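(* Let $G$ be a non-trivial finite group. Then $\kappa(G) \ge 1/4$ if and only if one of the following holds: (i) $|G| \le 4$; (ii) $G \cong A_4$, $S_4$, $A_5$ or $C_7 \rtimes C_3$; (iii) $G \cong A \rtimes C_2$ where $A$ is a non-trivial abelian group of odd order and the non-identity element of $C_2$ acts on $A$ by inversion.
   Context: For a finite group $G$, $\kappa(G)$ denotes the probability that $g$ and $h$ are conjugate in $G$, when $g,h\in G$ are chosen independently and uniformly at random from $G$. $A_n$ and $S_n$ are the alternating and symmetric groups of degree $n$, $C_m$ is the cyclic group of order $m$, and $C_7\rtimes C_3$ denotes the Frobenius group of order $21$, given by the presentation $\langle g,h : g^7 = h^3 = 1,\ g^h = g^2\rangle$, where $g^h = h^{-1}gh$. *)

theory Defs
  imports "HOL-Probability.Probability_Mass_Function" "HOL-Algebra.Algebra"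
begin

section \<open>The conjugacy probability\<close>

definition conjugate_in :: "('a, 'b) monoid_scheme \<Rightarrow> 'a \<Rightarrow> 'a \<Rightarrow> bool" where
  "conjugate_in G g h \<longleftrightarrow> (\<exists>x\<in>carrier G. h = inv\<^bsub>G\<^esub> x \<otimes>\<^bsub>G\<^esub> g \<otimes>\<^bsub>G\<^esub> x)"

definition kappa :: "('a, 'b) monoid_scheme \<Rightarrow> real" where
  "kappa G = measure_pmf.prob (pair_pmf (pmf_of_set (carrier G)) (pmf_of_set (carrier G)))
               {(g, h). conjugate_in G g h}"

lemma kappa_eq_card:
  assumes "group G" and fin: "finite (carrier G)"
  shows "kappa G =
    real (card {(g, h). g \<in> carrier G \<and> h \<in> carrier G \<and> conjugate_in G g h}) / real (Coset.order G) ^ 2"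
proof -
  interpret group G by fact
  have ne: "carrier G \<noteq> {}" by auto
  have "pair_pmf (pmf_of_set (carrier G)) (pmf_of_set (carrier G))
        = pmf_of_set (carrier G \<times> carrier G)"
    by (rule pmf_eqI) (auto simp: pmf_pair pmf_of_set[OF ne fin] pmf_of_set fin ne indicator_def)
  moreover have "(carrier G \<times> carrier G) \<inter> {(g, h). conjugate_in G g h}
        = {(g, h). g \<in> carrier G \<and> h \<in> carrier G \<and> conjugate_in G g h}"
    by auto
  ultimately show ?thesis
    using fin ne by (simp add: kappa_def measure_pmf_of_set Coset.order_def power2_eq_square)
qed


section \<open>Semidirect products\<close>

text \<open>
  \<open>\<phi>\<close> is a left action of \<open>H\<close> on \<open>A\<close> by automorphisms, so that in the product
  \<open>(1, h) (a, 1) (1, h)\<^sup>-\<^sup>1 = (\<phi> h a, 1)\<close>.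
\<close>

definition semidirect_product ::
  "('a, 'c) monoid_scheme \<Rightarrow> ('b, 'd) monoid_scheme \<Rightarrow> ('b \<Rightarrow> 'a \<Rightarrow> 'a) \<Rightarrow> ('a \<times> 'b) monoid" where
  "semidirect_product A H \<phi> =
     \<lparr> carrier = carrier A \<times> carrier H,
       mult = (\<lambda>(a, h) (b, k). (a \<otimes>\<^bsub>A\<^esub> \<phi> h b, h \<otimes>\<^bsub>H\<^esub> k)),
       one = (\<one>\<^bsub>A\<^esub>, \<one>\<^bsub>H\<^esub>) \<rparr>"

lemma group_semidirect_product:
  assumes "group A" "group H"
    and hom: "\<And>h. h \<in> carrier H \<Longrightarrow> \<phi> h \<in> hom A A"
    and one: "\<And>a. a \<in> carrier A \<Longrightarrow> \<phi> \<one>\<^bsub>H\<^esub> a = a"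
    and act: "\<And>h k a. \<lbrakk>h \<in> carrier H; k \<in> carrier H; a \<in> carrier A\<rbrakk>
                \<Longrightarrow> \<phi> (h \<otimes>\<^bsub>H\<^esub> k) a = \<phi> h (\<phi> k a)"
  shows "group (semidirect_product A H \<phi>)"
proof -
  interpret A: group A by fact
  interpret H: group H by fact
  have cl: "\<phi> h a \<in> carrier A" if "h \<in> carrier H" "a \<in> carrier A" for h a
    using hom[OF that(1)] that(2) by (auto simp: hom_def)
  have mu: "\<phi> h (a \<otimes>\<^bsub>A\<^esub> b) = \<phi> h a \<otimes>\<^bsub>A\<^esub> \<phi> h b"
    if "h \<in> carrier H" "a \<in> carrier A" "b \<in> carrier A" for h a b
    using hom[OF that(1)] that(2,3) by (auto simp: hom_def)
  show ?thesis
  proof (rule groupI)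
    fix x assume "x \<in> carrier (semidirect_product A H \<phi>)"
    then obtain a h where x: "x = (a, h)" "a \<in> carrier A" "h \<in> carrier H"
      by (auto simp: semidirect_product_def)
    let ?y = "(\<phi> (inv\<^bsub>H\<^esub> h) (inv\<^bsub>A\<^esub> a), inv\<^bsub>H\<^esub> h)"
    have "\<phi> (inv\<^bsub>H\<^esub> h) (inv\<^bsub>A\<^esub> a) \<otimes>\<^bsub>A\<^esub> \<phi> (inv\<^bsub>H\<^esub> h) a = \<phi> (inv\<^bsub>H\<^esub> h) \<one>\<^bsub>A\<^esub>"
      using mu[of "inv\<^bsub>H\<^esub> h" "inv\<^bsub>A\<^esub> a" a] x by simp
    also have "\<dots> = \<one>\<^bsub>A\<^esub>"
      using hom_one[OF hom[of "inv\<^bsub>H\<^esub> h"] A.is_group A.is_group] x by simp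
    finally have "?y \<otimes>\<^bsub>semidirect_product A H \<phi>\<^esub> x = \<one>\<^bsub>semidirect_product A H \<phi>\<^esub>"
      using x by (simp add: semidirect_product_def)
    moreover have "?y \<in> carrier (semidirect_product A H \<phi>)"
      using x cl by (simp add: semidirect_product_def)
    ultimately show "\<exists>y\<in>carrier (semidirect_product A H \<phi>).
        y \<otimes>\<^bsub>semidirect_product A H \<phi>\<^esub> x = \<one>\<^bsub>semidirect_product A H \<phi>\<^esub>" by blast
  qed (auto simp: semidirect_product_def cl one mu act A.m_assoc H.m_assoc)
qed

definition inversion_action :: "('a, 'c) monoid_scheme \<Rightarrow> int \<Rightarrow> 'a \<Rightarrow> 'a" where
  "inversion_action A k a = (if k = 0 then a else inv\<^bsub>A\<^esub> a)"

text \<open>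
  \<open>A \<rtimes> C\<^sub>2\<close>, where \<open>C\<^sub>2\<close> is \<open>{0, 1}\<close> under addition modulo 2 and \<open>1\<close> inverts \<open>A\<close>.
\<close>

definition inversion_extension :: "('a, 'c) monoid_scheme \<Rightarrow> ('a \<times> int) monoid" where
  "inversion_extension A = semidirect_product A (integer_mod_group 2) (inversion_action A)"

lemma group_inversion_extension:
  assumes "comm_group A"
  shows "group (inversion_extension A)"
proof -
  interpret A: comm_group A by fact
  show ?thesis
    unfolding inversion_extension_def
  proof (rule group_semidirect_product)
    fix h assume "h \<in> carrier (integer_mod_group 2)"
    show "inversion_action A h \<in> hom A A"
      by (auto simp: inversion_action_def hom_def A.inv_mult)
  next
    fix h k a
    assume "h \<in> carrier (integer_mod_group 2)" "k \<in> carrier (integer_mod_group 2)"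
      and a: "a \<in> carrier A"
    then have "h = 0 \<or> h = 1" "k = 0 \<or> k = 1"
      by (auto simp: carrier_integer_mod_group)
    then show "inversion_action A (h \<otimes>\<^bsub>integer_mod_group 2\<^esub> k) a
        = inversion_action A h (inversion_action A k a)"
      using a by (auto simp: inversion_action_def integer_mod_group_def)
  qed (auto simp: inversion_action_def A.is_group)
qed

text \<open>
  In \<open>G \<cong> A \<rtimes> C\<^sub>2\<close> the group \<open>A\<close> may be taken over the element type of \<open>G\<close>, so quantifying
  over \<open>A\<close> in that one type loses nothing.
\<close>

lemma inversion_extension_transfer:
  fixes G :: "('a, 'b) monoid_scheme" and A :: "('c, 'd) monoid_scheme"
  assumes "comm_group A" and iso: "G \<cong> inversion_extension A" and "group G"
  shows "\<exists>B :: 'a monoid. comm_group B \<and> B \<cong> A \<and> G \<cong> inversion_extension B"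
proof -
  interpret A: comm_group A by fact
  interpret G: group G by fact
  interpret E: group "inversion_extension A" by (rule group_inversion_extension) fact
  have "inversion_extension A \<cong> G" using G.iso_sym iso by blast
  then obtain f where f: "f \<in> iso (inversion_extension A) G" by (auto simp: is_iso_def)
  define e where "e = (\<lambda>a. f (a, 0 :: int))"
  have cE: "carrier (inversion_extension A) = carrier A \<times> {0, 1}"
    by (auto simp: inversion_extension_def semidirect_product_def carrier_integer_mod_group)
  have inj: "inj_on e (carrier A)"
    using f by (auto simp: e_def iso_def bij_betw_def inj_on_def cE)
  define B :: "'a monoid" where
    "B = \<lparr> carrier = e ` carrier A,
           mult = (\<lambda>x y. e (inv_into (carrier A) e x \<otimes>\<^bsub>A\<^esub> inv_into (carrier A) e y)),
           one = e \<one>\<^bsub>A\<^esub> \<rparr>"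
  have Be: "carrier B = e ` carrier A" "\<one>\<^bsub>B\<^esub> = e \<one>\<^bsub>A\<^esub>"
    "\<And>a b. \<lbrakk>a \<in> carrier A; b \<in> carrier A\<rbrakk> \<Longrightarrow> e a \<otimes>\<^bsub>B\<^esub> e b = e (a \<otimes>\<^bsub>A\<^esub> b)"
    using inj by (simp_all add: B_def)
  have eiso: "e \<in> iso A B"
    using inj by (auto simp: iso_def hom_def Be bij_betw_def)
  have cB: "comm_group B"
  proof (rule comm_groupI)
    fix x assume "x \<in> carrier B"
    then obtain a where a: "x = e a" "a \<in> carrier A" by (auto simp: Be)
    then have "e (inv\<^bsub>A\<^esub> a) \<otimes>\<^bsub>B\<^esub> x = \<one>\<^bsub>B\<^esub>" by (simp add: Be)
    moreover have "e (inv\<^bsub>A\<^esub> a) \<in> carrier B" using a by (simp add: Be)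
    ultimately show "\<exists>y\<in>carrier B. y \<otimes>\<^bsub>B\<^esub> x = \<one>\<^bsub>B\<^esub>" by blast
  next
    fix x y assume "x \<in> carrier B" "y \<in> carrier B"
    then show "x \<otimes>\<^bsub>B\<^esub> y = y \<otimes>\<^bsub>B\<^esub> x" by (auto simp: Be A.m_comm)
  qed (auto simp: Be A.m_assoc)
  interpret B: comm_group B by fact
  interpret e: group_hom A B e
    using eiso by unfold_locales (auto simp: iso_def)
  have act: "inversion_action B k (e a) = e (inversion_action A k a)" if "a \<in> carrier A" for k a
    using that by (simp add: inversion_action_def e.hom_inv)
  have acl: "inversion_action A k a \<in> carrier A" if "a \<in> carrier A" for k a
    using that by (simp add: inversion_action_def)
  let ?f = "\<lambda>p. (e (fst p), snd p) :: 'a \<times> int"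
  have "?f \<in> iso (inversion_extension A) (inversion_extension B)"
  proof (rule isoI)
    show "?f \<in> hom (inversion_extension A) (inversion_extension B)"
      by (rule homI)
         (auto simp: inversion_extension_def semidirect_product_def act acl)
    show "bij_betw ?f (carrier (inversion_extension A)) (carrier (inversion_extension B))"
      using inj
      by (auto simp: inversion_extension_def semidirect_product_def bij_betw_def Be(1) inj_on_def image_iff)
  qed
  then have "inversion_extension A \<cong> inversion_extension B" by (auto simp: is_iso_def)
  then have "G \<cong> inversion_extension B" using iso iso_trans by blast
  moreover have "B \<cong> A" using A.iso_sym eiso by (auto simp: is_iso_def)
  ultimately show ?thesis using cB by blast
qed


section \<open>Group presentations\<close>

text \<open>
  The group with generators the elements of \<open>'g\<close> and relators \<open>R\<close>: words in the letters
  \<open>x, x\<^sup>-\<^sup>1\<close> modulo the congruence generated by free cancellation and \<open>r = 1\<close> for \<open>r \<in> R\<close>.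
\<close>

datatype 'g letter = Gen 'g | Inv 'g

fun flip :: "'g letter \<Rightarrow> 'g letter" where
  "flip (Gen x) = Inv x"
| "flip (Inv x) = Gen x"

inductive word_eq :: "'g letter list set \<Rightarrow> 'g letter list \<Rightarrow> 'g letter list \<Rightarrow> bool"
  for R where
  refl: "word_eq R u u"
| sym: "word_eq R u v \<Longrightarrow> word_eq R v u"
| trans: "word_eq R u v \<Longrightarrow> word_eq R v w \<Longrightarrow> word_eq R u w"
| cong: "word_eq R u u' \<Longrightarrow> word_eq R v v' \<Longrightarrow> word_eq R (u @ v) (u' @ v')"
| cancel: "word_eq R [x, flip x] []"
| relator: "r \<in> R \<Longrightarrow> word_eq R r []"

definition word_class :: "'g letter list set \<Rightarrow> 'g letter list \<Rightarrow> 'g letter list set" where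
  "word_class R u = {v. word_eq R u v}"

definition presented_group :: "'g letter list set \<Rightarrow> 'g letter list set monoid" where
  "presented_group R =
     \<lparr> carrier = range (word_class R),
       mult = (\<lambda>U V. {w. \<exists>u\<in>U. \<exists>v\<in>V. word_eq R (u @ v) w}),
       one = word_class R [] \<rparr>"

lemma word_class_eq_iff: "word_class R u = word_class R v \<longleftrightarrow> word_eq R u v"
proof
  assume "word_class R u = word_class R v"
  moreover have "v \<in> word_class R v" by (simp add: word_class_def word_eq.refl)
  ultimately have "v \<in> word_class R u" by (simp only:)
  then show "word_eq R u v" by (simp add: word_class_def)
next
  assume "word_eq R u v"
  then have "word_eq R u w \<longleftrightarrow> word_eq R v w" for w
    using word_eq.trans[of R v u w] word_eq.trans[of R u v w] word_eq.sym[of R u v] by argo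
  then show "word_class R u = word_class R v" by (simp add: word_class_def)
qed

lemma word_class_mult:
  "word_class R u \<otimes>\<^bsub>presented_group R\<^esub> word_class R v = word_class R (u @ v)"
proof -
  have "word_eq R (u @ v) w"
    if "word_eq R u u'" "word_eq R v v'" "word_eq R (u' @ v') w" for u' v' w
    using word_eq.trans[OF word_eq.cong[OF that(1,2)] that(3)] .
  moreover have "word_eq R u u" "word_eq R v v" by (rule word_eq.refl)+
  ultimately have "{w. \<exists>u'\<in>word_class R u. \<exists>v'\<in>word_class R v. word_eq R (u' @ v') w}
      = word_class R (u @ v)"
    unfolding word_class_def by blast
  then show ?thesis by (simp add: presented_group_def)
qed

lemma word_eq_inverse: "word_eq R (rev (map flip u) @ u) []"
proof (induction u)
  case Nil
  show ?case by (simp add: word_eq.refl)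
next
  case (Cons x u)
  have ff: "flip (flip x) = x" by (cases x) auto
  have "word_eq R [flip x, x] []"
    using word_eq.cancel[of R "flip x"] by (simp only: ff)
  then have "word_eq R (rev (map flip u) @ ([flip x, x] @ u)) (rev (map flip u) @ ([] @ u))"
    by (intro word_eq.cong word_eq.refl)
  from word_eq.trans[OF this, of "[]"] Cons show ?case by simp
qed

lemma group_presented_group: "group (presented_group R)"
proof (rule groupI)
  have one: "\<one>\<^bsub>presented_group R\<^esub> = word_class R []" by (simp add: presented_group_def)
  fix x assume "x \<in> carrier (presented_group R)"
  then obtain u where "x = word_class R u" by (auto simp: presented_group_def)
  then have "word_class R (rev (map flip u)) \<otimes>\<^bsub>presented_group R\<^esub> x = \<one>\<^bsub>presented_group R\<^esub>"
    using word_eq_inverse[of R u] one by (simp add: word_class_mult word_class_eq_iff)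
  then show "\<exists>y\<in>carrier (presented_group R).
      y \<otimes>\<^bsub>presented_group R\<^esub> x = \<one>\<^bsub>presented_group R\<^esub>"
    by (auto simp: presented_group_def)
next
  fix x y assume "x \<in> carrier (presented_group R)" "y \<in> carrier (presented_group R)"
  then obtain u v where "x = word_class R u" "y = word_class R v"
    by (auto simp: presented_group_def)
  then have "x \<otimes>\<^bsub>presented_group R\<^esub> y = word_class R (u @ v)" by (simp add: word_class_mult)
  then show "x \<otimes>\<^bsub>presented_group R\<^esub> y \<in> carrier (presented_group R)"
    by (simp add: presented_group_def)
next
  fix x y z assume "x \<in> carrier (presented_group R)" "y \<in> carrier (presented_group R)"
    "z \<in> carrier (presented_group R)"
  then obtain u v w where "x = word_class R u" "y = word_class R v" "z = word_class R w"
    by (auto simp: presented_group_def)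
  then show "x \<otimes>\<^bsub>presented_group R\<^esub> y \<otimes>\<^bsub>presented_group R\<^esub> z
      = x \<otimes>\<^bsub>presented_group R\<^esub> (y \<otimes>\<^bsub>presented_group R\<^esub> z)"
    by (simp add: word_class_mult)
next
  fix x assume "x \<in> carrier (presented_group R)"
  then obtain u where "x = word_class R u" by (auto simp: presented_group_def)
  moreover have "\<one>\<^bsub>presented_group R\<^esub> = word_class R []" by (simp add: presented_group_def)
  ultimately show "\<one>\<^bsub>presented_group R\<^esub> \<otimes>\<^bsub>presented_group R\<^esub> x = x"
    by (simp add: word_class_mult)
next
  show "\<one>\<^bsub>presented_group R\<^esub> \<in> carrier (presented_group R)" by (simp add: presented_group_def)
qed

fun eval_letter :: "('a, 'b) monoid_scheme \<Rightarrow> ('g \<Rightarrow> 'a) \<Rightarrow> 'g letter \<Rightarrow> 'a" where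
  "eval_letter G \<rho> (Gen x) = \<rho> x"
| "eval_letter G \<rho> (Inv x) = inv\<^bsub>G\<^esub> (\<rho> x)"

fun eval_word :: "('a, 'b) monoid_scheme \<Rightarrow> ('g \<Rightarrow> 'a) \<Rightarrow> 'g letter list \<Rightarrow> 'a" where
  "eval_word G \<rho> [] = \<one>\<^bsub>G\<^esub>"
| "eval_word G \<rho> (l # w) = eval_letter G \<rho> l \<otimes>\<^bsub>G\<^esub> eval_word G \<rho> w"

text \<open>The universal property (existence part).\<close>

lemma presented_group_hom:
  assumes "group G" and \<rho>: "\<And>x. \<rho> x \<in> carrier G"
    and rel: "\<And>r. r \<in> R \<Longrightarrow> eval_word G \<rho> r = \<one>\<^bsub>G\<^esub>"
  obtains f where "f \<in> hom (presented_group R) G" "\<And>u. f (word_class R u) = eval_word G \<rho> u"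
proof -
  interpret group G by fact
  have lc: "eval_letter G \<rho> l \<in> carrier G" for l by (cases l) (auto simp: \<rho>)
  have wc: "eval_word G \<rho> u \<in> carrier G" for u by (induction u) (auto simp: lc)
  have app: "eval_word G \<rho> (u @ v) = eval_word G \<rho> u \<otimes>\<^bsub>G\<^esub> eval_word G \<rho> v" for u v
    by (induction u) (auto simp: lc wc m_assoc)
  have inv: "eval_word G \<rho> u = eval_word G \<rho> v" if "word_eq R u v" for u v
    using that
  proof induction
    case (cancel x)
    then show ?case by (cases x) (auto simp: \<rho>)
  qed (auto simp: app rel)
  define f where "f = (\<lambda>U. eval_word G \<rho> (SOME u. u \<in> U))"
  have f: "f (word_class R u) = eval_word G \<rho> u" for u
  proof -
    have "u \<in> word_class R u" by (simp add: word_class_def word_eq.refl)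
    then have "(SOME v. v \<in> word_class R u) \<in> word_class R u" by (rule someI)
    then show ?thesis using inv by (auto simp: f_def word_class_def)
  qed
  have "f \<in> hom (presented_group R) G"
  proof (rule homI)
    fix x assume "x \<in> carrier (presented_group R)"
    then show "f x \<in> carrier G" by (auto simp: presented_group_def f wc)
  next
    fix x y assume "x \<in> carrier (presented_group R)" "y \<in> carrier (presented_group R)"
    then obtain u v where "x = word_class R u" "y = word_class R v"
      by (auto simp: presented_group_def)
    then show "f (x \<otimes>\<^bsub>presented_group R\<^esub> y) = f x \<otimes>\<^bsub>G\<^esub> f y"
      by (simp add: word_class_mult f app)
  qed
  with f show thesis using that by blast
qed


section \<open>The Frobenius group of order 21\<close>

datatype frob_gen = gen_g | gen_h

text \<open>
  The relators \<open>g\<^sup>7\<close>, \<open>h\<^sup>3\<close> and \<open>h\<^sup>-\<^sup>1 g h g\<^sup>-\<^sup>2\<close>; the last one encodes \<open>g\<^sup>h = g\<^sup>2\<close>.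
\<close>

definition frobenius21 :: "frob_gen letter list set monoid" where
  "frobenius21 = presented_group
     {replicate 7 (Gen gen_g), replicate 3 (Gen gen_h),
      [Inv gen_h, Gen gen_g, Gen gen_h, Inv gen_g, Inv gen_g]}"

text \<open>
  The presentation does give \<open>C\<^sub>7 \<rtimes> C\<^sub>3\<close>, of order 21. As \<open>g\<^sup>h = g\<^sup>2\<close>, the left action of
  \<open>h\<close>, \<open>a \<mapsto> h a h\<^sup>-\<^sup>1\<close>, is multiplication by 4 on \<open>C\<^sub>7 = {0..<7}\<close>.
\<close>

definition C7_C3 :: "(int \<times> int) monoid" where
  "C7_C3 = semidirect_product (integer_mod_group 7) (integer_mod_group 3)
             (\<lambda>k a. 4 ^ nat k * a mod 7)"

lemma C7_C3_simps:
  "carrier C7_C3 = {0..<7} \<times> {0..<3}"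
  "(a, h) \<otimes>\<^bsub>C7_C3\<^esub> (b, k) = ((a + 4 ^ nat h * b mod 7) mod 7, (h + k) mod 3)"
  "\<one>\<^bsub>C7_C3\<^esub> = (0, 0)"
  by (simp_all add: C7_C3_def semidirect_product_def integer_mod_group_def)

lemma card_C7_C3: "card (carrier C7_C3) = 21"
  by (simp add: C7_C3_simps card_cartesian_product)

lemma group_C7_C3: "group C7_C3"
  unfolding C7_C3_def
proof (rule group_semidirect_product)
  fix h :: int
  show "(\<lambda>a. 4 ^ nat h * a mod 7) \<in> hom (integer_mod_group 7) (integer_mod_group 7)"
    by (auto simp: hom_def integer_mod_group_def mod_simps distrib_left)
next
  fix h k a :: int
  assume "h \<in> carrier (integer_mod_group 3)" "k \<in> carrier (integer_mod_group 3)"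
  then have "h \<in> {0, 1, 2}" "k \<in> {0, 1, 2}"
    by (auto simp: carrier_integer_mod_group)
  then have "4 ^ nat ((h + k) mod 3) mod 7 = 4 ^ nat h * 4 ^ nat k mod (7::int)"
    by (elim insertE emptyE; simp)
  then have "4 ^ nat ((h + k) mod 3) * a mod 7 = 4 ^ nat h * 4 ^ nat k * a mod 7"
    by (rule mod_mult_cong) simp
  then show "4 ^ nat (h \<otimes>\<^bsub>integer_mod_group 3\<^esub> k) * a mod 7
      = 4 ^ nat h * (4 ^ nat k * a mod 7) mod 7"
    by (simp add: integer_mod_group_def mod_mult_right_eq mult.assoc)
qed (auto simp: carrier_integer_mod_group)

lemma frobenius_relations_card_le:
  fixes P (structure)
  assumes "group P" and x: "x \<in> carrier P" and y: "y \<in> carrier P"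
    and x7: "x [^]\<^bsub>P\<^esub> (7::nat) = \<one>\<^bsub>P\<^esub>" and y3: "y [^]\<^bsub>P\<^esub> (3::nat) = \<one>\<^bsub>P\<^esub>"
    and rel: "inv\<^bsub>P\<^esub> y \<otimes>\<^bsub>P\<^esub> x \<otimes>\<^bsub>P\<^esub> y = x \<otimes>\<^bsub>P\<^esub> x"
    and gen: "generate P {x, y} = carrier P"
  shows "finite (carrier P)" "card (carrier P) \<le> 21"
proof -
  interpret group P by fact
  define S where "S = (\<lambda>(i::nat, j::nat). x [^] i \<otimes> y [^] j) ` ({..<7} \<times> {..<3})"
  have xm: "x [^] (n::nat) = x [^] (n mod 7)" for n
  proof -
    have "x [^] n = x [^] (7 * (n div 7) + n mod 7)" by simp
    also have "\<dots> = (x [^] (7::nat)) [^] (n div 7) \<otimes> x [^] (n mod 7)"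
      using x by (simp only: nat_pow_mult[symmetric] nat_pow_pow)
    finally show ?thesis using x x7 by (simp only: nat_pow_one l_one nat_pow_closed)
  qed
  have ym: "y [^] (n::nat) = y [^] (n mod 3)" for n
  proof -
    have "y [^] n = y [^] (3 * (n div 3) + n mod 3)" by simp
    also have "\<dots> = (y [^] (3::nat)) [^] (n div 3) \<otimes> y [^] (n mod 3)"
      using y by (simp only: nat_pow_mult[symmetric] nat_pow_pow)
    finally show ?thesis using y y3 by (simp only: nat_pow_one l_one nat_pow_closed)
  qed
  have S: "x [^] (i::nat) \<otimes> y [^] (j::nat) \<in> S" for i j
    unfolding S_def using xm[of i] ym[of j]
    by (intro image_eqI[of _ _ "(i mod 7, j mod 3)"]) auto
  have xy: "x \<otimes> y = y \<otimes> x [^] (2::nat)"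
  proof -
    have "y \<otimes> (inv y \<otimes> x \<otimes> y) = x \<otimes> y" using x y by (simp add: m_assoc[symmetric])
    then show ?thesis using x y rel by (simp add: numeral_2_eq_2)
  qed
  have xny: "x [^] (n::nat) \<otimes> y = y \<otimes> x [^] (2 * n)" for n
  proof (induction n)
    case (Suc n)
    have "x [^] Suc n \<otimes> y = x [^] n \<otimes> (x \<otimes> y)" using x y by (simp add: m_assoc)
    also have "\<dots> = (x [^] n \<otimes> y) \<otimes> x [^] (2::nat)" using x y by (simp add: xy m_assoc)
    also have "\<dots> = y \<otimes> x [^] (2 * n + 2)" using x y Suc by (simp only: m_assoc nat_pow_closed nat_pow_mult)
    finally show ?case by simp
  qed (use x y in simp)
  have yx: "y \<otimes> x [^] (n::nat) = x [^] (4 * n) \<otimes> y" for n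
  proof -
    have "8 * n mod 7 = n mod 7" by presburger
    then have "x [^] (8 * n) = x [^] n" using xm[of "8 * n"] xm[of n] by (simp only:)
    then show ?thesis using xny[of "4 * n"] by simp
  qed
  have mx: "x \<otimes> s \<in> S" if s: "s \<in> S" for s
  proof -
    obtain i j where "s = x [^] (i::nat) \<otimes> y [^] (j::nat)" using s by (auto simp: S_def)
    then have "x \<otimes> s = x [^] Suc i \<otimes> y [^] j"
      unfolding nat_pow_Suc2[OF x] using x y by (simp add: m_assoc)
    then show ?thesis using S by (simp only:)
  qed
  have my: "y \<otimes> s \<in> S" if s: "s \<in> S" for s
  proof -
    obtain i j where "s = x [^] (i::nat) \<otimes> y [^] (j::nat)" using s by (auto simp: S_def)
    then have "y \<otimes> s = (y \<otimes> x [^] i) \<otimes> y [^] j" using x y by (simp add: m_assoc)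
    also have "\<dots> = x [^] (4 * i) \<otimes> y [^] Suc j"
      unfolding yx nat_pow_Suc2[OF y] using x y by (simp add: m_assoc)
    finally show ?thesis using S by (simp only:)
  qed
  have Sc: "S \<subseteq> carrier P" using x y by (auto simp: S_def)
  have pow: "z [^] (n::nat) \<otimes> s \<in> S"
    if z: "z \<in> carrier P" "\<And>s. s \<in> S \<Longrightarrow> z \<otimes> s \<in> S" and s: "s \<in> S" for z n s
    using s
  proof (induction n arbitrary: s)
    case (Suc n)
    have "z [^] Suc n \<otimes> s = z [^] n \<otimes> (z \<otimes> s)" using z Suc.prems Sc by (auto simp: m_assoc)
    then show ?case using Suc z by simp
  qed (use Sc in auto)
  have "x [^] (6::nat) \<otimes> x = \<one>" "y [^] (2::nat) \<otimes> y = \<one>"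
    using x7 y3 nat_pow_Suc[of x 6] nat_pow_Suc[of y 2] by simp_all
  then have inv: "inv x = x [^] (6::nat)" "inv y = y [^] (2::nat)"
    using x y by (auto intro: inv_equality)
  have main: "\<forall>s\<in>S. z \<otimes> s \<in> S" if "z \<in> generate P {x, y}" for z
    using that
  proof induction
    case one
    then show ?case using Sc by auto
  next
    case (incl h)
    then show ?case using mx my by auto
  next
    case (inv h)
    then show ?case using pow[OF x mx] pow[OF y my] \<open>inv x = _\<close> \<open>inv y = _\<close> by auto
  next
    case (eng h1 h2)
    have "h1 \<in> carrier P" "h2 \<in> carrier P"
      using eng.hyps gen by auto
    then show ?case using eng.IH Sc by (auto simp: m_assoc subset_iff)
  qed
  have "\<one> \<in> S" using S[of 0 0] by simp
  then have "z \<in> S" if "z \<in> carrier P" for z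
    using main[of z] gen that by force
  then have "carrier P = S" using Sc by auto
  moreover have "finite S" by (simp add: S_def)
  moreover have "card S \<le> card ({..<7::nat} \<times> {..<3::nat})"
    unfolding S_def by (rule card_image_le) simp
  ultimately show "finite (carrier P)" "card (carrier P) \<le> 21" by simp_all
qed

lemma frobenius21_iso: "frobenius21 \<cong> C7_C3"
proof -
  define R where "R = {replicate 7 (Gen gen_g), replicate 3 (Gen gen_h),
      [Inv gen_h, Gen gen_g, Gen gen_h, Inv gen_g, Inv gen_g]}"
  have F: "frobenius21 = presented_group R" by (simp add: frobenius21_def R_def)
  interpret P: group "presented_group R" by (rule group_presented_group)
  interpret C: group C7_C3 by (rule group_C7_C3)
  define c where "c = (\<lambda>u. word_class R u)"
  have cm: "c u \<otimes>\<^bsub>presented_group R\<^esub> c v = c (u @ v)" for u v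
    by (simp add: c_def word_class_mult)
  have cc: "c u \<in> carrier (presented_group R)" for u
    by (simp add: c_def presented_group_def)
  have c1: "\<one>\<^bsub>presented_group R\<^esub> = c []" by (simp add: c_def presented_group_def)
  have cinv: "inv\<^bsub>presented_group R\<^esub> (c [Gen a]) = c [Inv a]" for a
  proof (rule P.inv_equality)
    show "c [Inv a] \<otimes>\<^bsub>presented_group R\<^esub> c [Gen a] = \<one>\<^bsub>presented_group R\<^esub>"
      using word_eq.cancel[of R "Inv a"] by (simp add: cm c1) (simp add: c_def word_class_eq_iff)
  qed (rule cc)+
  let ?x = "c [Gen gen_g]" and ?y = "c [Gen gen_h]"
  have cpow: "c [l] [^]\<^bsub>presented_group R\<^esub> n = c (replicate n l)" for l and n :: nat
    by (induction n) (simp_all add: c1 cm replicate_append_same)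
  have r: "c u = c []" if "u \<in> R" for u
    using word_eq.relator[OF that] by (simp add: c_def word_class_eq_iff)
  have x7: "?x [^]\<^bsub>presented_group R\<^esub> (7::nat) = \<one>\<^bsub>presented_group R\<^esub>"
    unfolding cpow c1 by (rule r) (simp add: R_def)
  have y3: "?y [^]\<^bsub>presented_group R\<^esub> (3::nat) = \<one>\<^bsub>presented_group R\<^esub>"
    unfolding cpow c1 by (rule r) (simp add: R_def)
  let ?a = "inv\<^bsub>presented_group R\<^esub> ?y \<otimes>\<^bsub>presented_group R\<^esub> ?x \<otimes>\<^bsub>presented_group R\<^esub> ?y"
    and ?b = "?x \<otimes>\<^bsub>presented_group R\<^esub> ?x"
  have "?a \<otimes>\<^bsub>presented_group R\<^esub> inv\<^bsub>presented_group R\<^esub> ?b = c []"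
  proof -
    have "[Inv gen_h, Gen gen_g, Gen gen_h, Inv gen_g, Inv gen_g] \<in> R" by (simp add: R_def)
    note r[OF this]
    moreover have "inv\<^bsub>presented_group R\<^esub> ?b = c [Inv gen_g, Inv gen_g]"
      using cm[of "[Inv gen_g]" "[Inv gen_g]"] by (simp add: P.inv_mult_group cc cinv)
    ultimately show ?thesis by (simp add: cinv cm)
  qed
  then have rel: "?a = ?b"
    using P.inv_solve_right[of "\<one>\<^bsub>presented_group R\<^esub>" ?a ?b] cc by (simp add: c1[symmetric])
  have gen: "generate (presented_group R) {?x, ?y} = carrier (presented_group R)"
  proof
    show "generate (presented_group R) {?x, ?y} \<subseteq> carrier (presented_group R)"
      by (rule P.generate_incl) (simp add: cc)
    have "c u \<in> generate (presented_group R) {?x, ?y}" for u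
    proof (induction u)
      case Nil
      then show ?case using generate.one[of "presented_group R"] by (simp add: c1)
    next
      case (Cons l u)
      have "c [Gen a] \<in> {?x, ?y}" for a by (cases a) auto
      then have "c [l] \<in> generate (presented_group R) {?x, ?y}"
        using generate.incl[of _ _ "presented_group R"] generate.inv[of _ _ "presented_group R"]
        by (cases l) (metis cinv)+
      then show ?case using generate.eng[OF _ Cons] cm[of "[l]" u] by fastforce
    qed
    then show "carrier (presented_group R) \<subseteq> generate (presented_group R) {?x, ?y}"
      by (auto simp: presented_group_def c_def)
  qed
  note le = frobenius_relations_card_le[OF P.is_group cc cc x7 y3 rel gen]
  define \<rho> :: "frob_gen \<Rightarrow> int \<times> int" where
    "\<rho> = (\<lambda>a. case a of gen_g \<Rightarrow> (1, 0) | gen_h \<Rightarrow> (0, 1))"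
  have rho: "\<rho> gen_g = (1, 0)" "\<rho> gen_h = (0, 1)" by (simp_all add: \<rho>_def)
  have ig: "inv\<^bsub>C7_C3\<^esub> (1, 0) = (6, 0)" and ih: "inv\<^bsub>C7_C3\<^esub> (0, 1) = (0, 2)"
    by (rule C.inv_equality; simp add: C7_C3_simps)+
  have rhoc: "\<rho> a \<in> carrier C7_C3" for a by (cases a) (simp_all add: rho C7_C3_simps)
  have relC: "eval_word C7_C3 \<rho> r = \<one>\<^bsub>C7_C3\<^esub>" if "r \<in> R" for r
    using that by (auto simp: R_def rho ig ih C7_C3_simps numeral_eq_Suc)
  obtain f where f: "f \<in> hom (presented_group R) C7_C3"
    and fe: "\<And>u. f (word_class R u) = eval_word C7_C3 \<rho> u"
    using presented_group_hom[OF C.is_group rhoc relC] by metis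
  have e1: "eval_word C7_C3 \<rho> (replicate j (Gen gen_h)) = (0, int j mod 3)" for j
    by (induction j) (auto simp: rho C7_C3_simps mod_simps)
  have e2: "eval_word C7_C3 \<rho> (replicate i (Gen gen_g) @ replicate j (Gen gen_h))
      = (int i mod 7, int j mod 3)" for i j
    by (induction i) (auto simp: rho C7_C3_simps e1 mod_simps)
  have surj: "carrier C7_C3 \<subseteq> f ` carrier (presented_group R)"
  proof
    fix p assume "p \<in> carrier C7_C3"
    then obtain i j where "p = (i, j)" "0 \<le> i" "i < 7" "0 \<le> j" "j < 3"
      by (auto simp: C7_C3_simps)
    then have "p = f (word_class R (replicate (nat i) (Gen gen_g) @ replicate (nat j) (Gen gen_h)))"
      by (simp add: fe e2)
    then show "p \<in> f ` carrier (presented_group R)" by (auto simp: presented_group_def)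
  qed
  then have im: "f ` carrier (presented_group R) = carrier C7_C3"
    using f by (auto simp: hom_def)
  then have "card (f ` carrier (presented_group R)) = card (carrier (presented_group R))"
    using card_image_le[OF le(1), of f] le(2) card_C7_C3 by simp
  then have "inj_on f (carrier (presented_group R))" by (rule eq_card_imp_inj_on[OF le(1)])
  then have "f \<in> iso (presented_group R) C7_C3"
    using f im by (simp add: iso_def bij_betw_def)
  then show ?thesis by (auto simp: F is_iso_def)
qed

end

theory Submission
  imports Defs "HOL-Number_Theory.Cong"
begin

text \<open>
  Write \<open>c(g)\<close> for the order of the centralizer of \<open>g\<close>. The class of \<open>g\<close> has \<open>|G| /
  c(g)\<close> elements, so \<open>\<kappa>(G)\<close> is the average of \<open>1 / c(g)\<close> over \<open>g\<close>
  (\<open>kappa_sum\<close>), and a class on which \<open>c\<close> takes the value \<open>m\<close> contributes \<open>1 /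
  m\<^sup>2\<close> to it. For the groups in the list it is enough to exhibit a few classes whose contributions add up to
  \<open>1/4\<close>, and for \<open>|G| \<le> 4\<close> the trivial bound \<open>\<kappa>(G) \<ge> 1 / |G|\<close> suffices.

  Conversely let \<open>\<kappa>(G) \<ge> 1/4\<close> and \<open>|G| > 4\<close>. As the identity contributes less than average,
  some \<open>x\<close> has \<open>c(x) \<le> 3\<close>. If an involution \<open>t\<close> has \<open>c(t) = 2\<close>, then its
  class is half of \<open>G\<close>, and the other half is a subgroup inverted by \<open>t\<close>, so it is abelian, and of odd
  order because \<open>t\<close> fixes only its identity. This is \<open>centralizer_order_2_imp_inversion_extension\<close>.

  Otherwise \<open>c(x) = 3\<close>, and every element of order 3 is conjugate to \<open>x\<close> or
  \<open>x\<^sup>-\<^sup>1\<close> (\<open>order_3_conjugate\<close>). Suppose first that \<open>x\<close> is not conjugate to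
  \<open>x\<^sup>-\<^sup>1\<close>. Then the classes \<open>K\<close> of \<open>x\<close> and \<open>L\<close> of
  \<open>x\<^sup>-\<^sup>1\<close> and the rest \<open>N\<close> have \<open>|G| / 3\<close> elements each. The relations of the
  Euclidean triangle group \<open>(3,3,3)\<close> show that a product of two elements of \<open>K\<close> is never in
  \<open>K\<close> (\<open>KK_notin_K\<close>), so that \<open>K\<close>, \<open>L\<close>, \<open>N\<close> are the cosets of a
  normal subgroup \<open>N\<close>, on which \<open>x\<close> acts without fixed points. Now \<open>(x a)\<^sup>3 = 1\<close> for
  all \<open>a \<in> N\<close>, and hence each \<open>a \<in> N\<close> commutes with all its conjugates
  (\<open>conj_commute\<close>). The bound on \<open>\<kappa>\<close> leaves some \<open>1 \<noteq> a \<in> N\<close> with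
  \<open>c(a) \<le> 12\<close>, and the subgroup generated by the class of \<open>a\<close>, which lies in the centralizer of
  \<open>a\<close>, is then so small that \<open>|N|\<close> is 4 or 7 (\<open>card_N_bound\<close>, \<open>card_N_ne_10\<close>).
  This gives \<open>A\<^sub>4\<close> and \<open>C\<^sub>7 \<rtimes> C\<^sub>3\<close>.

  Suppose now that \<open>x\<close> is conjugate to \<open>x\<^sup>-\<^sup>1\<close>. The two thirds of \<open>G\<close> outside
  the class of \<open>x\<close> still have to contribute \<open>5/36\<close>, so there is \<open>z\<close> with \<open>c(z) =
  4\<close>. If there is a second class with \<open>c(w) = 4\<close>, then \<open>z\<close> and \<open>w\<close> cannot both act
  by even permutations in all coset actions (\<open>odd_sign_exists\<close>), so \<open>G\<close> has a subgroup \<open>H\<close>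
  of index 2. Counting shows that \<open>H\<close> is the complement of the classes of \<open>z\<close> and \<open>w\<close> and
  that \<open>x\<close> is not conjugate to its inverse in \<open>H\<close>. The previous case applies to \<open>H\<close> and
  yields \<open>|G| = 24\<close> and \<open>G \<cong> S\<^sub>4\<close> (\<open>two_classes_4_imp_sym_group\<close>).

  If the class of \<open>z\<close> is the only one with \<open>c = 4\<close>, then there are two classes with \<open>c =
  5\<close>, and the class sizes found so far cover all but one sixtieth of \<open>G\<close>, as in \<open>A\<^sub>5\<close>. If
  \<open>z\<close> is an involution, then at most \<open>c(z)\<close> conjugates \<open>s\<close> of \<open>z\<close> have the
  product \<open>z s\<close> in a given class (\<open>card_involution_products_le\<close>); this bounds the class of
  \<open>z\<close> and leaves only \<open>|G| = 60\<close>, where the action on the five cosets of the normalizer of a Klein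
  four-group identifies \<open>A\<^sub>5\<close>. If \<open>z\<close> has order 4, put \<open>t = z\<^sup>2\<close> and let
  \<open>k\<close> run through the class of \<open>x\<close>. When the order of \<open>t k\<close> is 3, 4 or 5, then
  \<open>t\<close> and \<open>k\<close> satisfy the relations of the triangle groups \<open>(2,3,3)\<close>,
  \<open>(2,3,4)\<close>, \<open>(2,3,5)\<close>, that is of \<open>A\<^sub>4\<close>, \<open>S\<^sub>4\<close>,
  \<open>A\<^sub>5\<close>. These relations bound the number of such \<open>k\<close> in terms of the involutions and their
  centralizers, and the bounds add up to less than \<open>|G| / 3\<close> (\<open>order_4_impossible\<close>).
\<close>

section \<open>Fibres and fixed points\<close>

lemma card_eq_sum_fibres:
  assumes "finite A" "finite B" "f ` A \<subseteq> B"
  shows "card A = (\<Sum>b\<in>B. card {a \<in> A. f a = b})"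
  using sum.group[OF assms, of "\<lambda>_. 1::nat"] by simp

lemma card_le_fibres:
  assumes "finite A" "finite B" "f ` A \<subseteq> B" "\<And>b. b \<in> B \<Longrightarrow> card {a \<in> A. f a = b} \<le> m"
  shows "card A \<le> card B * m"
  using card_eq_sum_fibres[OF assms(1-3)] sum_bounded_above[of B "\<lambda>b. card {a \<in> A. f a = b}" m] assms(4)
  by simp

text \<open>
  The points that are not fixed fall into cycles of length exactly \<open>p\<close>, because the length of a cycle divides the
  prime \<open>p\<close>. The induction removes one such cycle at a time.
\<close>

lemma card_fixed_points_cong:
  fixes f :: "'a \<Rightarrow> 'a" and p :: nat
  assumes p: "Factorial_Ring.prime p" and "finite S" and "f ` S \<subseteq> S" and "\<And>s. s \<in> S \<Longrightarrow> (f ^^ p) s = s"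
  shows "[card S = card {s \<in> S. f s = s}] (mod p)"
  using assms(2-4)
proof (induction "card S" arbitrary: S rule: less_induct)
  case less
  show ?case
  proof (cases "\<forall>s\<in>S. f s = s")
    case True
    then have "{s \<in> S. f s = s} = S" by auto
    then show ?thesis by simp
  next
    case False
    then obtain s where s: "s \<in> S" "f s \<noteq> s" by auto
    define orb where "orb = (\<lambda>i. (f ^^ i) s) ` {..<p}"
    have iter: "(f ^^ i) s \<in> S" for i
      using s less.prems(2) by (induction i) auto
    have fa: "(f ^^ (a + b)) u = (f ^^ a) ((f ^^ b) u)" for a b u
      by (simp add: funpow_add)
    have mult: "(f ^^ (k * m)) s = s" if "(f ^^ m) s = s" for k m
      using that by (induction k) (simp_all add: fa add.commute[of m])
    note per = mult[OF less.prems(3)[OF s(1)]]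
    have inj: "inj_on (\<lambda>i. (f ^^ i) s) {..<p}"
    proof (rule linorder_inj_onI)
      fix i j assume ij: "i < j" "i \<in> {..<p}" "j \<in> {..<p}"
      show "(f ^^ i) s \<noteq> (f ^^ j) s"
      proof
        assume e: "(f ^^ i) s = (f ^^ j) s"
        have "(f ^^ (j - i)) s = (f ^^ (j - i)) ((f ^^ p) s)" using less.prems(3)[OF s(1)] by simp
        also have "\<dots> = (f ^^ ((p - i) + j)) s" using ij by (simp add: fa[symmetric] add.commute)
        also have "\<dots> = (f ^^ ((p - i) + i)) s" by (simp only: fa e)
        also have "\<dots> = s" using ij less.prems(3)[OF s(1)] by simp
        finally have dk: "(f ^^ (k * (j - i))) s = s" for k by (rule mult)
        have "coprime (j - i) p"
          using prime_imp_coprime[OF p, of "j - i"] ij nat_dvd_not_less[of "j - i" p]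
          by (auto simp: coprime_commute)
        then obtain a b where "a * (j - i) = b * p + 1"
          using coprime_bezout_strong[of "j - i" p] p by (metis mult.commute not_prime_1)
        then have "f s = s"
          using dk[of a] per[of b] by (simp add: fa)
        with s show False by simp
      qed
    qed auto
    then have cO: "card orb = p" by (simp add: orb_def card_image)
    have OS: "orb \<subseteq> S" using iter by (auto simp: orb_def)
    have fO: "f ` (S - orb) \<subseteq> S - orb"
    proof
      fix y assume "y \<in> f ` (S - orb)"
      then obtain u where u: "u \<in> S" "u \<notin> orb" "y = f u" by auto
      have "f u \<notin> orb"
      proof
        assume "f u \<in> orb"
        then obtain i where i: "i < p" "f u = (f ^^ i) s" by (auto simp: orb_def)
        have "u = (f ^^ (p - 1)) (f u)"
          using less.prems(3)[OF u(1)] prime_gt_0_nat[OF p] fa[of "p - 1" 1 u] by simp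
        also have "\<dots> = (f ^^ (p - 1 + i)) s" using i by (simp only: fa)
        finally have ue: "u = (f ^^ (p - 1 + i)) s" .
        have "u \<in> orb"
        proof (cases "i = 0")
          case True
          then show ?thesis using ue p prime_gt_0_nat[OF p] unfolding orb_def by auto
        next
          case False
          then have "p - 1 + i = (i - 1) + p" using prime_gt_0_nat[OF p] by linarith
          then have "u = (f ^^ (i - 1)) s" using ue per[of 1] by (simp add: funpow_add)
          then show ?thesis using i(1) unfolding orb_def by auto
        qed
        with u show False by simp
      qed
      then show "y \<in> S - orb" using u less.prems(2) by auto
    qed
    have noO: "f u \<noteq> u" if "u \<in> orb" for u
    proof
      assume a: "f u = u"
      obtain i where i: "i < p" "u = (f ^^ i) s" using \<open>u \<in> orb\<close> by (auto simp: orb_def)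
      have st: "(f ^^ k) u = u" for k using a by (induction k) auto
      have "s = (f ^^ (p - i)) u" using i less.prems(3)[OF s(1)] by (simp add: fa[symmetric])
      then have "s = u" using st by simp
      with a s show False by simp
    qed
    have cS: "card S = card (S - orb) + p"
      using cO OS less.prems(1) by (simp add: card_Diff_subset finite_subset card_mono)
        (metis cO card_mono le_add_diff_inverse2)
    have "[card (S - orb) = card {u \<in> S - orb. f u = u}] (mod p)"
      by (rule less.hyps) (use cS prime_gt_0_nat[OF p] less.prems fO in auto)
    moreover have "{u \<in> S - orb. f u = u} = {u \<in> S. f u = u}" using noO by auto
    ultimately show ?thesis unfolding cS by (simp add: cong_def)
  qed
qed

section \<open>Centralizers, conjugacy classes and the conjugacy probability\<close>

locale finite_grp = group +
  assumes finite_carrier [simp, intro]: "finite (carrier G)"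
begin

definition cent :: "'a \<Rightarrow> 'a set" where
  "cent g = {h \<in> carrier G. h \<otimes> g = g \<otimes> h}"

definition cl :: "'a \<Rightarrow> 'a set" where
  "cl g = (\<lambda>y. y \<otimes> g \<otimes> inv y) ` carrier G"

lemma finite_cent [simp]: "finite (cent g)" by (simp add: cent_def)
lemma finite_cl [simp]: "finite (cl g)" by (simp add: cl_def)
lemma cent_sub: "cent g \<subseteq> carrier G" by (auto simp: cent_def)
lemma cl_sub: "g \<in> carrier G \<Longrightarrow> cl g \<subseteq> carrier G" by (auto simp: cl_def)
lemma clD: "g \<in> carrier G \<Longrightarrow> h \<in> cl g \<Longrightarrow> h \<in> carrier G" by (auto simp: cl_def)

lemma inv_cancel_left [simp]: "\<lbrakk>y \<in> carrier G; a \<in> carrier G\<rbrakk> \<Longrightarrow> inv y \<otimes> (y \<otimes> a) = a"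
  by (simp add: m_assoc[symmetric])

lemma mult_inv_cancel_left [simp]: "\<lbrakk>y \<in> carrier G; a \<in> carrier G\<rbrakk> \<Longrightarrow> y \<otimes> (inv y \<otimes> a) = a"
  by (simp add: m_assoc[symmetric])

lemma conj_mult: "\<lbrakk>y \<in> carrier G; a \<in> carrier G; b \<in> carrier G\<rbrakk> \<Longrightarrow>
    (y \<otimes> a \<otimes> inv y) \<otimes> (y \<otimes> b \<otimes> inv y) = y \<otimes> (a \<otimes> b) \<otimes> inv y"
  by (simp add: m_assoc)

lemma conj_conj: "\<lbrakk>y \<in> carrier G; z \<in> carrier G; a \<in> carrier G\<rbrakk> \<Longrightarrow>
    y \<otimes> (z \<otimes> a \<otimes> inv z) \<otimes> inv y = (y \<otimes> z) \<otimes> a \<otimes> inv (y \<otimes> z)"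
  by (simp add: m_assoc inv_mult_group)

lemma conj_eq_iff: "\<lbrakk>y \<in> carrier G; a \<in> carrier G; b \<in> carrier G\<rbrakk> \<Longrightarrow>
    y \<otimes> a \<otimes> inv y = b \<longleftrightarrow> y \<otimes> a = b \<otimes> y"
  by (metis inv_closed inv_solve_right m_closed)

lemma conj_inj: "\<lbrakk>y \<in> carrier G; a \<in> carrier G; b \<in> carrier G\<rbrakk> \<Longrightarrow>
    y \<otimes> a \<otimes> inv y = y \<otimes> b \<otimes> inv y \<longleftrightarrow> a = b"
  by simp

lemma conj_inv: "\<lbrakk>y \<in> carrier G; a \<in> carrier G\<rbrakk> \<Longrightarrow>
    y \<otimes> inv a \<otimes> inv y = inv (y \<otimes> a \<otimes> inv y)"
  by (simp add: m_assoc inv_mult_group)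

lemma conj_pow: "\<lbrakk>y \<in> carrier G; a \<in> carrier G\<rbrakk> \<Longrightarrow>
    (y \<otimes> a \<otimes> inv y) [^] (m::nat) = y \<otimes> a [^] m \<otimes> inv y"
  by (induction m) (simp_all add: conj_mult)

lemma cl_self: "g \<in> carrier G \<Longrightarrow> g \<in> cl g"
  unfolding cl_def by (rule image_eqI[of _ _ \<one>]) auto

lemma cl_conj: "\<lbrakk>g \<in> carrier G; h \<in> cl g; y \<in> carrier G\<rbrakk> \<Longrightarrow> y \<otimes> h \<otimes> inv y \<in> cl g"
  unfolding cl_def by (auto simp: conj_conj)

lemma cl_sym: "g \<in> carrier G \<Longrightarrow> h \<in> cl g \<Longrightarrow> g \<in> cl h"
proof -
  assume g: "g \<in> carrier G" and "h \<in> cl g"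
  then obtain y where y: "y \<in> carrier G" "h = y \<otimes> g \<otimes> inv y" by (auto simp: cl_def)
  then have "g = inv y \<otimes> h \<otimes> inv (inv y)" using g by (simp add: m_assoc inv_solve_left)
  then show ?thesis using y unfolding cl_def by blast
qed

lemma cl_eq: "g \<in> carrier G \<Longrightarrow> h \<in> cl g \<Longrightarrow> cl h = cl g"
proof -
  assume g: "g \<in> carrier G" and h: "h \<in> cl g"
  have "cl a \<subseteq> cl b" if "b \<in> carrier G" "a \<in> cl b" for a b
    using that cl_conj[OF that] by (auto simp: cl_def)
  then show ?thesis using g h cl_sym[OF g h] clD[OF g h] by blast
qed

lemma cl_disjoint: "\<lbrakk>g \<in> carrier G; h \<in> carrier G; h \<notin> cl g\<rbrakk> \<Longrightarrow> cl g \<inter> cl h = {}"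
  using cl_eq cl_self by blast

lemma conj_cent_iff: "\<lbrakk>g \<in> carrier G; a \<in> carrier G; b \<in> carrier G\<rbrakk> \<Longrightarrow>
    g \<otimes> b \<otimes> inv g \<in> cent (g \<otimes> a \<otimes> inv g) \<longleftrightarrow> b \<in> cent a"
  by (simp add: cent_def conj_mult)

lemma cent_subgroup: "g \<in> carrier G \<Longrightarrow> subgroup (cent g) G"
proof (rule subgroupI)
  assume g: "g \<in> carrier G"
  show "cent g \<subseteq> carrier G" by (rule cent_sub)
  show "cent g \<noteq> {}" using g by (auto simp: cent_def)
  fix a b assume a: "a \<in> cent g" and b: "b \<in> cent g"
  have ac: "a \<in> carrier G" using a by (simp add: cent_def)
  have "inv a \<otimes> g = inv a \<otimes> (g \<otimes> a) \<otimes> inv a" using ac g by (simp add: m_assoc)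
  also have "\<dots> = inv a \<otimes> (a \<otimes> g) \<otimes> inv a" using a by (simp add: cent_def)
  also have "\<dots> = g \<otimes> inv a" using ac g by (simp add: m_assoc)
  finally show "inv a \<in> cent g" using ac by (simp add: cent_def)
  have c: "a \<in> carrier G" "b \<in> carrier G" using a b by (auto simp: cent_def)
  have "a \<otimes> b \<otimes> g = a \<otimes> (b \<otimes> g)" using c g by (simp add: m_assoc)
  also have "\<dots> = a \<otimes> g \<otimes> b" using b c g by (simp add: cent_def m_assoc)
  also have "\<dots> = g \<otimes> (a \<otimes> b)" using a c g by (simp add: cent_def m_assoc)
  finally show "a \<otimes> b \<in> cent g" using a b by (simp add: cent_def)
qed

lemma cent_self: "g \<in> carrier G \<Longrightarrow> g \<in> cent g" by (auto simp: cent_def)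
lemma cent_one: "g \<in> carrier G \<Longrightarrow> \<one> \<in> cent g" by (auto simp: cent_def)
lemma cent_of_one: "cent \<one> = carrier G" by (auto simp: cent_def)
lemma cent_sym: "\<lbrakk>g \<in> carrier G; h \<in> cent g\<rbrakk> \<Longrightarrow> g \<in> cent h" by (auto simp: cent_def)
lemma cent_closed: "h \<in> cent g \<Longrightarrow> h \<in> carrier G" by (auto simp: cent_def)

text \<open>
  The conjugators that take \<open>g\<close> to a fixed conjugate form a coset of the centralizer. Most counts below rest on this
  in the form of a bound for the fibres of some map.
\<close>

lemma conj_fibre:
  assumes g: "g \<in> carrier G" and h: "h \<in> cl g"
  shows "card {y \<in> carrier G. y \<otimes> g \<otimes> inv y = h} = card (cent g)"
proof -
  obtain z where z: "z \<in> carrier G" "h = z \<otimes> g \<otimes> inv z" using h by (auto simp: cl_def)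
  have "bij_betw (\<lambda>y. z \<otimes> y) (cent g) {y \<in> carrier G. y \<otimes> g \<otimes> inv y = h}"
  proof (rule bij_betwI[where g = "\<lambda>y. inv z \<otimes> y"])
    show "(\<otimes>) z \<in> cent g \<rightarrow> {y \<in> carrier G. y \<otimes> g \<otimes> inv y = h}"
    proof
      fix y assume "y \<in> cent g"
      then have y: "y \<in> carrier G" "y \<otimes> g \<otimes> inv y = g" using g conj_eq_iff[of y g g] by (auto simp: cent_def)
      then have "z \<otimes> y \<otimes> g \<otimes> inv (z \<otimes> y) = h"
        using z g conj_conj[of z y g] by simp
      then show "z \<otimes> y \<in> {y \<in> carrier G. y \<otimes> g \<otimes> inv y = h}" using y z by simp
    qed
    show "(\<otimes>) (inv z) \<in> {y \<in> carrier G. y \<otimes> g \<otimes> inv y = h} \<rightarrow> cent g"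
    proof
      fix y assume "y \<in> {y \<in> carrier G. y \<otimes> g \<otimes> inv y = h}"
      then have y: "y \<in> carrier G" "y \<otimes> g \<otimes> inv y = h" by auto
      have "(inv z \<otimes> y) \<otimes> g \<otimes> inv (inv z \<otimes> y) = inv z \<otimes> (y \<otimes> g \<otimes> inv y) \<otimes> inv (inv z)"
        by (rule conj_conj[symmetric]) (use y z g in auto)
      also have "\<dots> = g" using y z g by (simp add: m_assoc inv_solve_left)
      finally show "inv z \<otimes> y \<in> cent g" using y z g conj_eq_iff[of "inv z \<otimes> y" g g] by (auto simp: cent_def)
    qed
  qed (use z in \<open>auto simp: m_assoc[symmetric] cent_def\<close>)
  then show ?thesis by (simp add: bij_betw_same_card)
qed

lemma conj_fibre_le:
  assumes g: "g \<in> carrier G"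
  shows "card {y \<in> carrier G. y \<otimes> g \<otimes> inv y = h} \<le> card (cent g)"
proof (cases "h \<in> cl g")
  case True
  then show ?thesis using conj_fibre[OF g] by simp
next
  case False
  then have "{y \<in> carrier G. y \<otimes> g \<otimes> inv y = h} = {}" by (auto simp: cl_def)
  then show ?thesis by (simp only: card.empty)
qed

theorem card_cl: "g \<in> carrier G \<Longrightarrow> card (cl g) * card (cent g) = order G"
  using card_eq_sum_fibres[of "carrier G" "cl g" "\<lambda>y. y \<otimes> g \<otimes> inv y"] conj_fibre[of g]
  by (simp add: order_def) (simp add: cl_def)

lemma card_cent_cl: "g \<in> carrier G \<Longrightarrow> h \<in> cl g \<Longrightarrow> card (cent h) = card (cent g)"
proof -
  assume g: "g \<in> carrier G" and h: "h \<in> cl g"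
  have "card (cl g) * card (cent h) = card (cl g) * card (cent g)"
    using card_cl[OF g] card_cl[OF clD[OF g h]] cl_eq[OF g h] by simp
  moreover have "card (cl g) \<noteq> 0" using cl_self[OF g] by auto
  ultimately show ?thesis by simp
qed

lemma card_cent_pos: "g \<in> carrier G \<Longrightarrow> card (cent g) > 0"
  using cent_self by (metis card_gt_0_iff empty_iff finite_cent)

lemma card_cent_le: "card (cent g) \<le> order G"
  unfolding order_def by (rule card_mono) (auto simp: cent_sub)

lemma order_pos: "order G > 0"
  by (simp add: order_gt_0_iff_finite)

lemma real_card_cl: "g \<in> carrier G \<Longrightarrow> real (card (cl g)) = real (order G) / real (card (cent g))"
  using card_cl[of g] card_cent_pos[of g]
  by (metis nonzero_mult_div_cancel_right of_nat_0_eq_iff of_nat_mult less_irrefl)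

lemma conjugate_in_iff: "g \<in> carrier G \<Longrightarrow> conjugate_in G g h \<longleftrightarrow> h \<in> cl g"
  unfolding conjugate_in_def cl_def
  by (auto simp: image_iff) (metis inv_closed inv_inv)+

text \<open>
  The second element is conjugate to \<open>g\<close> with probability \<open>1 / c(g)\<close>, by the orbit-stabilizer theorem.
\<close>

theorem kappa_sum: "kappa G = (\<Sum>g\<in>carrier G. 1 / real (card (cent g))) / real (order G)"
proof -
  have "{(g, h). g \<in> carrier G \<and> h \<in> carrier G \<and> conjugate_in G g h} = Sigma (carrier G) cl"
    by (auto simp: conjugate_in_iff dest: clD)
  then have "card {(g, h). g \<in> carrier G \<and> h \<in> carrier G \<and> conjugate_in G g h} = (\<Sum>g\<in>carrier G. card (cl g))"
    by simp
  then have "kappa G = (\<Sum>g\<in>carrier G. real (order G) / real (card (cent g))) / real (order G) ^ 2"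
    using kappa_eq_card[OF is_group finite_carrier] real_card_cl by simp
  also have "(\<Sum>g\<in>carrier G. real (order G) / real (card (cent g)))
      = real (order G) * (\<Sum>g\<in>carrier G. 1 / real (card (cent g)))"
    by (simp add: sum_distrib_left)
  finally show ?thesis using order_pos by (simp add: power2_eq_square)
qed

end

section \<open>An element with centralizer of order 2\<close>

context finite_grp
begin

text \<open>
  The class \<open>K\<close> of \<open>t\<close> is half of \<open>G\<close>. A product of two elements of \<open>K\<close> that
  lay in \<open>K\<close> would be an involution, so the factors would commute and, by the order of the centralizers, be equal.
  Hence \<open>k K\<close> is the complement \<open>I\<close> for every \<open>k \<in> K\<close>, and \<open>I\<close> is a
  subgroup. Its elements are products \<open>t k\<close> of two involutions and so are inverted by \<open>t\<close>, which makes
  \<open>I\<close> abelian; inversion fixes only the identity of \<open>I\<close>, so \<open>|I|\<close> is odd.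
\<close>

lemma centralizer_order_2_imp_inversion_extension:
  assumes t: "t \<in> carrier G" and c2: "card (cent t) = 2" and n: "order G > 2"
  shows "\<exists>A :: 'a monoid. comm_group A \<and> finite (carrier A) \<and> odd (order A) \<and> 2 * order A = order G
    \<and> G \<cong> inversion_extension A"
proof -
  have t1: "t \<noteq> \<one>" using c2 n cent_of_one by (auto simp: order_def)
  have ct: "cent t = {\<one>, t}"
  proof -
    have "{\<one>, t} \<subseteq> cent t" using cent_one[OF t] cent_self[OF t] by auto
    moreover have "card {\<one>, t} = 2" using t1 by auto
    ultimately show ?thesis using c2 by (metis card_subset_eq finite_cent)
  qed
  have tt: "t \<otimes> t = \<one>"
  proof -
    have "t \<otimes> t \<in> cent t" using subgroup.m_closed[OF cent_subgroup[OF t]] ct by auto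
    then show ?thesis using ct t t1 by auto
  qed
  define K where "K = cl t"
  define I where "I = carrier G - K"
  have K: "k \<in> carrier G" "k \<otimes> k = \<one>" "cent k = {\<one>, k}" "k \<noteq> \<one>" if k: "k \<in> K" for k
  proof -
    obtain y where y: "y \<in> carrier G" "k = y \<otimes> t \<otimes> inv y" using k by (auto simp: K_def cl_def)
    show kc: "k \<in> carrier G" using y t by simp
    show "k \<otimes> k = \<one>" using y t tt by (simp add: conj_mult)
    show k1: "k \<noteq> \<one>" using y t t1 conj_inj[of y t \<one>] by auto
    have "card (cent k) = 2" using card_cent_cl[OF t] k c2 by (simp add: K_def)
    moreover have "{\<one>, k} \<subseteq> cent k" "card {\<one>, k} = 2" using cent_one[OF kc] cent_self[OF kc] k1 by auto
    ultimately show "cent k = {\<one>, k}" by (metis card_subset_eq finite_cent)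
  qed
  have tK: "t \<in> K" using cl_self[OF t] by (simp add: K_def)
  have Ksub: "K \<subseteq> carrier G" using K by auto
  have fK: "finite K" by (simp add: K_def)
  have cK: "2 * card K = order G" using card_cl[OF t] c2 by (simp add: K_def mult.commute)
  have cI: "card I = card K"
    using cK Ksub fK by (simp add: I_def card_Diff_subset order_def)
  have kk: "k \<otimes> k' \<in> I" if "k \<in> K" "k' \<in> K" for k k'
  proof -
    have False if kk: "k \<otimes> k' \<in> K"
    proof -
      have "inv (k \<otimes> k') = k \<otimes> k'" using K[OF kk] by (simp add: inv_equality)
      moreover have "inv (k \<otimes> k') = k' \<otimes> k"
        using K[OF \<open>k \<in> K\<close>] K[OF \<open>k' \<in> K\<close>] by (simp add: inv_mult_group inv_equality)
      ultimately have "k' \<in> cent k" using K[OF \<open>k' \<in> K\<close>] by (simp add: cent_def)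
      then have "k' = k" using K[OF \<open>k \<in> K\<close>] K[OF \<open>k' \<in> K\<close>] by simp
      then show False using K[OF kk] K[OF \<open>k \<in> K\<close>] by simp
    qed
    then show ?thesis using K that by (auto simp: I_def)
  qed
  have kI: "\<exists>k'\<in>K. i = k \<otimes> k'" if "k \<in> K" "i \<in> I" for k i
  proof -
    have "inj_on ((\<otimes>) k) K" using K(1) that(1) by (auto simp: inj_on_def)
    then have "card ((\<otimes>) k ` K) = card I" using cI by (simp add: card_image)
    moreover have "(\<otimes>) k ` K \<subseteq> I" using kk that by auto
    moreover have "finite I" by (simp add: I_def)
    ultimately have "(\<otimes>) k ` K = I" by (metis card_subset_eq)
    then show ?thesis using that by auto
  qed
  have kiK: "k \<otimes> i \<in> K" if k: "k \<in> K" and i: "i \<in> I" for k i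
  proof -
    obtain k' where "k' \<in> K" "i = k \<otimes> k'" using kI[OF k i] by auto
    then show ?thesis using K k by (simp add: m_assoc[symmetric])
  qed
  have Ic: "i \<in> carrier G" if "i \<in> I" for i using that by (auto simp: I_def)
  have Im: "i \<otimes> j \<in> I" if i: "i \<in> I" and j: "j \<in> I" for i j
  proof -
    obtain k where k: "k \<in> K" "i = t \<otimes> k" using kI[OF tK i] by auto
    have "t \<otimes> (k \<otimes> j) \<in> I" using kk[OF tK kiK[OF k(1) j]] .
    then show ?thesis using k K t Ic[OF j] by (simp add: m_assoc)
  qed
  have oneI: "\<one> \<in> I" using K(4) by (auto simp: I_def)
  have inverts: "t \<otimes> i \<otimes> t = inv i" if i: "i \<in> I" for i
  proof -
    obtain k where k: "k \<in> K" "i = t \<otimes> k" using kI[OF tK i] by auto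
    have kc: "k \<in> carrier G" using K k by simp
    have "t \<otimes> i \<otimes> t = k \<otimes> t" using t kc tt k(2) by (simp add: m_assoc[symmetric])
    also have "\<dots> = inv i"
      using K[OF k(1)] t tt k(2) by (simp add: inv_mult_group inv_equality)
    finally show ?thesis .
  qed
  have Iinv: "inv i \<in> I" if i: "i \<in> I" for i
  proof -
    have "inv i \<notin> K"
    proof
      assume a: "inv i \<in> K"
      have "inv (inv i) = inv i" using K[OF a] by (simp add: inv_equality)
      then show False using a i Ic[OF i] by (simp add: I_def)
    qed
    then show ?thesis using Ic[OF i] by (simp add: I_def)
  qed
  have comm: "i \<otimes> j = j \<otimes> i" if i: "i \<in> I" and j: "j \<in> I" for i j
  proof -
    have ic: "i \<in> carrier G" and jc: "j \<in> carrier G" using Ic i j by auto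
    have "(t \<otimes> i \<otimes> t) \<otimes> (t \<otimes> j \<otimes> t) = t \<otimes> i \<otimes> (t \<otimes> t) \<otimes> (j \<otimes> t)"
      using ic jc t by (simp add: m_assoc)
    also have "\<dots> = t \<otimes> (i \<otimes> j) \<otimes> t" using ic jc t tt by (simp add: m_assoc)
    finally have "inv i \<otimes> inv j = inv (i \<otimes> j)" using inverts i j Im[OF i j] by simp
    then have "inv (j \<otimes> i) = inv (i \<otimes> j)" using ic jc by (simp add: inv_mult_group)
    then show ?thesis using ic jc by (metis inv_inv m_closed)
  qed
  have odd: "odd (card I)"
  proof -
    have "{i \<in> I. inv i = i} = {\<one>}"
    proof -
      have "i = \<one>" if "i \<in> I" "inv i = i" for i
      proof -
        have ic: "i \<in> carrier G" using Ic that by auto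
        have "t \<otimes> (t \<otimes> i \<otimes> t) = t \<otimes> i" using inverts that by simp
        then have "i \<otimes> t = t \<otimes> i" using ic t tt by (simp add: m_assoc[symmetric])
        then have "i \<in> cent t" using ic by (simp add: cent_def)
        then show ?thesis using ct tK that by (auto simp: I_def)
      qed
      then have "{i \<in> I. inv i = i} \<subseteq> {\<one>}" by blast
      moreover have "\<one> \<in> {i \<in> I. inv i = i}" using oneI by simp
      ultimately show ?thesis by blast
    qed
    moreover have "[card I = card {i \<in> I. inv i = i}] (mod 2)"
      by (rule card_fixed_points_cong[OF two_is_prime_nat]) (use Iinv Ic in \<open>auto simp: numeral_2_eq_2\<close>, auto simp: I_def)
    ultimately have "[card I = 1] (mod 2)" by simp
    then show ?thesis by (metis cong_def odd_iff_mod_2_eq_one one_mod_two_eq_one)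
  qed
  define A :: "'a monoid" where "A = \<lparr>carrier = I, mult = mult G, one = \<one>\<rparr>"
  have A: "carrier A = I" "mult A = mult G" "one A = \<one>" by (simp_all add: A_def)
  have gA: "comm_group A"
  proof (rule comm_groupI)
    fix a assume "a \<in> carrier A"
    then show "\<exists>y\<in>carrier A. y \<otimes>\<^bsub>A\<^esub> a = \<one>\<^bsub>A\<^esub>"
      using Iinv[of a] Ic[of a] by (intro bexI[of _ "inv a"]) (auto simp: A)
  next
    fix a b assume "a \<in> carrier A" "b \<in> carrier A"
    then show "a \<otimes>\<^bsub>A\<^esub> b = b \<otimes>\<^bsub>A\<^esub> a" using comm by (simp add: A)
  qed (use Im oneI Ic in \<open>auto simp: A m_assoc\<close>)
  interpret A: comm_group A by fact
  have invA: "inv\<^bsub>A\<^esub> a = inv a" if "a \<in> I" for a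
    using that Iinv[OF that] Ic[OF that] by (intro A.inv_equality) (auto simp: A)
  define f where "f = (\<lambda>(a, k :: int). if k = 0 then a else a \<otimes> t)"
  have carE: "carrier (inversion_extension A) = I \<times> {0, 1}"
    by (auto simp: inversion_extension_def semidirect_product_def carrier_integer_mod_group A)
  have it: "i \<otimes> t \<in> K" if i: "i \<in> I" for i
  proof -
    have "t \<otimes> inv i \<in> K" using kiK[OF tK Iinv[OF i]] .
    moreover have "t \<otimes> inv i = t \<otimes> t \<otimes> i \<otimes> t"
      using inverts[OF i, symmetric] t Ic[OF i] by (simp add: m_assoc)
    then have "t \<otimes> inv i = i \<otimes> t" using t tt Ic[OF i] by simp
    ultimately show ?thesis by simp
  qed
  have "f \<in> iso (inversion_extension A) G"
  proof (rule isoI)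
    have ti: "t \<otimes> i = inv i \<otimes> t" if "i \<in> I" for i
    proof -
      have "t \<otimes> i = t \<otimes> i \<otimes> (t \<otimes> t)" using t tt Ic[OF that] by simp
      also have "\<dots> = (t \<otimes> i \<otimes> t) \<otimes> t" using t Ic[OF that] by (simp add: m_assoc)
      finally show ?thesis using inverts[OF that] by simp
    qed
    show "f \<in> hom (inversion_extension A) G"
    proof (rule homI)
      fix x y assume "x \<in> carrier (inversion_extension A)" "y \<in> carrier (inversion_extension A)"
      then obtain a k b l where x: "x = (a, k)" "a \<in> I" "k \<in> {0, 1}" and y: "y = (b, l)" "b \<in> I" "l \<in> {0, 1}"
        by (auto simp: carE)
      have [simp]: "a \<in> carrier G" "b \<in> carrier G" "t \<in> carrier G" using x y Ic t by auto
      have 1: "a \<otimes> t \<otimes> b = a \<otimes> inv b \<otimes> t" using ti[OF y(2)] by (simp add: m_assoc)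
      have 2: "a \<otimes> t \<otimes> (b \<otimes> t) = a \<otimes> inv b"
      proof -
        have "a \<otimes> t \<otimes> (b \<otimes> t) = (a \<otimes> t \<otimes> b) \<otimes> t" by (simp add: m_assoc)
        also have "\<dots> = a \<otimes> inv b \<otimes> (t \<otimes> t)" unfolding 1 by (simp add: m_assoc)
        finally show ?thesis by (simp add: tt)
      qed
      have m: "x \<otimes>\<^bsub>inversion_extension A\<^esub> y
          = (a \<otimes> inversion_action A k b, (k + l) mod 2)"
        by (simp add: x(1) y(1) inversion_extension_def semidirect_product_def A(2))
      have act: "inversion_action A 0 b = b" "inversion_action A 1 b = inv b"
        by (simp_all add: inversion_action_def invA[OF y(2)])
      show "f (x \<otimes>\<^bsub>inversion_extension A\<^esub> y) = f x \<otimes> f y"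
        unfolding m using x(3) y(3) 1 2 act
        by (elim insertE emptyE) (simp_all add: x(1) y(1) f_def m_assoc)
    next
      fix x assume "x \<in> carrier (inversion_extension A)"
      then have "fst x \<in> carrier G" using Ic by (auto simp: carE)
      then show "f x \<in> carrier G" using t by (simp add: f_def split_beta)
    qed
    show "bij_betw f (carrier (inversion_extension A)) (carrier G)"
    proof -
      have inj: "inj_on f (carrier (inversion_extension A))"
      proof (rule inj_onI)
        fix x y assume "x \<in> carrier (inversion_extension A)" "y \<in> carrier (inversion_extension A)" and e: "f x = f y"
        then obtain a k b l where x: "x = (a, k)" "a \<in> I" "k \<in> {0, 1}" and y: "y = (b, l)" "b \<in> I" "l \<in> {0, 1}"
          by (auto simp: carE)
        have c: "a \<in> carrier G" "b \<in> carrier G" using x y Ic by auto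
        have "a \<otimes> t \<noteq> b" "a \<noteq> b \<otimes> t" using it[OF x(2)] it[OF y(2)] x(2) y(2) by (auto simp: I_def)
        then show "x = y" using e x(3) y(3) c t
          by (elim insertE emptyE) (simp_all add: x(1) y(1) f_def)
      qed
      have "f ` carrier (inversion_extension A) \<subseteq> carrier G"
        using Ic t by (auto simp: carE f_def)
      moreover have "card (f ` carrier (inversion_extension A)) = card (carrier G)"
        using card_image[OF inj] cK cI by (simp add: carE card_cartesian_product order_def)
      ultimately have "f ` carrier (inversion_extension A) = carrier G" by (simp add: card_subset_eq)
      with inj show ?thesis by (simp add: bij_betw_def)
    qed
  qed
  then have "inversion_extension A \<cong> G" by (auto simp: is_iso_def)
  then have "G \<cong> inversion_extension A"
    by (rule group.iso_sym[OF group_inversion_extension[OF gA]])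
  moreover have "odd (order A)" "2 * order A = order G" using odd cK cI by (simp_all add: order_def A)
  moreover have "finite (carrier A)" by (simp add: A(1) I_def)
  ultimately show ?thesis using gA by blast
qed

end

section \<open>A non-real element with centralizer of order 3\<close>

context finite_grp
begin

lemma pow_card_cent: "g \<in> carrier G \<Longrightarrow> g [^] card (cent g) = \<one>"
  using group.pow_order_eq_1[OF subgroup_imp_group[OF cent_subgroup], of g g] cent_self[of g]
  by (simp add: order_def nat_pow_consistent[symmetric])

lemma cent_order_3:
  assumes x: "x \<in> carrier G" and c: "card (cent x) = 3" and n: "order G > 3"
  shows "x \<noteq> \<one>" "x \<otimes> x = inv x" "x \<noteq> inv x" "cent x = {\<one>, x, inv x}"
proof -
  show 1: "x \<noteq> \<one>" using c n cent_of_one by (auto simp: order_def)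
  have "x [^] (3::nat) = \<one>" using pow_card_cent[OF x] c by simp
  then have "x \<otimes> x \<otimes> x = \<one>" using x by (simp add: numeral_3_eq_3)
  then show 2: "x \<otimes> x = inv x" using x by (simp add: inv_equality)
  show 3: "x \<noteq> inv x"
  proof
    assume "x = inv x"
    then have "x \<otimes> x = x" using 2 by simp
    then show False using x 1 by simp
  qed
  have "{\<one>, x, inv x} \<subseteq> cent x"
    using cent_one[OF x] cent_self[OF x] subgroup.m_inv_closed[OF cent_subgroup[OF x]] by auto
  moreover have "inv x \<noteq> \<one>" using 1 x inv_eq_1_iff by simp
  then have "card {\<one>, x, inv x} = 3" using 1 3 by (simp add: eq_commute)
  ultimately show "cent x = {\<one>, x, inv x}" using c by (metis card_subset_eq finite_cent)
qed

lemma cl_inv: "g \<in> carrier G \<Longrightarrow> cl (inv g) = (\<lambda>h. inv h) ` cl g"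
  by (auto simp: cl_def conj_inv image_iff)

text \<open>
  In the Euclidean triangle group with \<open>a\<^sup>3 = b\<^sup>3 = (a b)\<^sup>3 = 1\<close>, the elements \<open>u\<close> and
  \<open>v\<close> are translations, and the rotation \<open>a b\<close> permutes \<open>u\<close>, \<open>v\<close> and \<open>(u
  v)\<^sup>-\<^sup>1\<close> cyclically.
\<close>

lemma triangle_333:
  assumes a: "a \<in> carrier G" and b: "b \<in> carrier G"
    and aa: "a \<otimes> a = inv a" and bb: "b \<otimes> b = inv b"
    and ab: "(a \<otimes> b) \<otimes> (a \<otimes> b) = inv (a \<otimes> b)"
  defines "u \<equiv> a \<otimes> inv b" and "v \<equiv> inv b \<otimes> a"
  shows "u \<otimes> v = v \<otimes> u" "(a \<otimes> b) \<otimes> u \<otimes> inv (a \<otimes> b) = v" "(a \<otimes> b) \<otimes> v \<otimes> inv (a \<otimes> b) = inv (u \<otimes> v)"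
proof -
  have iaia: "inv a \<otimes> inv a = a" and ibib: "inv b \<otimes> inv b = b"
    using a b aa bb by (metis inv_inv inv_mult_group)+
  have aa': "a \<otimes> (a \<otimes> w) = inv a \<otimes> w" and bb': "b \<otimes> (b \<otimes> w) = inv b \<otimes> w"
    and iaia': "inv a \<otimes> (inv a \<otimes> w) = a \<otimes> w" and ibib': "inv b \<otimes> (inv b \<otimes> w) = b \<otimes> w"
    if "w \<in> carrier G" for w
    using that a b aa bb iaia ibib by (simp_all add: m_assoc[symmetric])
  have "a \<otimes> b \<otimes> (a \<otimes> b) = inv b \<otimes> inv a" using ab a b by (simp add: inv_mult_group)
  then have "a \<otimes> (b \<otimes> (a \<otimes> b)) \<otimes> inv b = inv b \<otimes> inv a \<otimes> inv b" using a b by (simp add: m_assoc)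
  then have aba: "a \<otimes> (b \<otimes> a) = inv b \<otimes> (inv a \<otimes> inv b)" using a b by (simp add: m_assoc)
  have "inv (a \<otimes> (b \<otimes> a)) = inv (inv b \<otimes> (inv a \<otimes> inv b))" using aba by simp
  then have bab: "b \<otimes> (a \<otimes> b) = inv a \<otimes> (inv b \<otimes> inv a)" using a b by (simp add: inv_mult_group m_assoc)
  have uv: "u \<otimes> v = a \<otimes> (b \<otimes> a)" unfolding u_def v_def using a b by (simp add: m_assoc ibib')
  have vu: "v \<otimes> u = inv b \<otimes> (inv a \<otimes> inv b)" unfolding u_def v_def using a b by (simp add: m_assoc aa')
  show "u \<otimes> v = v \<otimes> u" using uv vu aba by simp
  have "(a \<otimes> b) \<otimes> u \<otimes> inv (a \<otimes> b) = a \<otimes> (b \<otimes> (a \<otimes> b)) \<otimes> inv a"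
    unfolding u_def using a b by (simp add: m_assoc inv_mult_group ibib')
  also have "\<dots> = inv b \<otimes> a" unfolding bab using a b by (simp add: m_assoc iaia)
  finally show "(a \<otimes> b) \<otimes> u \<otimes> inv (a \<otimes> b) = v" by (simp add: v_def)
  have "(a \<otimes> b) \<otimes> v \<otimes> inv (a \<otimes> b) = inv a \<otimes> (inv b \<otimes> inv a)"
    unfolding v_def using a b by (simp add: m_assoc inv_mult_group aa')
  also have "\<dots> = inv (u \<otimes> v)" unfolding uv using a b by (simp add: inv_mult_group m_assoc)
  finally show "(a \<otimes> b) \<otimes> v \<otimes> inv (a \<otimes> b) = inv (u \<otimes> v)" .
qed

lemma subgroup_normalizing:
  assumes T: "subgroup T G" and x: "x \<in> carrier G"
  shows "subgroup {g \<in> carrier G. x \<otimes> g \<otimes> inv x \<in> T} G"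
proof (rule subgroupI)
  show "{g \<in> carrier G. x \<otimes> g \<otimes> inv x \<in> T} \<noteq> {}"
    using subgroup.one_closed[OF T] x by (auto intro!: exI[of _ \<one>])
next
  fix a assume "a \<in> {g \<in> carrier G. x \<otimes> g \<otimes> inv x \<in> T}"
  then show "inv a \<in> {g \<in> carrier G. x \<otimes> g \<otimes> inv x \<in> T}"
    using subgroup.m_inv_closed[OF T] x by (auto simp: conj_inv)
next
  fix a b assume "a \<in> {g \<in> carrier G. x \<otimes> g \<otimes> inv x \<in> T}" "b \<in> {g \<in> carrier G. x \<otimes> g \<otimes> inv x \<in> T}"
  then show "a \<otimes> b \<in> {g \<in> carrier G. x \<otimes> g \<otimes> inv x \<in> T}"
    using subgroup.m_closed[OF T, of "x \<otimes> a \<otimes> inv x" "x \<otimes> b \<otimes> inv x"] x by (auto simp: conj_mult)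
qed auto

end

text \<open>
  An element \<open>x\<close> of order 3 that generates its centralizer and is not conjugate to its inverse. The sets
  \<open>K\<close>, \<open>L\<close> and \<open>N\<close> below are thirds of the group; the aim is to show that they are the
  cosets of \<open>N\<close>.
\<close>

locale nonreal_3 = finite_grp +
  fixes x
  assumes x: "x \<in> carrier G" and cent_x: "card (cent x) = 3" and order_gt: "order G > 3"
    and nonreal: "inv x \<notin> cl x"
begin

definition "K = cl x"
definition "L = cl (inv x)"
definition "N = carrier G - (K \<union> L)"

lemma K3:
  assumes "k \<in> K"
  shows "k \<in> carrier G" "k \<noteq> \<one>" "k \<otimes> k = inv k" "k \<noteq> inv k" "cent k = {\<one>, k, inv k}"
    "card (cent k) = 3" "cl k = K"
proof -
  show k: "k \<in> carrier G" using assms x clD by (simp add: K_def)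
  show c: "card (cent k) = 3" using assms card_cent_cl[OF x] cent_x by (simp add: K_def)
  show "cl k = K" using cl_eq[OF x] assms by (simp add: K_def)
  show "k \<noteq> \<one>" "k \<otimes> k = inv k" "k \<noteq> inv k" "cent k = {\<one>, k, inv k}"
    using cent_order_3[OF k c order_gt] by auto
qed

lemma L_eq: "L = (\<lambda>h. inv h) ` K" using cl_inv[OF x] by (simp add: L_def K_def)

lemma L_iff: "g \<in> carrier G \<Longrightarrow> g \<in> L \<longleftrightarrow> inv g \<in> K"
  using K3(1) by (auto simp: L_eq image_iff) (metis inv_inv)

lemma K_iff: "g \<in> carrier G \<Longrightarrow> g \<in> K \<longleftrightarrow> inv g \<in> L"
  by (simp add: L_iff)

lemma KL_disjoint: "K \<inter> L = {}"
  unfolding K_def L_def using cl_disjoint[of x "inv x"] x nonreal by simp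

lemma L_carrier: "L \<subseteq> carrier G" by (auto simp: L_eq K3)
lemma K_carrier: "K \<subseteq> carrier G" by (auto simp: K3)
lemma N_carrier: "N \<subseteq> carrier G" by (auto simp: N_def)

lemma fin: "finite K" "finite L" "finite N" by (simp_all add: K_def L_def N_def)

lemma card_KLN: "3 * card K = order G" "card L = card K" "card N = card K"
proof -
  show K: "3 * card K = order G" using card_cl[OF x] cent_x by (simp add: K_def mult.commute)
  show L: "card L = card K" unfolding L_eq by (rule card_image) (auto simp: inj_on_def K3 dest: inv_inj[THEN inj_onD])
  have "card (K \<union> L) = 2 * card K" using KL_disjoint L fin by (simp add: card_Un_disjoint)
  then show "card N = card K" using K fin K_carrier L_carrier
    by (simp add: N_def card_Diff_subset order_def)
qed

text \<open>
  If \<open>z = a b\<close> were in \<open>K\<close>, then by \<open>triangle_333\<close> the translations \<open>u\<close> and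
  \<open>v\<close> would generate an abelian subgroup \<open>T\<close> normalized by \<open>z\<close>. Only the identity of
  \<open>T\<close> commutes with \<open>z\<close>, so the conjugates of \<open>z\<^sup>-\<^sup>1\<close> by elements of
  \<open>T\<close> are pairwise different and fill the coset \<open>z\<^sup>-\<^sup>1 T\<close>. But this coset contains \<open>b
  = z\<^sup>-\<^sup>1 u\<close>, which is not conjugate to \<open>z\<^sup>-\<^sup>1\<close>.
\<close>

lemma KK_notin_K:
  assumes a: "a \<in> K" and b: "b \<in> K"
  shows "a \<otimes> b \<notin> K"
proof
  assume ab: "a \<otimes> b \<in> K"
  define z where "z = a \<otimes> b"
  define u where "u = a \<otimes> inv b"
  define v where "v = inv b \<otimes> a"
  have z: "z \<in> K" using ab by (simp add: z_def)
  note [simp] = K3(1)[OF a] K3(1)[OF b] K3(1)[OF z]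
  have uv: "u \<otimes> v = v \<otimes> u" "z \<otimes> u \<otimes> inv z = v" "z \<otimes> v \<otimes> inv z = inv (u \<otimes> v)"
    using triangle_333[of a b] K3[OF a] K3[OF b] K3[OF ab] by (simp_all add: z_def u_def v_def)
  have [simp]: "u \<in> carrier G" "v \<in> carrier G" by (simp_all add: u_def v_def)
  define T where "T = generate G {u, v}"
  have T: "subgroup T G" unfolding T_def by (rule generate_is_subgroup) auto
  have Tu: "u \<in> T" "v \<in> T" by (auto simp: T_def intro: generate.incl)
  have Tc: "T \<subseteq> carrier G" using subgroup.subset[OF T] .
  have norm: "z \<otimes> s \<otimes> inv z \<in> T" if "s \<in> T" for s
  proof -
    have "inv (u \<otimes> v) \<in> T" using Tu by (intro subgroup.m_inv_closed[OF T] subgroup.m_closed[OF T])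
    then have "{u, v} \<subseteq> {g \<in> carrier G. z \<otimes> g \<otimes> inv z \<in> T}" using uv Tu by auto
    then have "T \<subseteq> {g \<in> carrier G. z \<otimes> g \<otimes> inv z \<in> T}"
      unfolding T_def[symmetric]
      using generate_subgroup_incl[OF _ subgroup_normalizing[OF T, of z]] by (simp add: T_def)
    then show ?thesis using that by auto
  qed
  have zT: "z \<notin> T"
  proof
    assume zT: "z \<in> T"
    have "{u, v} \<subseteq> cent u" using uv(1) by (auto simp: cent_def)
    then have "T \<subseteq> cent u" unfolding T_def by (rule generate_subgroup_incl[OF _ cent_subgroup]) simp
    then have "u \<in> cent z" using zT cent_sym by auto
    then have "u = \<one> \<or> u = z \<or> u = inv z" using K3(5)[OF z] by auto
    then show False
    proof (elim disjE)
      assume "u = \<one>"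
      then have "a = b" using inv_solve_right[of \<one> a b] by (simp add: u_def)
      then have "inv a \<in> K" using ab K3(3)[OF a] by simp
      then show False using a KL_disjoint L_iff[of a] by auto
    next
      assume "u = z"
      then have "inv b = b" by (simp add: u_def z_def)
      then show False using K3(4)[OF b] by simp
    next
      assume "u = inv z"
      then have "v = inv z" using uv(2) by simp
      then have "inv b \<otimes> a = inv b \<otimes> inv a" by (simp add: v_def z_def inv_mult_group)
      then have "a = inv a" by simp
      then show False using K3(4)[OF a] by simp
    qed
  qed
  have izT: "inv z \<notin> T" using zT subgroup.m_inv_closed[OF T, of "inv z"] by auto
  have centT: "s = \<one>" if "s \<in> T" "s \<in> cent z" for s using that zT izT K3(5)[OF z] by auto
  let ?f = "\<lambda>s. s \<otimes> inv z \<otimes> inv s"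
  have finT: "finite T" using Tc finite_subset by blast
  have inj: "inj_on ?f T"
  proof (rule inj_onI)
    fix s r assume s: "s \<in> T" and r: "r \<in> T" and e: "?f s = ?f r"
    have [simp]: "s \<in> carrier G" "r \<in> carrier G" using s r Tc by auto
    have "(inv r \<otimes> s) \<otimes> inv z \<otimes> inv (inv r \<otimes> s) = inv r \<otimes> (s \<otimes> inv z \<otimes> inv s) \<otimes> inv (inv r)"
      by (rule conj_conj[symmetric]) auto
    also have "\<dots> = inv z" unfolding e by (simp add: m_assoc)
    finally have "(inv r \<otimes> s) \<otimes> inv z \<otimes> inv (inv r \<otimes> s) = inv z" .
    then have "(inv r \<otimes> s) \<otimes> z \<otimes> inv (inv r \<otimes> s) = z"
      by (metis \<open>r \<in> carrier G\<close> \<open>s \<in> carrier G\<close> \<open>z \<in> carrier G\<close> conj_inv inv_closed inv_inv m_closed)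
    then have "inv r \<otimes> s \<in> cent z" using conj_eq_iff[of "inv r \<otimes> s" z z] by (simp add: cent_def)
    moreover have "inv r \<otimes> s \<in> T" using s r by (intro subgroup.m_closed[OF T] subgroup.m_inv_closed[OF T])
    ultimately have "inv r \<otimes> s = \<one>" by (rule centT[rotated])
    then have "r \<otimes> (inv r \<otimes> s) = r" by simp
    then show "s = r" by simp
  qed
  have im: "?f ` T \<subseteq> (\<lambda>s. inv z \<otimes> s) ` T"
  proof
    fix y assume "y \<in> ?f ` T"
    then obtain s where s: "s \<in> T" "y = ?f s" by auto
    have [simp]: "s \<in> carrier G" using s Tc by auto
    have "(z \<otimes> s \<otimes> inv z) \<otimes> inv s \<in> T"
      using subgroup.m_closed[OF T norm[OF s(1)] subgroup.m_inv_closed[OF T s(1)]] .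
    moreover have "y = inv z \<otimes> ((z \<otimes> s \<otimes> inv z) \<otimes> inv s)" using s(2) by (simp add: m_assoc)
    ultimately show "y \<in> (\<lambda>s. inv z \<otimes> s) ` T" by blast
  qed
  have "card (?f ` T) = card ((\<lambda>s. inv z \<otimes> s) ` T)"
  proof -
    have "inj_on (\<lambda>s. inv z \<otimes> s) T" using Tc by (auto simp: inj_on_def subset_iff)
    then show ?thesis by (simp only: card_image[OF inj] card_image)
  qed
  then have eq: "?f ` T = (\<lambda>s. inv z \<otimes> s) ` T"
    using im finT by (metis card_subset_eq finite_imageI)
  have "b = inv z \<otimes> u"
  proof -
    have "z \<otimes> b = a \<otimes> (b \<otimes> b)" by (simp add: z_def m_assoc)
    also have "\<dots> = u" unfolding K3(3)[OF b] u_def ..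
    finally have "inv z \<otimes> u = inv z \<otimes> (z \<otimes> b)" by simp
    then show ?thesis by simp
  qed
  then have "b \<in> ?f ` T" unfolding eq using Tu by auto
  then have "b \<in> cl (inv z)" using Tc by (auto simp: cl_def)
  moreover have "cl (inv z) = L" using cl_inv[of z] K3(7)[OF z] by (simp add: L_eq)
  ultimately show False using b KL_disjoint by auto
qed

end

context finite_grp
begin

lemma card_subgroup_dvd:
  assumes H: "subgroup H G" and J: "subgroup J G" and s: "H \<subseteq> J"
  shows "card H dvd card J"
proof -
  have "subgroup H (G\<lparr>carrier := J\<rparr>)" using subgroup_incl[OF H J s] .
  from group.lagrange[OF subgroup_imp_group[OF J] this]
  show ?thesis unfolding order_def by (simp) (metis dvd_triv_right)
qed

end

context nonreal_3
begin

text \<open>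
  The situation is symmetric in \<open>x\<close> and \<open>x\<^sup>-\<^sup>1\<close>; statements about \<open>L\<close> are
  obtained by interpreting the locale for the inverse.
\<close>

lemma nonreal_3_inv: "nonreal_3 G (inv x)"
proof
  show "inv x \<in> carrier G" using x by simp
  have "cent (inv x) = cent x"
  proof -
    have *: "cent g \<subseteq> cent (inv g)" if "g \<in> carrier G" for g
    proof
      fix h assume h: "h \<in> cent g"
      then have "g \<in> cent h" using that cent_sym by blast
      then have "inv g \<in> cent h" using h cent_closed cent_subgroup subgroup.m_inv_closed by metis
      then show "h \<in> cent (inv g)" using h cent_closed cent_sym by blast
    qed
    show ?thesis using *[OF x] *[of "inv x"] x by auto
  qed
  then show "card (cent (inv x)) = 3" using cent_x by simp
  show "order G > 3" by (rule order_gt)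
  show "inv (inv x) \<notin> cl (inv x)"
    using x nonreal cl_sym[of "inv x" x] by auto
qed

lemma KLN_inv: "nonreal_3.K G (inv x) = L" "nonreal_3.L G (inv x) = K" "nonreal_3.N G (inv x) = N"
proof -
  interpret op: nonreal_3 G "inv x" by (rule nonreal_3_inv)
  show "op.K = L" by (simp add: op.K_def L_def)
  show "op.L = K" using x by (simp add: op.L_def K_def)
  show "op.N = N" using x by (simp add: op.N_def N_def op.K_def op.L_def K_def L_def Un_commute)
qed

lemma card_translate: "\<lbrakk>g \<in> carrier G; S \<subseteq> carrier G\<rbrakk> \<Longrightarrow> card ((\<otimes>) g ` S) = card S"
  by (rule card_image) (auto simp: inj_on_def subset_iff)

text \<open>
  By \<open>KK_notin_K\<close> the translate misses both \<open>K\<close> and \<open>L\<close>, and it has the right number of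
  elements. The other entries of the multiplication table of \<open>K\<close>, \<open>L\<close>, \<open>N\<close> follow from this
  one by counting.
\<close>

lemma K_mult_L: assumes k: "k \<in> K" shows "(\<otimes>) k ` L = N"
proof -
  have "(\<otimes>) k ` L \<subseteq> N"
  proof
    fix y assume "y \<in> (\<otimes>) k ` L"
    then obtain j where j: "j \<in> K" "y = k \<otimes> inv j" by (auto simp: L_eq)
    note [simp] = K3(1)[OF k] K3(1)[OF j(1)]
    have "y \<notin> K" using KK_notin_K[of y j] j k by (auto simp: m_assoc)
    moreover have "y \<notin> L"
    proof
      assume "y \<in> L"
      then have "inv y \<in> K" by (simp add: L_iff j)
      then have "inv y \<otimes> k \<notin> K" using KK_notin_K k by blast
      then show False using j by (simp add: inv_mult_group m_assoc)
    qed
    ultimately show "y \<in> N" using j by (simp add: N_def)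
  qed
  moreover have "card ((\<otimes>) k ` L) = card N"
    using card_translate[of k L] K3[OF k] L_carrier card_KLN by simp
  ultimately show ?thesis using fin by (metis card_subset_eq)
qed

lemma L_mult_K: assumes k: "k \<in> L" shows "(\<otimes>) k ` K = N"
  using nonreal_3.K_mult_L[OF nonreal_3_inv] k by (simp add: KLN_inv)

lemma K_mult_K: assumes k: "k \<in> K" shows "(\<otimes>) k ` K = L"
proof -
  have "(\<otimes>) k ` K \<subseteq> L"
  proof
    fix y assume "y \<in> (\<otimes>) k ` K"
    then obtain j where j: "j \<in> K" "y = k \<otimes> j" by auto
    note c = K3(1)[OF k] K3(1)[OF j(1)]
    have "y \<notin> N"
    proof
      assume "y \<in> N"
      then obtain l where l: "l \<in> L" "k \<otimes> j = k \<otimes> l" using K_mult_L[OF k] j(2) by auto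
      then have "j = l" using c L_carrier by auto
      then show False using l j KL_disjoint by auto
    qed
    moreover have "y \<notin> K" using KK_notin_K j k by simp
    ultimately show "y \<in> L" using c j by (simp add: N_def)
  qed
  moreover have "card ((\<otimes>) k ` K) = card L"
    using card_translate[of k K] K3[OF k] K_carrier card_KLN by simp
  ultimately show ?thesis using fin by (metis card_subset_eq)
qed

lemma K_mult_N: assumes k: "k \<in> K" shows "(\<otimes>) k ` N = K"
proof -
  have "(\<otimes>) k ` N \<subseteq> K"
  proof
    fix y assume "y \<in> (\<otimes>) k ` N"
    then obtain j where j: "j \<in> N" "y = k \<otimes> j" by auto
    have c: "k \<in> carrier G" "j \<in> carrier G" using K3(1)[OF k] j N_carrier by auto
    have "y \<notin> N"
    proof
      assume "y \<in> N"
      then obtain l where l: "l \<in> L" "k \<otimes> j = k \<otimes> l" using K_mult_L[OF k] j(2) by auto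
      then have "j = l" using c L_carrier by auto
      then show False using l j by (simp add: N_def)
    qed
    moreover have "y \<notin> L"
    proof
      assume "y \<in> L"
      then obtain l where l: "l \<in> K" "k \<otimes> j = k \<otimes> l" using K_mult_K[OF k] j(2) by auto
      then have "j = l" using c K_carrier by auto
      then show False using l j by (simp add: N_def)
    qed
    ultimately show "y \<in> K" using c j by (simp add: N_def)
  qed
  moreover have "card ((\<otimes>) k ` N) = card K"
    using card_translate[of k N] K3[OF k] N_carrier card_KLN by simp
  ultimately show ?thesis using fin by (metis card_subset_eq)
qed

lemma conj_K: "\<lbrakk>k \<in> K; g \<in> carrier G\<rbrakk> \<Longrightarrow> g \<otimes> k \<otimes> inv g \<in> K"
  using cl_conj[OF x] by (simp add: K_def)

lemma conj_L: "\<lbrakk>k \<in> L; g \<in> carrier G\<rbrakk> \<Longrightarrow> g \<otimes> k \<otimes> inv g \<in> L"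
  using cl_conj[of "inv x"] x by (simp add: L_def)

lemma conj_N:
  assumes a: "a \<in> N" and g: "g \<in> carrier G"
  shows "g \<otimes> a \<otimes> inv g \<in> N"
proof -
  have ac: "a \<in> carrier G" using a by (simp add: N_def)
  have e: "inv g \<otimes> (g \<otimes> a \<otimes> inv g) \<otimes> inv (inv g) = a" using ac g by (simp add: m_assoc)
  show ?thesis
    using conj_K[of "g \<otimes> a \<otimes> inv g" "inv g"] conj_L[of "g \<otimes> a \<otimes> inv g" "inv g"] a g ac
    unfolding e by (auto simp: N_def)
qed

lemma N_subgroup: "subgroup N G"
proof (rule subgroupI)
  have xK: "x \<in> K" using cl_self[OF x] by (simp add: K_def)
  have "inv x \<in> L" using xK K_iff[OF x] by simp
  then have "\<one> \<in> N" using K_mult_L[OF xK] x by force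
  then show "N \<noteq> {}" by auto
  show "N \<subseteq> carrier G" by (rule N_carrier)
  fix a b assume a: "a \<in> N" and b: "b \<in> N"
  have ac: "a \<in> carrier G" and bc: "b \<in> carrier G" using a b N_carrier by auto
  show "inv a \<in> N" using a K_iff[OF ac] L_iff[OF ac] ac unfolding N_def by blast
  obtain k where k: "k \<in> K" "a = inv x \<otimes> k" using L_mult_K[OF \<open>inv x \<in> L\<close>] a by auto
  have "k \<otimes> b \<in> K" using K_mult_N[OF k(1)] b by auto
  then have "inv x \<otimes> (k \<otimes> b) \<in> N" using L_mult_K[OF \<open>inv x \<in> L\<close>] by auto
  then show "a \<otimes> b \<in> N" using k K3(1)[OF k(1)] x bc by (simp add: m_assoc)
qed

lemma xK: "x \<in> K" using cl_self[OF x] by (simp add: K_def)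

lemma K_N: "\<lbrakk>k \<in> K; a \<in> N\<rbrakk> \<Longrightarrow> k \<otimes> a \<in> K" using K_mult_N by auto
lemma N_K: "\<lbrakk>k \<in> K; a \<in> N\<rbrakk> \<Longrightarrow> a \<otimes> k \<in> K"
proof -
  assume k: "k \<in> K" and a: "a \<in> N"
  have c: "k \<in> carrier G" "a \<in> carrier G" using k a K_carrier N_carrier by auto
  have "k \<otimes> (inv k \<otimes> a \<otimes> inv (inv k)) \<in> K" using conj_N[of a "inv k"] k a c by (intro K_N) auto
  then show ?thesis using c by (simp add: m_assoc)
qed

lemma N_L: "\<lbrakk>k \<in> L; a \<in> N\<rbrakk> \<Longrightarrow> a \<otimes> k \<in> L"
  using nonreal_3.N_K[OF nonreal_3_inv] by (simp add: KLN_inv)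

text \<open>
  As \<open>y a\<close> lies in \<open>K\<close>, it satisfies \<open>(y a)\<^sup>3 = 1\<close>; with \<open>y\<^sup>3 = 1\<close>
  this says that the product of the three conjugates of \<open>a\<close> by the powers of \<open>y\<close> is trivial.
\<close>

lemma inv_eq_conj_mult:
  assumes y: "y \<in> K" and a: "a \<in> N"
  shows "inv a = (y \<otimes> a \<otimes> inv y) \<otimes> (inv y \<otimes> a \<otimes> y)"
proof -
  have c: "y \<in> carrier G" "a \<in> carrier G" using y a K_carrier N_carrier by auto
  have "(y \<otimes> a) \<otimes> (y \<otimes> a) = inv (y \<otimes> a)" using K3(3)[OF K_N[OF y a]] .
  then have e: "y \<otimes> (a \<otimes> (y \<otimes> a)) = inv a \<otimes> inv y" using c by (simp add: m_assoc inv_mult_group)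
  have iy: "inv y \<otimes> inv y = y" using K3(3)[OF y] c by (metis inv_inv inv_mult_group)
  have "(y \<otimes> a \<otimes> inv y) \<otimes> (inv y \<otimes> a \<otimes> y) = y \<otimes> a \<otimes> (inv y \<otimes> inv y) \<otimes> (a \<otimes> y)"
    using c by (simp add: m_assoc)
  also have "\<dots> = y \<otimes> (a \<otimes> (y \<otimes> a)) \<otimes> y" unfolding iy using c by (simp add: m_assoc)
  also have "\<dots> = inv a" unfolding e using c by (simp add: m_assoc)
  finally show ?thesis by simp
qed

text \<open>
  The relation of \<open>inv_eq_conj_mult\<close>, taken for \<open>y\<close> and for \<open>y\<^sup>-\<^sup>1\<close>, gives both
  products of the two other conjugates as \<open>a\<^sup>-\<^sup>1\<close>. So these conjugates commute with each other, and hence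
  with \<open>a\<close>.
\<close>

lemma conj_commute_K:
  assumes y: "y \<in> K" and a: "a \<in> N"
  shows "y \<otimes> a \<otimes> inv y \<in> cent a" "inv y \<otimes> a \<otimes> y \<in> cent a"
proof -
  have c: "y \<in> carrier G" "a \<in> carrier G" using y a K_carrier N_carrier by auto
  define b where "b = y \<otimes> a \<otimes> inv y"
  define d where "d = inv y \<otimes> a \<otimes> y"
  have bc: "b \<in> carrier G" and dc: "d \<in> carrier G" using c by (simp_all add: b_def d_def)
  have 1: "inv a = b \<otimes> d" using inv_eq_conj_mult[OF y a] by (simp add: b_def d_def)
  have "inv y \<in> L" using y K_iff c by simp
  then have 2: "inv a = d \<otimes> b"
    using nonreal_3.inv_eq_conj_mult[OF nonreal_3_inv, of "inv y" a] a c by (simp add: KLN_inv b_def d_def)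
  have "(b \<otimes> d) \<otimes> b = b \<otimes> (d \<otimes> b)" using bc dc by (rule m_assoc[OF _ _ bc])
  then have "inv a \<otimes> b = b \<otimes> inv a" by (simp only: 1[symmetric] 2[symmetric])
  moreover have "(d \<otimes> b) \<otimes> d = d \<otimes> (b \<otimes> d)" using dc bc by (rule m_assoc[OF _ _ dc])
  then have "inv a \<otimes> d = d \<otimes> inv a" by (simp only: 1[symmetric] 2[symmetric])
  ultimately have "inv a \<in> cent b" "inv a \<in> cent d" using c by (simp_all add: cent_def)
  then have "a \<in> cent b" "a \<in> cent d"
    using subgroup.m_inv_closed[OF cent_subgroup[OF bc], of "inv a"]
      subgroup.m_inv_closed[OF cent_subgroup[OF dc], of "inv a"] c by simp_all
  then show "y \<otimes> a \<otimes> inv y \<in> cent a" "inv y \<otimes> a \<otimes> y \<in> cent a"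
    using bc dc cent_sym by (auto simp: b_def d_def)
qed

lemma conj_commute_KL:
  assumes y: "y \<in> K \<union> L" and a: "a \<in> N"
  shows "y \<otimes> a \<otimes> inv y \<in> cent a"
proof (cases "y \<in> K")
  case True
  then show ?thesis by (rule conj_commute_K(1)[OF _ a])
next
  case False
  then have "y \<in> L" using y by simp
  then show ?thesis by (rule nonreal_3.conj_commute_K(1)[OF nonreal_3_inv, unfolded KLN_inv, OF _ a])
qed

text \<open>
  Conjugators outside \<open>N\<close> are covered by \<open>conj_commute_KL\<close>. For \<open>g \<in> N\<close> and
  \<open>y\<close> outside \<open>N\<close>, the element \<open>g\<^sup>-\<^sup>1 y\<close> is outside \<open>N\<close> too, so
  the conjugate of \<open>a\<close> by \<open>y\<close> commutes with the conjugate by \<open>g\<close>. Taking \<open>y =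
  x\<close> and \<open>y = x\<^sup>-\<^sup>1\<close>, this passes to the product of the two conjugates, which is
  \<open>a\<^sup>-\<^sup>1\<close>.
\<close>

lemma conj_commute:
  assumes g: "g \<in> carrier G" and a: "a \<in> N"
  shows "g \<otimes> a \<otimes> inv g \<in> cent a"
proof (cases "g \<in> K \<union> L")
  case True
  then show ?thesis using conj_commute_KL a by simp
next
  case False
  then have gN: "g \<in> N" using g by (simp add: N_def)
  have ac: "a \<in> carrier G" using a N_carrier by auto
  let ?ag = "g \<otimes> a \<otimes> inv g"
  have ig: "inv g \<in> N" using subgroup.m_inv_closed[OF N_subgroup gN] .
  have *: "y \<otimes> a \<otimes> inv y \<in> cent ?ag" if y: "y \<in> K \<union> L" for y
  proof -
    have yc: "y \<in> carrier G" using y K_carrier L_carrier by blast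
    have "inv g \<otimes> y \<in> K \<union> L" using y N_K[OF _ ig] N_L[OF _ ig] by blast
    then have "(inv g \<otimes> y) \<otimes> a \<otimes> inv (inv g \<otimes> y) \<in> cent a" by (rule conj_commute_KL[OF _ a])
    then have "g \<otimes> ((inv g \<otimes> y) \<otimes> a \<otimes> inv (inv g \<otimes> y)) \<otimes> inv g \<in> cent ?ag"
      by (subst conj_cent_iff) (use g ac yc in \<open>auto\<close>)
    also have "g \<otimes> ((inv g \<otimes> y) \<otimes> a \<otimes> inv (inv g \<otimes> y)) \<otimes> inv g = y \<otimes> a \<otimes> inv y"
      using g yc ac by (simp add: m_assoc inv_mult_group)
    finally show ?thesis .
  qed
  have ix: "inv x \<in> K \<union> L" using xK K_iff[OF x] by simp
  have agc: "?ag \<in> carrier G" using g ac by simp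
  have "(x \<otimes> a \<otimes> inv x) \<otimes> (inv x \<otimes> a \<otimes> inv (inv x)) \<in> cent ?ag"
    using xK by (intro subgroup.m_closed[OF cent_subgroup[OF agc]] * ix) simp
  then have "inv a \<in> cent ?ag" unfolding inv_eq_conj_mult[OF xK a] inv_inv[OF x] .
  then have "a \<in> cent ?ag"
    using subgroup.m_inv_closed[OF cent_subgroup[OF agc], of "inv a"] ac by simp
  then show ?thesis using cent_sym[OF agc] by simp
qed

lemma cl_sub_cent: "a \<in> N \<Longrightarrow> cl a \<subseteq> cent a"
  using conj_commute by (auto simp: cl_def)

lemma cent_sub_N:
  assumes a: "a \<in> N" "a \<noteq> \<one>"
  shows "cent a \<subseteq> N"
proof
  fix g assume g: "g \<in> cent a"
  have ac: "a \<in> carrier G" using a N_carrier by auto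
  have gc: "g \<in> carrier G" using g cent_closed by auto
  have ag: "a \<in> cent g" using cent_sym[OF ac g] .
  have "g \<notin> K"
  proof
    assume k: "g \<in> K"
    then have "a = g \<or> a = inv g" using ag a K3(5)[OF k] by auto
    then show False using a k K_iff[OF gc] by (auto simp: N_def)
  qed
  moreover have "g \<notin> L"
  proof
    assume k: "g \<in> L"
    then have "a = g \<or> a = inv g" using ag a nonreal_3.K3(5)[OF nonreal_3_inv, of g] by (auto simp: KLN_inv)
    then show False using a k L_iff[OF gc] by (auto simp: N_def)
  qed
  ultimately show "g \<in> N" using gc by (simp add: N_def)
qed

text \<open>
  Conjugation by \<open>x\<close> permutes \<open>S\<close> with orbits of length 1 or 3 and fixes only the identity of
  \<open>N\<close>.
\<close>

lemma card_mod_3: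
  assumes S: "S \<subseteq> N" "\<one> \<in> S" and inv: "\<And>s. s \<in> S \<Longrightarrow> x \<otimes> s \<otimes> inv x \<in> S"
  shows "card S mod 3 = 1"
proof -
  have x3: "x \<otimes> (x \<otimes> x) = \<one>" using K3(3)[OF xK] x by simp
  have fx: "{s \<in> S. x \<otimes> s \<otimes> inv x = s} = {\<one>}"
  proof -
    have "s = \<one>" if s: "s \<in> S" "x \<otimes> s \<otimes> inv x = s" for s
    proof -
      have sc: "s \<in> carrier G" using s S N_carrier by auto
      then have "x \<otimes> s = s \<otimes> x" using s(2) x conj_eq_iff[of x s s] by simp
      then have "s \<in> cent x" using sc by (simp add: cent_def)
      then have "s = \<one> \<or> s = x \<or> s = inv x" using K3(5)[OF xK] by simp
      moreover have "x \<notin> N" "inv x \<notin> N" using xK K_iff[OF x] by (auto simp: N_def)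
      ultimately show ?thesis using s(1) S(1) by blast
    qed
    then have "{s \<in> S. x \<otimes> s \<otimes> inv x = s} \<subseteq> {\<one>}" by blast
    moreover have "\<one> \<in> {s \<in> S. x \<otimes> s \<otimes> inv x = s}" using S x by simp
    ultimately show ?thesis by blast
  qed
  have "[card S = card {s \<in> S. x \<otimes> s \<otimes> inv x = s}] (mod 3)"
  proof (rule card_fixed_points_cong)
    show "finite S" using S fin finite_subset by blast
    show "(\<lambda>s. x \<otimes> s \<otimes> inv x) ` S \<subseteq> S" using inv by auto
    fix s assume "s \<in> S"
    then have sc: "s \<in> carrier G" using S N_carrier by auto
    have "x \<otimes> (x \<otimes> (x \<otimes> s \<otimes> inv x) \<otimes> inv x) \<otimes> inv x = (x \<otimes> (x \<otimes> x)) \<otimes> s \<otimes> inv (x \<otimes> (x \<otimes> x))"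
      using sc x by (simp add: m_assoc inv_mult_group)
    then show "((\<lambda>s. x \<otimes> s \<otimes> inv x) ^^ 3) s = s" using sc by (simp add: x3 numeral_3_eq_3)
  qed simp
  then show ?thesis unfolding fx by (simp add: cong_def)
qed

text \<open>
  Let \<open>M\<close> be the subgroup generated by the class of \<open>a\<close>. It lies in the centralizer of \<open>a\<close>
  by \<open>conj_commute\<close>, so \<open>|M|\<close> divides \<open>c(a)\<close>; it is congruent to 1 modulo 3, hence one of
  4, 7, 10. If \<open>|N| = c(a) i\<close>, then the class of \<open>a\<close> has \<open>3 i\<close> elements, and \<open>3 i + 1
  \<le> |M|\<close> leaves few values of \<open>i\<close>.
\<close>

lemma card_N_bound:
  assumes a: "a \<in> N" "a \<noteq> \<one>" and c: "card (cent a) \<le> 12"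
  shows "card N \<in> {4, 7, 10}"
proof -
  have ac: "a \<in> carrier G" using a N_carrier by auto
  define M where "M = generate G (cl a)"
  have M: "subgroup M G" unfolding M_def by (rule generate_is_subgroup) (rule cl_sub[OF ac])
  have Mc: "M \<subseteq> cent a" unfolding M_def
    by (rule generate_subgroup_incl[OF cl_sub_cent[OF a(1)] cent_subgroup[OF ac]])
  have clM: "cl a \<subseteq> M" unfolding M_def by (auto intro: generate.incl)
  have "cl a \<subseteq> {g \<in> carrier G. x \<otimes> g \<otimes> inv x \<in> M}"
    using cl_conj[OF ac _ x] cl_sub[OF ac] clM by blast
  then have Mx: "M \<subseteq> {g \<in> carrier G. x \<otimes> g \<otimes> inv x \<in> M}"
    unfolding M_def by (rule generate_subgroup_incl[OF _ subgroup_normalizing[OF M[unfolded M_def] x]])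
  have q3: "card M mod 3 = 1"
  proof (rule card_mod_3)
    show "M \<subseteq> N" using Mc cent_sub_N[OF a] by simp
    show "\<one> \<in> M" by (rule subgroup.one_closed[OF M])
    show "x \<otimes> s \<otimes> inv x \<in> M" if "s \<in> M" for s using subsetD[OF Mx that] by simp
  qed
  have m3: "card N mod 3 = 1"
    using card_mod_3[OF subset_refl subgroup.one_closed[OF N_subgroup] conj_N[OF _ x]] .
  have q: "card M dvd card (cent a)" by (rule card_subgroup_dvd[OF M cent_subgroup[OF ac] Mc])
  have cN: "card (cent a) dvd card N" by (rule card_subgroup_dvd[OF cent_subgroup[OF ac] N_subgroup cent_sub_N[OF a]])
  have fM: "finite M" by (rule finite_subset[OF Mc finite_cent])
  have "\<one> \<notin> cl a"
  proof
    assume "\<one> \<in> cl a"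
    then have "a \<in> cl \<one>" by (rule cl_sym[OF ac])
    then show False using a by (auto simp: cl_def)
  qed
  then have "card (cl a) + 1 = card (insert \<one> (cl a))" by simp
  also have "\<dots> \<le> card M" by (rule card_mono[OF fM]) (use clM subgroup.one_closed[OF M] in auto)
  finally have cq: "card (cl a) + 1 \<le> card M" .
  obtain i where i: "card N = card (cent a) * i" using cN by (elim dvdE)
  obtain j where j: "card (cent a) = card M * j" using q by (elim dvdE)
  have "card (cl a) * card (cent a) = 3 * card N" using card_cl[OF ac] card_KLN by simp
  then have "card (cl a) * card (cent a) = (3 * i) * card (cent a)" unfolding i by (simp only: ac_simps)
  then have cl: "card (cl a) = 3 * i" using card_cent_pos[OF ac] by (metis mult_cancel2 less_irrefl)
  have "i \<noteq> 0" using m3 i by (intro notI) simp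
  moreover have "j \<noteq> 0" using card_cent_pos[OF ac] j by (intro notI) simp
  ultimately have i0: "i > 0" and j0: "j > 0" by simp_all
  have "card M \<le> card (cent a)" using j j0 by simp
  then have "card M \<le> 12" using c by simp
  moreover have "card M > 1" using cq cl i0 by linarith
  moreover have "q = 4 \<or> q = 7 \<or> q = 10" if "q mod 3 = 1" "q \<le> 12" "q > 1" for q :: nat
    using that by presburger
  ultimately consider "card M = 4" | "card M = 7" | "card M = 10" using q3 by blast
  then show ?thesis
  proof cases
    case 1
    have cj: "card (cent a) = 4 * j" using j 1 by simp
    from 1 have "i = 1" "j \<le> 3" using cq cl i0 c cj by linarith+
    then consider "j = 1" | "j = 2" | "j = 3" using j0 by linarith
    then show ?thesis using i cj m3 \<open>i = 1\<close> by cases simp_all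
  next
    case 2
    have cj: "card (cent a) = 7 * j" using j 2 by simp
    from 2 have "i \<le> 2" "j = 1" using cq cl c cj j0 by linarith+
    then consider "i = 1" | "i = 2" using i0 by linarith
    then show ?thesis using i cj m3 \<open>j = 1\<close> by cases simp_all
  next
    case 3
    have cj: "card (cent a) = 10 * j" using j 3 by simp
    from 3 have "i \<le> 3" "j = 1" using cq cl c cj j0 by linarith+
    then consider "i = 1" | "i = 2" | "i = 3" using i0 by linarith
    then show ?thesis using i cj m3 \<open>j = 1\<close> by cases simp_all
  qed
qed

end

section \<open>Permutation representations on cosets\<close>

lemma permutes_remove_invariant:
  assumes p: "p permutes S" and O: "orb \<subseteq> S" "finite orb" "p ` orb \<subseteq> orb"
  shows "(\<lambda>v. if v \<in> orb then v else p v) permutes (S - orb)"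
    and "v \<in> S - orb \<Longrightarrow> p v \<in> S - orb"
proof -
  have inj: "inj p" using permutes_inj[OF p] .
  have im: "p ` orb = orb" using O inj by (metis card_image card_subset_eq inj_on_subset subset_UNIV)
  show *: "p v \<in> S - orb" if "v \<in> S - orb" for v
  proof -
    have "p v \<notin> p ` orb" using that inj by (auto dest: injD)
    then show ?thesis using that permutes_in_image[OF p] im by auto
  qed
  show "(\<lambda>v. if v \<in> orb then v else p v) permutes (S - orb)"
  proof (rule bij_imp_permutes)
    have "p ` (S - orb) = S - orb"
      using permutes_image[OF p] im inj O by (simp add: image_set_diff)
    then have "bij_betw p (S - orb) (S - orb)" using inj by (auto simp: bij_betw_def dest: injD intro: inj_on_subset)
    then show "bij_betw (\<lambda>v. if v \<in> orb then v else p v) (S - orb) (S - orb)"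
      by (rule bij_betw_cong[THEN iffD1, rotated]) auto
    show "(if v \<in> orb then v else p v) = v" if "v \<notin> S - orb" for v
      using that permutes_not_in[OF p, of v] by auto
  qed
qed

text \<open>
  Here \<open>a\<close> and \<open>b\<close> count the cycles of length 2 and 4 of \<open>p\<close>, each of which is an odd
  permutation. The induction removes one cycle at a time.
\<close>

lemma sign_order_4:
  fixes p :: "'a \<Rightarrow> 'a"
  assumes "finite S" "p permutes S" "\<And>s. p (p (p (p s))) = s"
  shows "\<exists>a b. card {s \<in> S. p (p s) = s} = card {s \<in> S. p s = s} + 2 * a
    \<and> card S = card {s \<in> S. p (p s) = s} + 4 * b \<and> sign p = (-1) ^ (a + b)"
  using assms
proof (induction "card S" arbitrary: S p rule: less_induct)
  case less
  note fin = less.prems(1) and p = less.prems(2) and p4 = less.prems(3)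
  show ?case
  proof (cases "\<forall>s\<in>S. p s = s")
    case True
    then have "p s = s" for s using permutes_not_in[OF p] by (cases "s \<in> S") auto
    then have "p = id" by auto
    then show ?thesis by (intro exI[of _ 0]) simp
  next
    case False
    then obtain s where s: "s \<in> S" "p s \<noteq> s" by auto
    have inj: "p u = p v \<longleftrightarrow> u = v" for u v using permutes_inj[OF p] by (auto dest: injD)
    have step: ?thesis
      if O: "orb \<subseteq> S" "finite orb" "p ` orb \<subseteq> orb" "orb \<noteq> {}" and nf: "\<And>v. v \<in> orb \<Longrightarrow> p v \<noteq> v"
        and c: "permutation c" "sign c = (-1 :: int)" "\<And>v. v \<in> orb \<Longrightarrow> c v = p v" "\<And>v. v \<notin> orb \<Longrightarrow> c v = v"
        and alt: "(card orb = 2 \<and> (\<forall>v\<in>orb. p (p v) = v)) \<or> (card orb = 4 \<and> (\<forall>v\<in>orb. p (p v) \<noteq> v))"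
      for orb c
    proof -
      define q where "q = (\<lambda>v. if v \<in> orb then v else p v)"
      have q: "q permutes (S - orb)" unfolding q_def by (rule permutes_remove_invariant[OF p O(1-3)])
      have nO: "p v \<notin> orb" if v: "v \<notin> orb" for v
      proof (cases "v \<in> S")
        case True
        then show ?thesis using permutes_remove_invariant(2)[OF p O(1-3)] v by auto
      next
        case False
        then show ?thesis using permutes_not_in[OF p] v by simp
      qed
      have q4: "q (q (q (q v))) = v" for v
        using p4[of v] nO by (auto simp: q_def)
      have pcq: "p = c \<circ> q" using c nO by (auto simp: fun_eq_iff q_def)
      have sgn: "sign p = - sign q"
        unfolding pcq using sign_compose[OF c(1) permutes_imp_permutation[OF _ q]] fin c(2) by simp
      have lt: "card (S - orb) < card S" using O fin by (intro psubset_card_mono) auto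
      obtain a b where ab: "card {s \<in> S - orb. q (q s) = s} = card {s \<in> S - orb. q s = s} + 2 * a"
        "card (S - orb) = card {s \<in> S - orb. q (q s) = s} + 4 * b" "sign q = (-1) ^ (a + b)"
        using less.hyps[OF lt _ q q4] fin by auto
      have e1: "{s \<in> S - orb. q s = s} = {s \<in> S. p s = s}" using nf O by (auto simp: q_def)
      have e2: "{s \<in> S - orb. q (q s) = s} = {s \<in> S. p (p s) = s} - orb"
        using nO by (auto simp: q_def)
      have cS: "card S = card (S - orb) + card orb"
        using O fin by (metis card_Diff_subset card_mono le_add_diff_inverse2)
      from alt show ?thesis
      proof (elim disjE conjE)
        assume "card orb = 2" and pp: "\<forall>v\<in>orb. p (p v) = v"
        then have sub: "orb \<subseteq> {s \<in> S. p (p s) = s}" using O(1) by blast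
        have "card orb \<le> card {s \<in> S. p (p s) = s}" using sub fin by (intro card_mono) auto
        then have "card {s \<in> S. p (p s) = s} = card ({s \<in> S. p (p s) = s} - orb) + card orb"
          using card_Diff_subset[OF O(2) sub] by linarith
        then show ?thesis using ab e1 e2 cS sgn \<open>card orb = 2\<close>
          by (intro exI[of _ "Suc a"] exI[of _ b]) simp
      next
        assume "card orb = 4" and pp: "\<forall>v\<in>orb. p (p v) \<noteq> v"
        then have "{s \<in> S. p (p s) = s} - orb = {s \<in> S. p (p s) = s}" by auto
        then show ?thesis using ab e1 e2 cS sgn \<open>card orb = 4\<close>
          by (intro exI[of _ a] exI[of _ "Suc b"]) simp
      qed
    qed
    have pS: "p v \<in> S" if "v \<in> S" for v using that permutes_in_image[OF p] by simp
    show ?thesis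
    proof (cases "p (p s) = s")
      case True
      show ?thesis
        by (rule step[of "{s, p s}" "Transposition.transpose s (p s)"])
           (use s True pS[OF s(1)] permutation_swap_id in
             \<open>auto simp: sign_swap_id Transposition.transpose_def\<close>)
    next
      case False
      define b d e where "b = p s" and "d = p b" and "e = p d"
      have pe: "p e = s" using p4[of s] by (simp add: b_def d_def e_def)
      have ds: "d \<noteq> s" using False by (simp add: b_def d_def)
      have bs: "b \<noteq> s" using s by (simp add: b_def)
      have bd: "b \<noteq> d" using bs by (metis inj b_def d_def)
      have de: "d \<noteq> e" using bd by (metis inj d_def e_def)
      have es: "e \<noteq> s" using de pe by (metis inj e_def)
      have eb: "e \<noteq> b" using ds by (metis inj b_def e_def)
      note ne = ds bs bd de es eb ds[symmetric] bs[symmetric] bd[symmetric] de[symmetric] es[symmetric] eb[symmetric]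
      have pv: "p s = b" "p b = d" "p d = e" "p e = s" by (simp_all only: b_def d_def e_def p4)
      let ?c = "Transposition.transpose s b \<circ> (Transposition.transpose b d \<circ> Transposition.transpose d e)"
      have pc: "permutation ?c" by (intro permutation_compose permutation_swap_id)
      have sc: "sign ?c = (-1 :: int)"
        using ne by (simp add: sign_compose permutation_compose permutation_swap_id sign_swap_id)
      have cc: "?c s = b" "?c b = d" "?c d = e" "?c e = s" using ne by (simp_all add: Transposition.transpose_def)
      have cn: "?c v = v" if "v \<notin> {s, b, d, e}" for v using that by (auto simp: Transposition.transpose_def)
      show ?thesis
      proof (rule step[of "{s, b, d, e}" ?c])
        show "{s, b, d, e} \<subseteq> S" using s pS by (simp add: b_def d_def e_def)
        show "p ` {s, b, d, e} \<subseteq> {s, b, d, e}" using pv by simp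
        show "p v \<noteq> v" if "v \<in> {s, b, d, e}" for v using that pv ne by auto
        show "?c v = p v" if "v \<in> {s, b, d, e}" for v using that pv cc by auto
        have "card {s, b, d, e} = 4" using ne by simp
        moreover have "\<forall>v\<in>{s, b, d, e}. p (p v) \<noteq> v" using pv ne by simp
        ultimately show "(card {s, b, d, e} = 2 \<and> (\<forall>v\<in>{s, b, d, e}. p (p v) = v)) \<or>
          (card {s, b, d, e} = 4 \<and> (\<forall>v\<in>{s, b, d, e}. p (p v) \<noteq> v))" by blast
      qed (use pc sc cn in auto)
    qed
  qed
qed

context finite_grp
begin

text \<open>
  Right multiplication by \<open>g\<^sup>-\<^sup>1\<close> on right cosets, so that the action is a homomorphism for composition.
  Fixing everything else makes it a permutation of the set of cosets in the sense of \<open>permutes\<close>, which signs require.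
\<close>

definition cperm :: "'a set \<Rightarrow> 'a \<Rightarrow> 'a set \<Rightarrow> 'a set" where
  "cperm M g = (\<lambda>C. if C \<in> rcosets M then C #> inv g else C)"

lemma finite_rcosets: "subgroup M G \<Longrightarrow> finite (rcosets M)"
  by (auto simp: RCOSETS_def)

lemma rcosetsE:
  assumes "C \<in> rcosets M"
  obtains y where "y \<in> carrier G" "C = M #> y"
proof -
  have "\<exists>y. y \<in> carrier G \<and> C = M #> y" using assms unfolding RCOSETS_def by blast
  then show thesis using that by blast
qed

lemma cperm_coset:
  assumes M: "subgroup M G" and "y \<in> carrier G" "g \<in> carrier G"
  shows "cperm M g (M #> y) = M #> (y \<otimes> inv g)"
  using assms subgroup.subset[OF M] by (simp add: cperm_def rcosetsI coset_mult_assoc)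

lemma cperm_mult:
  assumes M: "subgroup M G" and g: "g \<in> carrier G" and h: "h \<in> carrier G"
  shows "cperm M (g \<otimes> h) = cperm M g \<circ> cperm M h"
proof
  fix C
  show "cperm M (g \<otimes> h) C = (cperm M g \<circ> cperm M h) C"
  proof (cases "C \<in> rcosets M")
    case True
    then obtain y where "y \<in> carrier G" "C = M #> y" by (rule rcosetsE)
    then show ?thesis using g h by (simp add: cperm_coset[OF M] m_assoc inv_mult_group)
  qed (simp add: cperm_def)
qed

lemma cperm_one: "subgroup M G \<Longrightarrow> cperm M \<one> = id"
  by (rule ext) (auto simp: cperm_def RCOSETS_def coset_mult_assoc subgroup.subset)

lemma cperm_permutes:
  assumes M: "subgroup M G" and g: "g \<in> carrier G"
  shows "cperm M g permutes (rcosets M)"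
proof (rule bij_imp_permutes)
  have in_R: "cperm M h C \<in> rcosets M" if C: "C \<in> rcosets M" and h: "h \<in> carrier G" for C h
  proof -
    obtain y where "y \<in> carrier G" "C = M #> y" using C by (rule rcosetsE)
    then show ?thesis using h subgroup.subset[OF M] by (simp add: cperm_coset[OF M] rcosetsI)
  qed
  have inverse: "cperm M (inv g) (cperm M g C) = C" "cperm M g (cperm M (inv g) C) = C" for C
    using cperm_mult[OF M, of "inv g" g] cperm_mult[OF M, of g "inv g"] g cperm_one[OF M]
    by (simp_all add: fun_eq_iff)
  show "bij_betw (cperm M g) (rcosets M) (rcosets M)"
    by (rule bij_betw_byWitness[of _ "cperm M (inv g)"]) (use inverse in_R g in auto)
  show "cperm M g C = C" if "C \<notin> rcosets M" for C using that by (simp add: cperm_def)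
qed

lemma cperm_permutation: "subgroup M G \<Longrightarrow> g \<in> carrier G \<Longrightarrow> permutation (cperm M g)"
  using permutes_imp_permutation[OF finite_rcosets cperm_permutes] .

lemma rcos_eq_iff:
  assumes M: "subgroup M G" and "y \<in> carrier G" "z \<in> carrier G"
  shows "M #> y = M #> z \<longleftrightarrow> z \<otimes> inv y \<in> M"
proof
  assume "M #> y = M #> z"
  then have "z \<in> M #> y" using rcos_self[OF assms(3) M] by simp
  then show "z \<otimes> inv y \<in> M" using subgroup.rcos_module[OF M is_group assms(2,3)] by simp
next
  assume "z \<otimes> inv y \<in> M"
  then have "z \<in> M #> y" using subgroup.rcos_module[OF M is_group assms(2,3)] by simp
  then show "M #> y = M #> z" using repr_independence assms M by blast
qed

lemma cperm_fix_iff: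
  assumes M: "subgroup M G" and y: "y \<in> carrier G" and g: "g \<in> carrier G"
  shows "cperm M g (M #> y) = M #> y \<longleftrightarrow> y \<otimes> g \<otimes> inv y \<in> M"
proof -
  have "cperm M g (M #> y) = M #> y \<longleftrightarrow> y \<otimes> inv (y \<otimes> inv g) \<in> M"
    using cperm_coset[OF M y g] rcos_eq_iff[OF M, of "y \<otimes> inv g" y] y g by simp
  also have "y \<otimes> inv (y \<otimes> inv g) = y \<otimes> g \<otimes> inv y" using y g by (simp add: inv_mult_group m_assoc)
  finally show ?thesis .
qed

text \<open>
  Both sides count the \<open>y\<close> that lie in a fixed coset, since \<open>g\<close> fixes the coset of \<open>y\<close>
  exactly if it is conjugated into \<open>M\<close> by \<open>y\<close>.
\<close>

lemma card_cperm_fix: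
  assumes M: "subgroup M G" and g: "g \<in> carrier G"
  shows "card {C \<in> rcosets M. cperm M g C = C} * card M = card {y \<in> carrier G. y \<otimes> g \<otimes> inv y \<in> M}"
proof -
  let ?Y = "{y \<in> carrier G. y \<otimes> g \<otimes> inv y \<in> M}" and ?F = "{C \<in> rcosets M. cperm M g C = C}"
  have "card ?Y = (\<Sum>C\<in>?F. card {y \<in> ?Y. M #> y = C})"
  proof (rule card_eq_sum_fibres)
    show "finite ?F" using finite_rcosets[OF M] by simp
    show "(#>) M ` ?Y \<subseteq> ?F"
      using cperm_fix_iff[OF M _ g] subgroup.subset[OF M] by (auto simp: rcosetsI)
  qed simp
  also have "\<dots> = (\<Sum>C\<in>?F. card M)"
  proof (rule sum.cong)
    fix C assume C: "C \<in> ?F"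
    then obtain z where z: "z \<in> carrier G" "C = M #> z" by (auto elim: rcosetsE)
    have "{y \<in> ?Y. M #> y = C} = C"
    proof
      show "{y \<in> ?Y. M #> y = C} \<subseteq> C" using rcos_self[OF _ M] by auto
      show "C \<subseteq> {y \<in> ?Y. M #> y = C}"
      proof
        fix y assume y: "y \<in> C"
        have yc: "y \<in> carrier G" using y z r_coset_subset_G[OF subgroup.subset[OF M]] by blast
        have "C = M #> y" using y z repr_independence M by simp
        then show "y \<in> {y \<in> ?Y. M #> y = C}" using C cperm_fix_iff[OF M yc g] yc by auto
      qed
    qed
    moreover have "card C = card M" using card_cosets_equal[of C M] C subgroup.subset[OF M] by (auto dest: bij_betw_same_card)
    ultimately show "card {y \<in> ?Y. M #> y = C} = card M" by simp
  qed simp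
  finally show ?thesis by simp
qed

text \<open>
  The subgroup \<open>H\<close> is the kernel of the sign of the coset action. Being a kernel it is normal, and it contains all
  elements of order 3.
\<close>

lemma index_2_of_sign:
  assumes M: "subgroup M G" and g: "g \<in> carrier G" and s: "sign (cperm M g) \<noteq> (1::int)"
  obtains H where "subgroup H G" "2 * card H = order G"
    "\<And>h. h \<in> carrier G \<Longrightarrow> h \<otimes> h = inv h \<Longrightarrow> h \<in> H"
    "\<And>h y. h \<in> H \<Longrightarrow> y \<in> carrier G \<Longrightarrow> y \<otimes> h \<otimes> inv y \<in> H"
proof -
  define \<sigma> where "\<sigma> h = (sign (cperm M h) :: int)" for h
  have mult: "\<sigma> (a \<otimes> b) = \<sigma> a * \<sigma> b" if "a \<in> carrier G" "b \<in> carrier G" for a b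
    using that by (simp add: \<sigma>_def cperm_mult[OF M] sign_compose cperm_permutation[OF M])
  have pm: "\<sigma> a = 1 \<or> \<sigma> a = -1" for a unfolding \<sigma>_def by (cases "cperm M a" rule: sign_cases) auto
  have one: "\<sigma> \<one> = 1" by (simp add: \<sigma>_def cperm_one[OF M])
  have inv: "\<sigma> (inv a) = \<sigma> a" if "a \<in> carrier G" for a
    using mult[of "inv a" a] that one pm[of a] pm[of "inv a"] by auto
  define H where "H = {h \<in> carrier G. \<sigma> h = 1}"
  have H: "subgroup H G"
    by (rule subgroupI) (use one mult inv in \<open>auto simp: H_def\<close>)
  have "card ((\<lambda>h. h \<otimes> g) ` H) = card H"
    by (rule card_image) (use g in \<open>auto simp: inj_on_def H_def\<close>)
  moreover have "(\<lambda>h. h \<otimes> g) ` H = carrier G - H"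
  proof
    have sg: "\<sigma> g = -1" using s pm[of g] by (simp add: \<sigma>_def)
    show "(\<lambda>h. h \<otimes> g) ` H \<subseteq> carrier G - H" using g mult sg by (auto simp: H_def)
    show "carrier G - H \<subseteq> (\<lambda>h. h \<otimes> g) ` H"
    proof
      fix a assume a: "a \<in> carrier G - H"
      then have "\<sigma> a = -1" using pm[of a] by (auto simp: H_def)
      then have "a \<otimes> inv g \<in> H" using a g sg mult inv by (simp add: H_def)
      moreover have "a = (a \<otimes> inv g) \<otimes> g" using a g by (simp add: m_assoc)
      ultimately show "a \<in> (\<lambda>h. h \<otimes> g) ` H" by blast
    qed
  qed
  moreover have Hc: "H \<subseteq> carrier G" by (auto simp: H_def)
  ultimately have "card H = order G - card H"
    using finite_subset[OF Hc] by (simp add: card_Diff_subset order_def)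
  moreover have "card H \<le> order G" using Hc by (simp add: order_def card_mono)
  ultimately have c: "2 * card H = order G" by linarith
  have "h \<in> H" if h: "h \<in> carrier G" "h \<otimes> h = inv h" for h
  proof -
    have "\<sigma> h * \<sigma> h = \<sigma> h" using mult[OF h(1) h(1)] inv[OF h(1)] h(2) by simp
    then show ?thesis using pm[of h] h by (auto simp: H_def)
  qed
  moreover have "y \<otimes> h \<otimes> inv y \<in> H" if "h \<in> H" "y \<in> carrier G" for h y
    using that mult[of "y \<otimes> h" "inv y"] mult[of y h] inv[of y] pm[of y] by (auto simp: H_def)
  ultimately show thesis using that[OF H c] by blast
qed

lemma embed_sym_group:
  assumes M: "subgroup M G" and d: "order G = d * card M"
    and core: "\<And>g. g \<in> carrier G \<Longrightarrow> (\<And>y. y \<in> carrier G \<Longrightarrow> y \<otimes> g \<otimes> inv y \<in> M) \<Longrightarrow> g = \<one>"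
  obtains f where "f \<in> hom G (sym_group d)" "inj_on f (carrier G)"
proof -
  have "card M > 0" using subgroup.one_closed[OF M] finite_subset[OF subgroup.subset[OF M]] by (auto simp: card_gt_0_iff)
  then have "card (rcosets M) = d" using lagrange[OF M] d by (simp add: mult.commute)
  then obtain e where e: "bij_betw e (rcosets M) {1..d}"
    using finite_same_card_bij[of "rcosets M" "{1..d}"] finite_rcosets[OF M] by auto
  define f where "f g = map_permutation (rcosets M) e (cperm M g)" for g
  have inj_e: "inj_on e (rcosets M)" using e by (simp add: bij_betw_def)
  have "f \<in> hom G (sym_group d)"
  proof (rule homI)
    fix g assume "g \<in> carrier G"
    then show "f g \<in> carrier (sym_group d)"
      unfolding f_def sym_group_carrier by (intro map_permutation_permutes[OF e] cperm_permutes[OF M])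
  next
    fix g h assume "g \<in> carrier G" "h \<in> carrier G"
    then show "f (g \<otimes> h) = f g \<otimes>\<^bsub>sym_group d\<^esub> f h"
      unfolding f_def sym_group_mult
      by (simp add: cperm_mult[OF M] map_permutation_compose'[OF inj_e cperm_permutes[OF M]])
  qed
  moreover have "inj_on f (carrier G)"
  proof (rule inj_onI)
    fix g h assume g: "g \<in> carrier G" and h: "h \<in> carrier G" and e: "f g = f h"
    have *: "cperm M g C = cperm M h C" if C: "C \<in> rcosets M" for C
    proof -
      have "e (cperm M g C) = e (cperm M h C)"
        using e map_permutation_apply[OF inj_e C] by (metis f_def)
      then show ?thesis
        using inj_e C permutes_in_image[OF cperm_permutes[OF M]] g h by (auto dest: inj_onD)
    qed
    have "inv h \<otimes> g = \<one>"
    proof (rule core)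
      fix y assume y: "y \<in> carrier G"
      have "M #> y \<in> rcosets M" using y subgroup.subset[OF M] by (simp add: rcosetsI)
      from *[OF this] have "M #> (y \<otimes> inv g) = M #> (y \<otimes> inv h)"
        using cperm_coset[OF M y] g h by simp
      then have "(y \<otimes> inv h) \<otimes> inv (y \<otimes> inv g) \<in> M" using rcos_eq_iff[OF M] y g h by simp
      then show "y \<otimes> (inv h \<otimes> g) \<otimes> inv y \<in> M" using y g h by (simp add: m_assoc inv_mult_group)
    qed (use g h in auto)
    then have "h \<otimes> (inv h \<otimes> g) = h" using g h by simp
    then show "g = h" using g h by simp
  qed
  ultimately show thesis by (rule that)
qed

lemma iso_sym_group:
  assumes f: "f \<in> hom G (sym_group d)" "inj_on f (carrier G)" and n: "order G = fact d"
  shows "G \<cong> sym_group d"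
proof -
  have "f ` carrier G \<subseteq> carrier (sym_group d)" using f by (auto simp: hom_def)
  moreover have "card (f ` carrier G) = card (carrier (sym_group d))"
    using card_image[OF f(2)] n by (simp add: order_def sym_group_card_carrier)
  moreover have "finite (carrier (sym_group d))" by (simp add: sym_group_def finite_permutations)
  ultimately have "f ` carrier G = carrier (sym_group d)" by (simp add: card_subset_eq)
  then show ?thesis using f by (auto simp: is_iso_def iso_def bij_betw_def)
qed

text \<open>
  Elements of odd order act by even permutations. If they make up more than half of the group, then all permutations are even,
  because the even ones form a subgroup.
\<close>

lemma iso_alt_group:
  assumes f: "f \<in> hom G (sym_group d)" "inj_on f (carrier G)" and n: "2 * order G = fact d" and d: "d \<ge> 2"
    and O: "S \<subseteq> carrier G" "2 * card S > order G" "\<And>g. g \<in> S \<Longrightarrow> \<exists>m. g [^] (2 * m + 1 :: nat) = \<one>"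
  shows "G \<cong> alt_group d"
proof -
  interpret Sd: group "sym_group d" by (rule sym_group_is_group)
  interpret f: group_hom G "sym_group d" f using f(1) by unfold_locales
  define \<sigma> where "\<sigma> g = (sign (f g) :: int)" for g
  have mult: "\<sigma> (a \<otimes> b) = \<sigma> a * \<sigma> b" if "a \<in> carrier G" "b \<in> carrier G" for a b
    using that sign_compose[OF sym_group_carrier'[OF f.hom_closed[of a]] sym_group_carrier'[OF f.hom_closed[of b]]]
    by (simp add: \<sigma>_def sym_group_mult)
  have pm: "\<sigma> a = 1 \<or> \<sigma> a = -1" for a unfolding \<sigma>_def by (cases "f a" rule: sign_cases) auto
  have one: "\<sigma> \<one> = 1" using f.hom_one by (simp add: \<sigma>_def sym_group_one)
  have pow: "\<sigma> (a [^] (m::nat)) = \<sigma> a ^ m" if "a \<in> carrier G" for a m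
    by (induction m) (simp_all add: one mult that)
  have inv: "\<sigma> (inv a) = \<sigma> a" if "a \<in> carrier G" for a
    using mult[of "inv a" a] that one pm[of a] pm[of "inv a"] by auto
  define H where "H = {h \<in> carrier G. \<sigma> h = 1}"
  have H: "subgroup H G"
    by (rule subgroupI) (use one mult inv in \<open>auto simp: H_def\<close>)
  have "S \<subseteq> H"
  proof
    fix g assume g: "g \<in> S"
    obtain m where m: "g [^] (2 * m + 1 :: nat) = \<one>" using O(3)[OF g] by auto
    have "\<sigma> g ^ (2 * m + 1) = 1" using pow[of g "2 * m + 1"] g O(1) m one by auto
    then show "g \<in> H" using pm[of g] g O(1) by (auto simp: H_def)
  qed
  then have "card S \<le> card H" by (intro card_mono) (auto simp: H_def)
  moreover have "card H dvd order G" using lagrange[OF H] by (metis dvd_triv_right)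
  ultimately have gt: "2 * card H > order G" and dvd: "card H dvd order G" using O(2) by simp_all
  from dvd obtain k where k: "order G = card H * k" "2 * card H > order G" using gt by blast
  then have "k < 2" "k \<noteq> 0" using order_pos by (auto intro: ccontr)
  then have "card H = order G" using k by simp
  then have "H = carrier G" by (intro card_subset_eq) (auto simp: H_def order_def)
  then have even: "evenperm (f g)" if "g \<in> carrier G" for g
    using that by (auto simp: H_def \<sigma>_def sign_def split: if_splits)
  have "f ` carrier G \<subseteq> carrier (alt_group d)"
    using f.hom_closed even by (auto simp: alt_group_carrier sym_group_carrier)
  moreover have "card (f ` carrier G) = card (carrier (alt_group d))"
    using card_image[OF f(2)] n alt_group_card_carrier[OF d] by (simp add: order_def)
  moreover have "finite (carrier (alt_group d))" by (simp add: alt_group_def finite_permutations)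
  ultimately have "f ` carrier G = carrier (alt_group d)" by (simp add: card_subset_eq)
  moreover have "f \<in> hom G (alt_group d)"
    using f(1) calculation by (auto simp: hom_def alt_group_mult sym_group_mult)
  ultimately show ?thesis using f by (auto simp: is_iso_def iso_def bij_betw_def)
qed

end

section \<open>The groups with a non-real element and a small kernel\<close>

context finite_grp
begin

lemma klein_four_subgroup:
  assumes a: "a \<in> carrier G" "a \<otimes> a = \<one>" "a \<noteq> \<one>" and b: "b \<in> carrier G" "b \<otimes> b = \<one>" "b \<noteq> \<one>"
    and ab: "a \<otimes> b = b \<otimes> a" "a \<noteq> b"
  shows "subgroup {\<one>, a, b, a \<otimes> b} G" "card {\<one>, a, b, a \<otimes> b} = 4"
proof -
  have aa': "a \<otimes> (a \<otimes> w) = w" and bb': "b \<otimes> (b \<otimes> w) = w" if "w \<in> carrier G" for w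
    using that a b by (simp_all add: m_assoc[symmetric])
  have ba: "b \<otimes> a = a \<otimes> b" using ab by simp
  have ba': "b \<otimes> (a \<otimes> w) = a \<otimes> (b \<otimes> w)" if "w \<in> carrier G" for w
    using that a b ba by (simp add: m_assoc[symmetric])
  have inv: "inv a = a" "inv b = b" "inv (a \<otimes> b) = a \<otimes> b"
    using a b ba by (simp_all add: inv_equality m_assoc ba' bb')
  show "subgroup {\<one>, a, b, a \<otimes> b} G"
    by (rule subgroupI) (use a b inv in \<open>auto simp: m_assoc aa' bb' ba ba'\<close>)
  have "a \<otimes> b \<noteq> \<one>" "a \<otimes> b \<noteq> a" "a \<otimes> b \<noteq> b"
  proof -
    show "a \<otimes> b \<noteq> \<one>"
    proof
      assume "a \<otimes> b = \<one>"
      then have "a \<otimes> (a \<otimes> b) = a" using a by simp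
      then have "a = b" using aa'[OF b(1)] by simp
      then show False using ab(2) by simp
    qed
  qed (use a b in auto)
  then show "card {\<one>, a, b, a \<otimes> b} = 4" using a b ab by auto
qed

lemma cperm_funpow:
  "subgroup M G \<Longrightarrow> g \<in> carrier G \<Longrightarrow> (cperm M g ^^ k) = cperm M (g [^] k)"
proof (induction k)
  case (Suc k)
  then have "cperm M g ^^ Suc k = cperm M (g \<otimes> g [^] k)" by (simp add: cperm_mult)
  then show ?case using Suc.prems by (simp only: nat_pow_Suc2)
qed (simp add: cperm_one)

lemma cperm_fixed_points_cong:
  assumes p: "Factorial_Ring.prime p" and M: "subgroup M G" and g: "g \<in> carrier G" "g [^] p = \<one>"
  shows "[card (rcosets M) = card {C \<in> rcosets M. cperm M g C = C}] (mod p)"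
  by (rule card_fixed_points_cong[OF p finite_rcosets[OF M]])
     (use permutes_in_image[OF cperm_permutes[OF M g(1)]] cperm_funpow[OF M g(1)] g(2) cperm_one[OF M] in auto)

text \<open>
  In the action on the cosets of the centralizer of \<open>x\<close>, the element \<open>x\<close> fixes one or two points,
  depending on whether it is conjugate to its inverse. The number of fixed points of \<open>y\<close> is congruent to this modulo
  3, so \<open>y\<close> fixes a point as well, and a conjugate of \<open>y\<close> lies in the centralizer of \<open>x\<close>.
\<close>

lemma order_3_conjugate:
  assumes x: "x \<in> carrier G" "card (cent x) = 3" and n: "order G > 3"
    and y: "y \<in> carrier G" "y \<noteq> \<one>" "y \<otimes> y = inv y"
  shows "y \<in> cl x \<or> y \<in> cl (inv x)"
proof -
  note cx = cent_order_3[OF x n]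
  have M: "subgroup (cent x) G" by (rule cent_subgroup[OF x(1)])
  have p3: "Factorial_Ring.prime (3::nat)" by simp
  have pow3: "g [^] (3::nat) = \<one>" if "g \<in> carrier G" "g \<otimes> g = inv g" for g
    using that by (simp add: numeral_3_eq_3)
  let ?F = "\<lambda>g. card {C \<in> rcosets (cent x). cperm (cent x) g C = C}"
  have "{w \<in> carrier G. w \<otimes> x \<otimes> inv w \<in> cent x}
      = {w \<in> carrier G. w \<otimes> x \<otimes> inv w = x} \<union> {w \<in> carrier G. w \<otimes> x \<otimes> inv w = inv x}"
  proof -
    have "w \<otimes> x \<otimes> inv w \<noteq> \<one>" if "w \<in> carrier G" for w using that x cx(1) conj_inj[of w x \<one>] by auto
    then show ?thesis unfolding cx(4) by blast
  qed
  then have "card {w \<in> carrier G. w \<otimes> x \<otimes> inv w \<in> cent x}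
      = card {w \<in> carrier G. w \<otimes> x \<otimes> inv w = x} + card {w \<in> carrier G. w \<otimes> x \<otimes> inv w = inv x}"
    using cx(3) by (simp only:) (subst card_Un_disjoint, auto)
  moreover have "card {w \<in> carrier G. w \<otimes> x \<otimes> inv w = x} = 3" using conj_fibre[OF x(1) cl_self[OF x(1)]] x by simp
  moreover have "card {w \<in> carrier G. w \<otimes> x \<otimes> inv w = inv x} \<le> 3" using conj_fibre_le[OF x(1)] x by metis
  ultimately have "?F x * 3 \<ge> 3" "?F x * 3 \<le> 6" using card_cperm_fix[OF M x(1)] x by simp_all
  then have F: "?F x = 1 \<or> ?F x = 2" by linarith
  have "[?F x = ?F y] (mod 3)"
    using cperm_fixed_points_cong[OF p3 M x(1) pow3[OF x(1) cx(2)]]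
      cperm_fixed_points_cong[OF p3 M y(1) pow3[OF y(1,3)]] cong_trans cong_sym by blast
  then have "?F y \<noteq> 0" using F by (auto simp: cong_def)
  then obtain C where C: "C \<in> rcosets (cent x)" "cperm (cent x) y C = C" by (metis (mono_tags, lifting) card.empty empty_Collect_eq)
  then obtain w where w: "w \<in> carrier G" "C = cent x #> w" by (auto elim: rcosetsE)
  then have "w \<otimes> y \<otimes> inv w \<in> cent x" using cperm_fix_iff[OF M w(1) y(1)] C by simp
  moreover have "w \<otimes> y \<otimes> inv w \<noteq> \<one>" using w y conj_inj[of w y \<one>] by auto
  moreover have "w \<otimes> y \<otimes> inv w \<in> cl y" using w unfolding cl_def by blast
  ultimately have "x \<in> cl y \<or> inv x \<in> cl y" unfolding cx(4) by auto
  then show ?thesis using cl_sym[OF y(1)] by blast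
qed

end

context nonreal_3
begin

text \<open>
  A group of even order contains an involution \<open>z\<close>. Its conjugate by \<open>x\<close> is a different involution that
  commutes with it, so \<open>N\<close> contains a Klein four-group, whose order does not divide 10.
\<close>

lemma card_N_ne_10: "card N \<noteq> 10"
proof
  assume N10: "card N = 10"
  have oneN: "\<one> \<in> N" by (rule subgroup.one_closed[OF N_subgroup])
  have invN: "inv a \<in> N" if "a \<in> N" for a by (rule subgroup.m_inv_closed[OF N_subgroup that])
  have "[card N = card {a \<in> N. inv a = a}] (mod 2)"
  proof (rule card_fixed_points_cong[OF two_is_prime_nat fin(3)])
    show "(\<lambda>a. inv a) ` N \<subseteq> N" using invN by auto
    fix a assume "a \<in> N"
    then show "((\<lambda>a. inv a) ^^ 2) a = a" using N_carrier by (auto simp: numeral_2_eq_2)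
  qed
  then have "even (card {a \<in> N. inv a = a})" using N10 by (simp add: cong_def even_iff_mod_2_eq_zero)
  then have "{a \<in> N. inv a = a} \<noteq> {\<one>}" by (metis card_1_singleton_iff One_nat_def odd_one)
  then obtain z where z: "z \<in> N" "inv z = z" "z \<noteq> \<one>" using oneN by auto
  have zc: "z \<in> carrier G" using z N_carrier by auto
  define y where "y = x \<otimes> z \<otimes> inv x"
  have yN: "y \<in> N" unfolding y_def by (rule conj_N[OF z(1) x])
  have yc: "y \<in> carrier G" using yN N_carrier by auto
  have zz: "z \<otimes> z = \<one>" using z zc by (metis r_inv)
  have yy: "y \<otimes> y = \<one>" unfolding y_def using zz zc x by (simp add: conj_mult)
  have y1: "y \<noteq> \<one>" unfolding y_def using conj_inj[of x z \<one>] zc x z by auto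
  have comm: "z \<otimes> y = y \<otimes> z" using conj_commute[OF x z(1)] by (simp add: cent_def y_def)
  have "z \<noteq> y"
  proof
    assume "z = y"
    then have "x \<otimes> z = z \<otimes> x" using conj_eq_iff[of x z z] x zc by (simp add: y_def)
    then have "z \<in> cent x" using zc by (simp add: cent_def)
    then have "z = x \<or> z = inv x" using K3(5)[OF xK] z by auto
    then show False using z(1) xK K_iff[OF x] by (auto simp: N_def)
  qed
  note V = klein_four_subgroup[OF zc zz z(3) yc yy y1 comm this]
  have "card {\<one>, z, y, z \<otimes> y} dvd card N"
    by (rule card_subgroup_dvd[OF V(1) N_subgroup])
       (use oneN z yN subgroup.m_closed[OF N_subgroup] in auto)
  then show False using V(2) N10 by simp
qed

text \<open>
  The group acts faithfully on the four cosets of the centralizer of \<open>x\<close>, because a class of elements of order 3 has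
  four elements and does not fit into this centralizer. Two thirds of the elements have order 3.
\<close>

lemma order_12_iso:
  assumes n: "order G = 12"
  shows "G \<cong> alt_group 4"
proof -
  have cK: "card K = 4" using card_KLN n by simp
  have M: "subgroup (cent x) G" by (rule cent_subgroup[OF x])
  obtain f where f: "f \<in> hom G (sym_group 4)" "inj_on f (carrier G)"
  proof (rule embed_sym_group[OF M])
    show "order G = 4 * card (cent x)" using n cent_x by simp
    fix g assume g: "g \<in> carrier G" and core: "\<And>y. y \<in> carrier G \<Longrightarrow> y \<otimes> g \<otimes> inv y \<in> cent x"
    have "cl g \<subseteq> cent x" using core by (auto simp: cl_def)
    then have "card (cl g) \<le> 3" using card_mono[of "cent x" "cl g"] cent_x by simp
    then have "g \<notin> K" "g \<notin> L" using K3(7)[of g] nonreal_3.K3(7)[OF nonreal_3_inv, of g] cK card_KLN by (auto simp: KLN_inv)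
    moreover have "g \<in> cent x" using core[of \<one>] g by simp
    then have "g = \<one> \<or> g = x \<or> g = inv x" using K3(5)[OF xK] by simp
    ultimately show "g = \<one>" using xK K_iff[OF x] by blast
  qed blast
  show ?thesis
  proof (rule iso_alt_group[OF f])
    show "2 * order G = fact 4" using n by (simp add: fact_numeral)
    show "K \<union> L \<subseteq> carrier G" using K_carrier L_carrier by auto
    show "2 * card (K \<union> L) > order G" using card_KLN cK n KL_disjoint fin by (simp add: card_Un_disjoint)
    fix g assume g: "g \<in> K \<union> L"
    then have "g \<in> carrier G" "g \<otimes> g = inv g"
      using K3[of g] nonreal_3.K3(1,3)[OF nonreal_3_inv, of g] by (auto simp: KLN_inv)
    then have "g [^] (2 * 1 + 1 :: nat) = \<one>" by (simp add: numeral_eq_Suc)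
    then show "\<exists>m. g [^] (2 * m + 1 :: nat) = \<one>" by blast
  qed simp
qed

end

context finite_grp
begin

text \<open>
  The presentation gives a homomorphism onto the subgroup generated by \<open>g\<close> and \<open>h\<close>. Its order is
  divisible by 7 and by 3, and the presented group has order 21, so the homomorphism is bijective.
\<close>

lemma frobenius_relations_iso:
  assumes g: "g \<in> carrier G" "g \<noteq> \<one>" "g [^] (7::nat) = \<one>"
    and h: "h \<in> carrier G" "h \<noteq> \<one>" "h [^] (3::nat) = \<one>" and rel: "inv h \<otimes> g \<otimes> h = g [^] (2::nat)"
    and n: "order G = 21"
  shows "G \<cong> frobenius21"
proof -
  interpret F: group frobenius21 unfolding frobenius21_def by (rule group_presented_group)
  define \<rho> where "\<rho> = case_frob_gen g h"
  have r: "\<rho> gen_g = g" "\<rho> gen_h = h" by (simp_all add: \<rho>_def)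
  have g7: "g \<otimes> (g \<otimes> (g \<otimes> (g \<otimes> (g \<otimes> (g \<otimes> g))))) = \<one>"
    using g by (simp add: numeral_eq_Suc m_assoc)
  have h3: "h \<otimes> (h \<otimes> h) = \<one>" using h by (simp add: numeral_eq_Suc m_assoc)
  have rel': "inv h \<otimes> (g \<otimes> (h \<otimes> (inv g \<otimes> inv g))) = \<one>"
  proof -
    have "inv h \<otimes> (g \<otimes> (h \<otimes> (inv g \<otimes> inv g))) = (inv h \<otimes> g \<otimes> h) \<otimes> (inv g \<otimes> inv g)"
      using g h by (simp add: m_assoc)
    also have "\<dots> = \<one>" unfolding rel using g by (simp add: numeral_2_eq_2 m_assoc)
    finally show ?thesis .
  qed
  have rc: "\<rho> a \<in> carrier G" for a using g h by (cases a) (simp_all add: r)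
  obtain f where f: "f \<in> hom frobenius21 G" "\<And>u. f (word_class {replicate 7 (Gen gen_g), replicate 3 (Gen gen_h),
      [Inv gen_h, Gen gen_g, Gen gen_h, Inv gen_g, Inv gen_g]} u) = eval_word G \<rho> u"
  proof (rule presented_group_hom[OF is_group, of \<rho> "{replicate 7 (Gen gen_g), replicate 3 (Gen gen_h),
      [Inv gen_h, Gen gen_g, Gen gen_h, Inv gen_g, Inv gen_g]}"])
    fix w assume "w \<in> {replicate 7 (Gen gen_g), replicate 3 (Gen gen_h),
      [Inv gen_h, Gen gen_g, Gen gen_h, Inv gen_g, Inv gen_g]}"
    then show "eval_word G \<rho> w = \<one>"
      using g7 h3 rel' g h by (elim insertE emptyE) (simp_all add: numeral_eq_Suc r)
  qed (use rc in \<open>simp_all add: frobenius21_def\<close>)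
  interpret f: group_hom frobenius21 G f using f(1) by unfold_locales
  define I where "I = f ` carrier frobenius21"
  have I: "subgroup I G" unfolding I_def by (rule f.img_is_subgroup)
  have "eval_word G \<rho> u \<in> I" for u
    unfolding I_def f(2)[symmetric] by (rule imageI) (simp add: frobenius21_def presented_group_def)
  from this[of "[Gen gen_g]"] this[of "[Gen gen_h]"] have gI: "g \<in> I" and hI: "h \<in> I" using g h by (simp_all add: r)
  have dv: "p dvd card I" if "a \<in> I" "a \<noteq> \<one>" "a [^] p = \<one>" "Factorial_Ring.prime p" for a and p :: nat
  proof -
    have a: "a \<in> carrier G" using that(1) subgroup.subset[OF I] by auto
    have "ord a dvd p" using pow_eq_id[OF a] that(3) by simp
    moreover have "ord a \<noteq> 1" using ord_eq_1[OF a] that(2) by simp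
    ultimately have "ord a = p" using that(4) by (metis One_nat_def prime_nat_iff)
    moreover have "card (generate G {a}) dvd card I"
      by (rule card_subgroup_dvd[OF generate_is_subgroup I generate_subgroup_incl[OF _ I]]) (use a that(1) in auto)
    ultimately show ?thesis using generate_pow_card[OF a] by simp
  qed
  have "7 dvd card I" by (rule dv[OF gI g(2,3)]) simp
  moreover have "3 dvd card I" by (rule dv[OF hI h(2,3)]) simp
  moreover have "coprime (7::nat) 3" by (simp add: coprime_iff_gcd_eq_1 gcd_non_0_nat)
  ultimately have "7 * 3 dvd card I" by (rule divides_mult)
  moreover have "card I > 0" using gI finite_subset[OF subgroup.subset[OF I]] by (auto simp: card_gt_0_iff)
  ultimately have c21: "card I \<ge> 21" using dvd_imp_le by fastforce
  have F21: "card (carrier frobenius21) = 21"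
    using iso_same_card[OF frobenius21_iso] card_C7_C3 by simp
  then have finF: "finite (carrier frobenius21)" by (intro card_ge_0_finite) simp
  have "card I \<le> 21" unfolding I_def using card_image_le[OF finF, of f] F21 by simp
  then have cI: "card I = 21" using c21 by simp
  then have "inj_on f (carrier frobenius21)" using finF F21 by (intro eq_card_imp_inj_on) (simp_all add: I_def)
  moreover have "I = carrier G" using cI n subgroup.subset[OF I] by (intro card_subset_eq) (simp_all add: order_def)
  ultimately have "f \<in> iso frobenius21 G" using f(1) by (auto simp: iso_def bij_betw_def I_def)
  then show ?thesis using F.iso_sym by (auto simp: is_iso_def)
qed

end

context nonreal_3
begin

text \<open>
  The subgroup \<open>N\<close> is generated by some \<open>g\<close> of order 7, and conjugation by
  \<open>x\<^sup>-\<^sup>1\<close> takes \<open>g\<close> to a power \<open>g\<^sup>i\<close> with \<open>i\<^sup>3 = 1\<close>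
  modulo 7. As \<open>x\<close> does not centralize \<open>g\<close>, the exponent is 2 or 4, and replacing \<open>x\<close> by
  its inverse exchanges these two values.
\<close>

lemma order_21_iso:
  assumes n: "order G = 21"
  shows "G \<cong> frobenius21"
proof -
  have cN: "card N = 7" using card_KLN n by simp
  have "N \<noteq> {\<one>}" using cN by auto
  then obtain g where g: "g \<in> N" "g \<noteq> \<one>" using subgroup.one_closed[OF N_subgroup] by auto
  have gc: "g \<in> carrier G" using g N_carrier by auto
  have p7: "Factorial_Ring.prime (7::nat)" by simp
  have "card (generate G {g}) dvd card N"
    by (rule card_subgroup_dvd[OF generate_is_subgroup N_subgroup generate_subgroup_incl[OF _ N_subgroup]]) (use gc g in auto)
  then have "ord g dvd 7" using generate_pow_card[OF gc] cN by simp
  moreover have "ord g \<noteq> 1" using ord_eq_1[OF gc] g by simp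
  ultimately have o: "ord g = 7" using p7 by (metis prime_nat_iff One_nat_def)
  have "generate G {g} = N"
  proof (rule card_subset_eq[OF fin(3)])
    show "generate G {g} \<subseteq> N" by (rule generate_subgroup_incl[OF _ N_subgroup]) (use g in auto)
    show "card (generate G {g}) = card N" using generate_pow_card[OF gc] o cN by simp
  qed
  then have "N = {g [^] k | k. k \<in> (UNIV :: nat set)}" using generate_pow_on_finite_carrier[OF finite_carrier gc] by simp
  moreover have "inv x \<otimes> g \<otimes> inv (inv x) \<in> N" by (rule conj_N) (use g x in auto)
  ultimately obtain k :: nat where "inv x \<otimes> g \<otimes> inv (inv x) = g [^] k" by auto
  then have k: "inv x \<otimes> g \<otimes> x = g [^] k" using x by simp
  have g7: "g [^] (7::nat) = \<one>" using o pow_ord_eq_1[OF gc] by simp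
  have red: "g [^] (m::nat) = g [^] (m mod 7)" for m
  proof -
    have "g [^] m = g [^] (7 * (m div 7) + m mod 7)" by simp
    also have "\<dots> = (g [^] (7::nat)) [^] (m div 7) \<otimes> g [^] (m mod 7)"
      using gc by (simp only: nat_pow_mult[symmetric] nat_pow_pow)
    finally show ?thesis using gc g7 by (simp only: nat_pow_one l_one nat_pow_closed)
  qed
  define i where "i = k mod 7"
  have i: "inv x \<otimes> g \<otimes> x = g [^] i" using k red[of k] by (simp add: i_def)
  have i7: "i < 7" by (simp add: i_def)
  have ipow: "inv x \<otimes> g [^] (m::nat) \<otimes> x = g [^] (i * m)" for m
    using conj_pow[of "inv x" g m] x gc i by (simp add: nat_pow_pow)
  have xx: "x \<otimes> x = inv x" "inv x \<otimes> inv x = x" using K3(3)[OF xK] x by (simp, metis inv_inv inv_mult_group)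
  have i2: "x \<otimes> g \<otimes> inv x = g [^] (i * i)"
  proof -
    have "x \<otimes> g \<otimes> inv x = (inv x \<otimes> inv x) \<otimes> g \<otimes> (x \<otimes> x)" using xx by simp
    also have "\<dots> = inv x \<otimes> (inv x \<otimes> g \<otimes> x) \<otimes> x" using x gc by (simp add: m_assoc)
    finally show ?thesis using i ipow by simp
  qed
  have "g = inv x \<otimes> (x \<otimes> g \<otimes> inv x) \<otimes> x" using x gc by (simp add: m_assoc)
  also have "\<dots> = g [^] (i * (i * i))" unfolding i2 ipow ..
  finally have "g [^] (1::nat) = g [^] (i * (i * i))" using gc by simp
  then have "g [^] (1::nat) = g [^] ((i * (i * i)) mod 7)" using red[of "i * (i * i)"] by simp
  moreover have "i * (i * i) mod 7 \<le> 6" using mod_less_divisor[of 7 "i * (i * i)"] by linarith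
  ultimately have "1 = (i * (i * i)) mod 7"
    using inj_onD[OF ord_inj[OF gc], of 1 "i * (i * i) mod 7"] by (simp add: o)
  moreover have "i = 0 \<or> i = 1 \<or> i = 2 \<or> i = 3 \<or> i = 4 \<or> i = 5 \<or> i = 6" using i7 by linarith
  moreover have "i \<noteq> 1"
  proof
    assume "i = 1"
    then have e: "inv x \<otimes> g \<otimes> x = g" using i gc by simp
    have "x \<otimes> (inv x \<otimes> g \<otimes> x) = x \<otimes> g" unfolding e ..
    then have "g \<otimes> x = x \<otimes> g" using x gc by (simp add: m_assoc)
    then have "g \<in> cent x" using gc by (simp add: cent_def)
    then have "g = x \<or> g = inv x" using K3(5)[OF xK] g by auto
    then show False using g(1) xK K_iff[OF x] by (auto simp: N_def)
  qed
  ultimately have i24: "i = 2 \<or> i = 4" by auto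
  have x3: "x [^] (3::nat) = \<one>" "inv x [^] (3::nat) = \<one>" "x \<noteq> \<one>" "inv x \<noteq> \<one>"
    using K3(2,3)[OF xK] x xx by (simp_all add: numeral_3_eq_3 inv_eq_1_iff)
  from i24 show ?thesis
  proof
    assume "i = 2"
    then show ?thesis using frobenius_relations_iso[OF gc g(2) g7 x x3(3,1) _ n] i by simp
  next
    assume "i = 4"
    then have "x \<otimes> g \<otimes> inv x = g [^] (2::nat)" using i2 red[of 16] by simp
    then show ?thesis using frobenius_relations_iso[OF gc g(2) g7 _ x3(4,2) _ n] x by simp
  qed
qed

theorem small_centralizer_classification:
  assumes a: "a \<in> N" "a \<noteq> \<one>" and c: "card (cent a) \<le> 12"
  shows "order G = 12 \<or> order G = 21"
  using card_N_bound[OF a c] card_N_ne_10 card_KLN by auto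

end

section \<open>Odd permutations from two classes with centralizers of order 4\<close>

lemma card_fixed_points_parity_4:
  fixes f :: "'a \<Rightarrow> 'a"
  assumes fin: "finite S" and im: "f ` S \<subseteq> S" and f4: "\<And>s. s \<in> S \<Longrightarrow> f (f (f (f s))) = s"
  shows "even (card S) = even (card {s \<in> S. f s = s})"
proof -
  let ?F = "{s \<in> S. f (f s) = s}"
  have "[card S = card ?F] (mod 2)"
    using card_fixed_points_cong[OF two_is_prime_nat fin, of "\<lambda>s. f (f s)"] im f4 by (auto simp: numeral_2_eq_2 image_subset_iff)
  moreover have "[card ?F = card {s \<in> ?F. f s = s}] (mod 2)"
    using im fin by (intro card_fixed_points_cong[OF two_is_prime_nat]) (auto simp: numeral_2_eq_2)
  moreover have "{s \<in> ?F. f s = s} = {s \<in> S. f s = s}" by auto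
  ultimately show ?thesis by (simp add: cong_def even_iff_mod_2_eq_zero)
qed

context finite_grp
begin

lemma cent_order_4:
  assumes z: "z \<in> carrier G" "card (cent z) = 4" and zz: "z \<otimes> z \<noteq> \<one>"
  shows "cent z = {\<one>, z, z \<otimes> z, inv z}" "(z \<otimes> z) \<otimes> (z \<otimes> z) = \<one>" "z \<noteq> inv z" "z \<noteq> \<one>"
    "z \<otimes> z \<noteq> z" "z \<otimes> z \<noteq> inv z" "inv z \<noteq> \<one>" "inv z \<otimes> inv z = z \<otimes> z"
proof -
  have "z [^] (4::nat) = \<one>" using pow_card_cent[OF z(1)] z by simp
  then show 4: "(z \<otimes> z) \<otimes> (z \<otimes> z) = \<one>" using z by (simp add: numeral_eq_Suc m_assoc)
  show 1: "z \<noteq> \<one>" using zz z by auto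
  show 2: "z \<noteq> inv z" using zz z by (metis r_inv)
  show 3: "z \<otimes> z \<noteq> z" using 1 z by auto
  show 5: "z \<otimes> z \<noteq> inv z"
  proof
    assume "z \<otimes> z = inv z"
    then have "(z \<otimes> z) \<otimes> z = \<one>" using z by simp
    then have "((z \<otimes> z) \<otimes> z) \<otimes> z = z" using z by simp
    then show False using 4 1 z by (simp add: m_assoc)
  qed
  show 6: "inv z \<noteq> \<one>" using 1 z by (simp add: inv_eq_1_iff)
  have "inv (z \<otimes> z) = z \<otimes> z" using 4 z by (simp add: inv_equality)
  then show "inv z \<otimes> inv z = z \<otimes> z" using z by (simp add: inv_mult_group)
  have "{\<one>, z, z \<otimes> z, inv z} \<subseteq> cent z"
    using cent_one[OF z(1)] cent_self[OF z(1)] subgroup.m_inv_closed[OF cent_subgroup[OF z(1)]]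
      subgroup.m_closed[OF cent_subgroup[OF z(1)]] by auto
  moreover have "card {\<one>, z, z \<otimes> z, inv z} = 4"
    using 1 2 3 5 6 zz by (simp add: eq_commute)
  ultimately show "cent z = {\<one>, z, z \<otimes> z, inv z}" using z by (metis card_subset_eq finite_cent)
qed

text \<open>
  For an element whose fourth power is trivial, the sign of its coset action is determined by the numbers \<open>F1\<close> and
  \<open>F2\<close> of cosets that are fixed by the element and by its square, and these are counted by conjugators.
\<close>

lemma cperm_sign:
  assumes M: "subgroup M G" and g: "g \<in> carrier G" "(g \<otimes> g) \<otimes> (g \<otimes> g) = \<one>"
    and F1: "card {y \<in> carrier G. y \<otimes> g \<otimes> inv y \<in> M} = F1 * card M"
    and F2: "card {y \<in> carrier G. y \<otimes> (g \<otimes> g) \<otimes> inv y \<in> M} = F2 * card M"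
    and n: "order G = r * card M"
  shows "\<exists>a b. F2 = F1 + 2 * a \<and> r = F2 + 4 * b \<and> sign (cperm M g) = (-1 :: int) ^ (a + b)"
proof -
  have cM: "card M > 0" using subgroup.one_closed[OF M] finite_subset[OF subgroup.subset[OF M]] by (auto simp: card_gt_0_iff)
  have gg: "cperm M g (cperm M g C) = cperm M (g \<otimes> g) C" for C using cperm_mult[OF M g(1) g(1)] by simp
  have 4: "cperm M g (cperm M g (cperm M g (cperm M g C))) = C" for C
  proof -
    have "cperm M (g \<otimes> g) (cperm M (g \<otimes> g) C) = cperm M ((g \<otimes> g) \<otimes> (g \<otimes> g)) C"
      using cperm_mult[OF M, of "g \<otimes> g" "g \<otimes> g"] g(1) by simp
    then show ?thesis using g(2) cperm_one[OF M] by (simp add: gg)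
  qed
  have "card {C \<in> rcosets M. cperm M g C = C} = F1" using card_cperm_fix[OF M g(1)] F1 cM by simp
  moreover have "card {C \<in> rcosets M. cperm M g (cperm M g C) = C} = F2"
    unfolding gg using card_cperm_fix[OF M, of "g \<otimes> g"] g F2 cM by simp
  moreover have "card (rcosets M) = r" using lagrange[OF M] n cM by simp
  ultimately show ?thesis
    using sign_order_4[OF finite_rcosets[OF M] cperm_permutes[OF M g(1)] 4] by auto
qed

lemma card_conj_none:
  assumes "g \<in> carrier G" "\<And>m. m \<in> M \<Longrightarrow> m \<notin> cl g"
  shows "card {y \<in> carrier G. y \<otimes> g \<otimes> inv y \<in> M} = 0"
proof -
  have "{y \<in> carrier G. y \<otimes> g \<otimes> inv y \<in> M} = {}" using assms unfolding cl_def by blast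
  then show ?thesis by (simp only: card.empty)
qed

lemma card_conj_one:
  assumes g: "g \<in> carrier G" and h: "h \<in> M" "h \<in> cl g" and "\<And>m. m \<in> M \<Longrightarrow> m \<noteq> h \<Longrightarrow> m \<notin> cl g"
  shows "card {y \<in> carrier G. y \<otimes> g \<otimes> inv y \<in> M} = card (cent g)"
proof -
  have "{y \<in> carrier G. y \<otimes> g \<otimes> inv y \<in> M} = {y \<in> carrier G. y \<otimes> g \<otimes> inv y = h}"
    using assms unfolding cl_def by blast
  then show ?thesis using conj_fibre[OF g h(2)] by (simp only:)
qed

lemma card_conj_two:
  assumes g: "g \<in> carrier G" and h: "h \<in> M" "h \<in> cl g" and k: "k \<in> M" "k \<in> cl g" "h \<noteq> k"
    and o: "\<And>m. m \<in> M \<Longrightarrow> m \<noteq> h \<Longrightarrow> m \<noteq> k \<Longrightarrow> m \<notin> cl g"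
  shows "card {y \<in> carrier G. y \<otimes> g \<otimes> inv y \<in> M} = 2 * card (cent g)"
proof -
  have "{y \<in> carrier G. y \<otimes> g \<otimes> inv y \<in> M} = {y \<in> carrier G. y \<otimes> g \<otimes> inv y = h} \<union> {y \<in> carrier G. y \<otimes> g \<otimes> inv y = k}"
    using assms unfolding cl_def by blast
  moreover have "{y \<in> carrier G. y \<otimes> g \<otimes> inv y = h} \<inter> {y \<in> carrier G. y \<otimes> g \<otimes> inv y = k} = {}" using k by auto
  ultimately show ?thesis using conj_fibre[OF g h(2)] conj_fibre[OF g k(2)] by (simp add: card_Un_disjoint)
qed

lemma one_in_cl: "g \<in> carrier G \<Longrightarrow> \<one> \<in> cl g \<Longrightarrow> g = \<one>"
  using cl_sym[of g \<one>] by (auto simp: cl_def)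

lemma cl_square: "g \<in> carrier G \<Longrightarrow> h \<in> cl g \<Longrightarrow> h \<otimes> h \<in> cl (g \<otimes> g)"
  by (auto simp: cl_def conj_mult)

lemma subgroup_pair:
  assumes "z \<in> carrier G" "z \<otimes> z = \<one>" "z \<noteq> \<one>"
  shows "subgroup {\<one>, z} G" "card {\<one>, z} = 2"
proof -
  have "inv z = z" using assms by (simp add: inv_equality)
  then show "subgroup {\<one>, z} G" by (intro subgroupI) (use assms in auto)
qed (use assms in simp)

text \<open>
  The involution fixes two of the \<open>|G| / 2\<close> cosets of the subgroup that it generates, namely its centralizer split
  into cosets, and interchanges the others in pairs.
\<close>

lemma sign_involution:
  assumes z: "z \<in> carrier G" "z \<otimes> z = \<one>" "z \<noteq> \<one>" "card (cent z) = 4"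
  shows "\<exists>a. order G = 4 + 4 * a \<and> sign (cperm {\<one>, z} z) = (-1 :: int) ^ a"
proof -
  note M = subgroup_pair[OF z(1-3)]
  have "card {y \<in> carrier G. y \<otimes> z \<otimes> inv y \<in> {\<one>, z}} = card (cent z)"
    by (rule card_conj_one[of z z]) (use z cl_self one_in_cl in auto)
  then have F1: "card {y \<in> carrier G. y \<otimes> z \<otimes> inv y \<in> {\<one>, z}} = 2 * card {\<one>, z}" using z(4) M(2) by simp
  obtain r where r: "order G = r * card {\<one>, z}" using lagrange[OF M(1)] by metis
  have "{y \<in> carrier G. y \<otimes> (z \<otimes> z) \<otimes> inv y \<in> {\<one>, z}} = carrier G" using z by auto
  then have F2: "card {y \<in> carrier G. y \<otimes> (z \<otimes> z) \<otimes> inv y \<in> {\<one>, z}} = r * card {\<one>, z}"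
    using r by (simp only: order_def)
  obtain a b where "r = 2 + 2 * a" "r = r + 4 * b" "sign (cperm {\<one>, z} z) = (-1 :: int) ^ (a + b)"
    using cperm_sign[OF M(1) z(1) _ F1 F2 r] z by auto
  then show ?thesis using r M(2) by auto
qed

text \<open>
  The regular representation consists of \<open>|G| / 4\<close> cycles of length 4.
\<close>

lemma sign_regular_order_4:
  assumes z: "z \<in> carrier G" "(z \<otimes> z) \<otimes> (z \<otimes> z) = \<one>" "z \<otimes> z \<noteq> \<one>"
  shows "\<exists>b. order G = 4 * b \<and> sign (cperm {\<one>} z) = (-1 :: int) ^ b"
proof -
  have M: "subgroup {\<one>} G" by (rule subgroupI) auto
  have z1: "z \<noteq> \<one>" using z by auto
  have F1: "card {y \<in> carrier G. y \<otimes> z \<otimes> inv y \<in> {\<one>}} = 0 * card {\<one>}"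
    using card_conj_none[of z "{\<one>}"] one_in_cl[of z] z z1 by auto
  have F2: "card {y \<in> carrier G. y \<otimes> (z \<otimes> z) \<otimes> inv y \<in> {\<one>}} = 0 * card {\<one>}"
    using card_conj_none[of "z \<otimes> z" "{\<one>}"] one_in_cl[of "z \<otimes> z"] z by auto
  have r: "order G = order G * card {\<one>}" by simp
  from cperm_sign[OF M z(1,2) F1 F2 r] show ?thesis by auto
qed

text \<open>
  Put \<open>m = |G| / 4\<close>. An involution \<open>z\<close> with centralizer of order 4 is a product of \<open>m - 1\<close>
  transpositions on the cosets of \<open>\<langle>z\<rangle>\<close>, an involution from another class is a product of
  \<open>m\<close> transpositions there, and an element of order 4 is a product of \<open>m\<close> cycles of length 4 in the
  regular representation. So if one of \<open>z\<close>, \<open>w\<close> is an involution, then two consecutive numbers occur,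
  and one of them is odd.

  Let both have order 4. If \<open>z\<close> is not conjugate to its inverse, then it fixes a single coset of
  \<open>\<langle>z\<rangle>\<close>, so the number \<open>m\<close> of cosets is odd, and the regular representation of
  \<open>z\<close> is odd. If it is, then \<open>z\<close> fixes two cosets and \<open>w\<close> none, but
  \<open>z\<^sup>2\<close> and \<open>w\<^sup>2\<close> are conjugate and fix the same number. So \<open>z\<close> and
  \<open>w\<close> have the same number of cycles of length 4, their numbers of transpositions differ by one, and one of them is
  odd.
\<close>

lemma odd_sign_exists:
  assumes z: "z \<in> carrier G" "card (cent z) = 4" and w: "w \<in> carrier G" "card (cent w) = 4"
    and zw: "w \<notin> cl z" and n: "order G > 4"
  shows "\<exists>M g. subgroup M G \<and> g \<in> carrier G \<and> sign (cperm M g) \<noteq> (1::int)"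
proof -
  have ne: "z \<noteq> \<one>" "w \<noteq> \<one>" using z w n cent_of_one by (auto simp: order_def)
  have mixed: ?thesis
    if a: "a \<in> carrier G" "card (cent a) = 4" "a \<otimes> a = \<one>" "a \<noteq> \<one>"
      and b: "b \<in> carrier G" "card (cent b) = 4" "b \<otimes> b \<noteq> \<one>" for a b
  proof -
    obtain i where i: "order G = 4 + 4 * i" "sign (cperm {\<one>, a} a) = (-1 :: int) ^ i"
      using sign_involution[OF a(1,3,4,2)] by auto
    obtain j where j: "order G = 4 * j" "sign (cperm {\<one>} b) = (-1 :: int) ^ j"
      using sign_regular_order_4[OF b(1) cent_order_4(2)[OF b] b(3)] by auto
    have "j = Suc i" using i j by simp
    then have "sign (cperm {\<one>, a} a) \<noteq> (1::int) \<or> sign (cperm {\<one>} b) \<noteq> (1::int)"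
      using i(2) j(2) by (cases "even i") auto
    moreover have "subgroup {\<one>, a} G" "subgroup {\<one>} G"
      using subgroup_pair[OF a(1,3,4)] by (auto intro: subgroupI)
    ultimately show ?thesis using a b by blast
  qed
  consider "z \<otimes> z = \<one>" "w \<otimes> w = \<one>" | "z \<otimes> z = \<one>" "w \<otimes> w \<noteq> \<one>" | "z \<otimes> z \<noteq> \<one>" "w \<otimes> w = \<one>"
    | "z \<otimes> z \<noteq> \<one>" "w \<otimes> w \<noteq> \<one>" "inv z \<notin> cl z" | "z \<otimes> z \<noteq> \<one>" "w \<otimes> w \<noteq> \<one>" "inv z \<in> cl z" by blast
  then show ?thesis
  proof cases
    case 1
    note M = subgroup_pair[OF z(1) 1(1) ne(1)]
    obtain i where i: "order G = 4 + 4 * i" "sign (cperm {\<one>, z} z) = (-1 :: int) ^ i"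
      using sign_involution[OF z(1) 1(1) ne(1) z(2)] by auto
    have zcw: "z \<notin> cl w" using zw cl_sym[OF w(1)] by auto
    have F1: "card {y \<in> carrier G. y \<otimes> w \<otimes> inv y \<in> {\<one>, z}} = 0 * card {\<one>, z}"
      using card_conj_none[of w "{\<one>, z}"] zcw one_in_cl[OF w(1)] ne w by auto
    have r: "order G = (2 + 2 * i) * card {\<one>, z}" using i M(2) by simp
    have "{y \<in> carrier G. y \<otimes> (w \<otimes> w) \<otimes> inv y \<in> {\<one>, z}} = carrier G" using 1 by auto
    then have F2: "card {y \<in> carrier G. y \<otimes> (w \<otimes> w) \<otimes> inv y \<in> {\<one>, z}} = (2 + 2 * i) * card {\<one>, z}"
      using r by (simp only: order_def)
    obtain a b where ab: "2 + 2 * i = 0 + 2 * a" "2 + 2 * i = 2 + 2 * i + 4 * b" "sign (cperm {\<one>, z} w) = (-1 :: int) ^ (a + b)"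
      using cperm_sign[OF M(1) w(1) _ F1 F2 r] 1 by auto
    then have "a + b = Suc i" by simp
    then have "sign (cperm {\<one>, z} w) = (-1 :: int) ^ Suc i" using ab(3) by (simp only:)
    then have "sign (cperm {\<one>, z} z) \<noteq> (1::int) \<or> sign (cperm {\<one>, z} w) \<noteq> (1::int)"
      using i(2) by (cases "even i") auto
    then show ?thesis using M(1) z w by blast
  next
    case 2
    then show ?thesis using mixed[of z w] z w ne by blast
  next
    case 3
    then show ?thesis using mixed[of w z] z w ne by blast
  next
    case 4
    note cz = cent_order_4[OF z 4(1)]
    have M: "subgroup (cent z) G" by (rule cent_subgroup[OF z(1)])
    have nz: "z \<otimes> z \<notin> cl z"
    proof
      assume "z \<otimes> z \<in> cl z"
      then have "(z \<otimes> z) \<otimes> (z \<otimes> z) \<in> cl (z \<otimes> z)" by (rule cl_square[OF z(1)])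
      then show False using one_in_cl[of "z \<otimes> z"] cz(2) 4(1) z by simp
    qed
    have "card {y \<in> carrier G. y \<otimes> z \<otimes> inv y \<in> cent z} = card (cent z)"
      by (rule card_conj_one[of z z]) (use z cl_self[OF z(1)] one_in_cl[OF z(1)] nz 4(3) cz(1) ne in auto)
    then have F1: "card {y \<in> carrier G. y \<otimes> z \<otimes> inv y \<in> cent z} = 1 * card (cent z)" by simp
    have F2: "card {y \<in> carrier G. y \<otimes> (z \<otimes> z) \<otimes> inv y \<in> cent z}
        = card {C \<in> rcosets (cent z). cperm (cent z) (z \<otimes> z) C = C} * card (cent z)"
      using card_cperm_fix[OF M, of "z \<otimes> z"] z by simp
    obtain r where r: "order G = r * card (cent z)" using lagrange[OF M] by metis
    obtain a b where "card {C \<in> rcosets (cent z). cperm (cent z) (z \<otimes> z) C = C} = 1 + 2 * a"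
      "r = card {C \<in> rcosets (cent z). cperm (cent z) (z \<otimes> z) C = C} + 4 * b"
      using cperm_sign[OF M z(1) cz(2) F1 F2 r] by auto
    then have "odd r" by simp
    moreover obtain j where j: "order G = 4 * j" "sign (cperm {\<one>} z) = (-1 :: int) ^ j"
      using sign_regular_order_4[OF z(1) cz(2) 4(1)] by auto
    ultimately have "odd j" using r z by simp
    then have "sign (cperm {\<one>} z) \<noteq> (1::int)" using j by simp
    moreover have "subgroup {\<one>} G" by (auto intro: subgroupI)
    ultimately show ?thesis using z by blast
  next
    case 5
    note cz = cent_order_4[OF z 5(1)] and cw = cent_order_4[OF w 5(2)]
    define t where "t = z \<otimes> z"
    have tc: "t \<in> carrier G" and t1: "t \<noteq> \<one>" and tt: "t \<otimes> t = \<one>" using z 5 cz(2) by (simp_all add: t_def)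
    have inv_cl: "s \<in> carrier G" "s \<noteq> \<one>" "s \<otimes> s = \<one>" if "s \<in> cl t" for s
    proof -
      show "s \<in> carrier G" using clD[OF tc that] .
      show "s \<noteq> \<one>" using that one_in_cl[OF tc] t1 by auto
      show "s \<otimes> s = \<one>" using that tc tt by (auto simp: cl_def conj_mult)
    qed
    have only: "s = v \<otimes> v" if v: "v \<in> carrier G" "card (cent v) = 4" "v \<otimes> v \<noteq> \<one>" and s: "s \<in> cl t" "s \<in> cent v" for v s
    proof -
      have "s = \<one> \<or> s = v \<or> s = v \<otimes> v \<or> s = inv v" using s(2) cent_order_4(1)[OF v] by auto
      then show ?thesis using inv_cl[OF s(1)] v(3) cent_order_4(8)[OF v] by auto
    qed
    \<comment> \<open>The squares are conjugate: \<open>z\<close> fixes only \<open>t\<close> in the class of \<open>t\<close>, so this class has odd size, and \<open>w\<close> fixes some element of it.\<close>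
    have fixpts: "even (card (cl t)) = even (card {s \<in> cl t. v \<otimes> s \<otimes> inv v = s})"
      if v: "v \<in> carrier G" "(v \<otimes> v) \<otimes> (v \<otimes> v) = \<one>" for v
    proof (rule card_fixed_points_parity_4)
      show "(\<lambda>s. v \<otimes> s \<otimes> inv v) ` cl t \<subseteq> cl t" using cl_conj[OF tc _ v(1)] by auto
      fix s assume "s \<in> cl t"
      then have sc: "s \<in> carrier G" using inv_cl by simp
      have "v \<otimes> (v \<otimes> (v \<otimes> (v \<otimes> s \<otimes> inv v) \<otimes> inv v) \<otimes> inv v) \<otimes> inv v
          = ((v \<otimes> v) \<otimes> (v \<otimes> v)) \<otimes> s \<otimes> inv ((v \<otimes> v) \<otimes> (v \<otimes> v))"
        using sc v(1) by (simp add: m_assoc inv_mult_group)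
      then show "v \<otimes> (v \<otimes> (v \<otimes> (v \<otimes> s \<otimes> inv v) \<otimes> inv v) \<otimes> inv v) \<otimes> inv v = s" using v sc by simp
    qed simp
    have fix_cent: "{s \<in> cl t. v \<otimes> s \<otimes> inv v = s} = cl t \<inter> cent v" if v: "v \<in> carrier G" for v
      using conj_eq_iff[OF v] inv_cl(1) by (auto simp: cent_def)
    have "cl t \<inter> cent z = {t}"
      using only[OF z 5(1)] cl_self[OF tc] cz(1) by (auto simp: t_def)
    then have "odd (card (cl t))" using fixpts[OF z(1) cz(2)] fix_cent[OF z(1)] by simp
    then have "cl t \<inter> cent w \<noteq> {}" using fixpts[OF w(1) cw(2)] fix_cent[OF w(1)] by auto
    then have wt: "w \<otimes> w \<in> cl t" using only[OF w 5(2)] by auto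
    have M: "subgroup (cent z) G" by (rule cent_subgroup[OF z(1)])
    have nz: "z \<otimes> z \<notin> cl v" if v: "v \<in> carrier G" "(v \<otimes> v) \<noteq> \<one>" for v
    proof
      assume "z \<otimes> z \<in> cl v"
      then have "(z \<otimes> z) \<otimes> (z \<otimes> z) \<in> cl (v \<otimes> v)" by (rule cl_square[OF v(1)])
      then show False using one_in_cl[of "v \<otimes> v"] cz(2) v by simp
    qed
    have "card {y \<in> carrier G. y \<otimes> z \<otimes> inv y \<in> cent z} = 2 * card (cent z)"
    proof (rule card_conj_two[OF z(1) cent_self[OF z(1)] cl_self[OF z(1)] _ 5(3) cz(3)])
      show "inv z \<in> cent z" by (simp add: cz(1))
      show "m \<notin> cl z" if "m \<in> cent z" "m \<noteq> z" "m \<noteq> inv z" for m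
        using that cz(1) nz[OF z(1) 5(1)] one_in_cl[OF z(1)] ne by auto
    qed
    note F1z = this
    have invz_w: "inv z \<notin> cl w" "z \<notin> cl w"
    proof -
      show "z \<notin> cl w" using zw cl_sym[OF w(1)] by auto
      then show "inv z \<notin> cl w" using cl_eq[OF w(1)] cl_eq[OF z(1) 5(3)] cl_self[OF z(1)] by auto
    qed
    have F1w: "card {y \<in> carrier G. y \<otimes> w \<otimes> inv y \<in> cent z} = 0 * card (cent z)"
      using card_conj_none[OF w(1), of "cent z"] cz(1) invz_w one_in_cl[OF w(1)] ne nz[OF w(1) 5(2)] by auto
    obtain r where r: "order G = r * card (cent z)" using lagrange[OF M] by metis
    define F where "F = card {C \<in> rcosets (cent z). cperm (cent z) (z \<otimes> z) C = C}"
    have F2z: "card {y \<in> carrier G. y \<otimes> (z \<otimes> z) \<otimes> inv y \<in> cent z} = F * card (cent z)"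
      unfolding F_def using card_cperm_fix[OF M, of "z \<otimes> z"] z by simp
    have same: "card {y \<in> carrier G. y \<otimes> s \<otimes> inv y \<in> cent z} = card (cent t)" if s: "s \<in> cl t" for s
    proof -
      have sc: "s \<in> carrier G" using inv_cl[OF s] by simp
      have cls: "cl s = cl t" by (rule cl_eq[OF tc s])
      have "card {y \<in> carrier G. y \<otimes> s \<otimes> inv y \<in> cent z} = card (cent s)"
      proof (rule card_conj_one[OF sc, of t])
        show "t \<in> cent z" by (simp add: cz(1) t_def)
        show "t \<in> cl s" unfolding cls by (rule cl_self[OF tc])
        show "m \<notin> cl s" if "m \<in> cent z" "m \<noteq> t" for m
          unfolding cls using only[OF z 5(1) _ that(1)] that(2) by (auto simp: t_def)
      qed
      then show ?thesis using card_cent_cl[OF tc s] by simp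
    qed
    have F2w: "card {y \<in> carrier G. y \<otimes> (w \<otimes> w) \<otimes> inv y \<in> cent z} = F * card (cent z)"
      using same[OF wt] same[OF cl_self[OF tc]] F2z by (simp add: t_def)
    obtain a b where ab: "F = 2 + 2 * a" "r = F + 4 * b" "sign (cperm (cent z) z) = (-1 :: int) ^ (a + b)"
      using cperm_sign[OF M z(1) cz(2) F1z F2z r] by auto
    obtain a' b' where ab': "F = 0 + 2 * a'" "r = F + 4 * b'" "sign (cperm (cent z) w) = (-1 :: int) ^ (a' + b')"
      using cperm_sign[OF M w(1) cw(2) F1w F2w r] by auto
    have "a' + b' = Suc (a + b)" using ab(1,2) ab'(1,2) by simp
    then have "sign (cperm (cent z) z) \<noteq> (1::int) \<or> sign (cperm (cent z) w) \<noteq> (1::int)"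
      using ab(3) ab'(3) by (cases "even (a + b)") auto
    then show ?thesis using M z w by blast
  qed
qed

end

section \<open>Two classes with centralizers of order 4\<close>

context finite_grp
begin

lemma finite_grp_subgroup:
  assumes H: "subgroup H G"
  shows "finite_grp (G\<lparr>carrier := H\<rparr>)"
proof -
  interpret HG: group "G\<lparr>carrier := H\<rparr>" by (rule subgroup_imp_group[OF H])
  show ?thesis
    by unfold_locales (use finite_subset[OF subgroup.subset[OF H]] in auto)
qed

text \<open>
  The normalizer \<open>M\<close> of the subgroup generated by \<open>x\<close> has order 6, and \<open>x\<close> and its inverse
  are the only elements of their class in it. As the class has eight elements, \<open>M\<close> does not contain it. An element of
  the core of \<open>M\<close> that inverts \<open>x\<close> would put \<open>x\<close> into the core as a commutator, so the core
  is trivial, and \<open>G\<close> acts faithfully on the four cosets of \<open>M\<close>.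
\<close>

lemma real_order_24_iso:
  assumes x: "x \<in> carrier G" "card (cent x) = 3" and real: "inv x \<in> cl x" and n: "order G = 24"
  shows "G \<cong> sym_group 4"
proof -
  note cx = cent_order_3[OF x] 
  have x1: "x \<noteq> \<one>" "x \<otimes> x = inv x" "x \<noteq> inv x" "cent x = {\<one>, x, inv x}" using cx n by simp_all
  have cardK: "card (cl x) = 8" using card_cl[OF x(1)] x n by simp
  define M where "M = {h \<in> carrier G. h \<otimes> x \<otimes> inv h = x \<or> h \<otimes> x \<otimes> inv h = inv x}"
  have conj_inv_x: "h \<otimes> inv x \<otimes> inv h = inv (h \<otimes> x \<otimes> inv h)" if "h \<in> carrier G" for h
    using conj_inv[OF that x(1)] .
  have M: "subgroup M G"
  proof (rule subgroupI)
    have "\<one> \<in> M" using x by (simp add: M_def)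
    then show "M \<noteq> {}" by auto
    fix a assume a: "a \<in> M"
    have ac: "a \<in> carrier G" using a by (simp add: M_def)
    have bk: "inv a \<otimes> (a \<otimes> x \<otimes> inv a) \<otimes> inv (inv a) = x" using ac x by (simp add: m_assoc)
    from a consider "a \<otimes> x \<otimes> inv a = x" | "a \<otimes> x \<otimes> inv a = inv x" by (auto simp: M_def)
    then show "inv a \<in> M"
    proof cases
      case 1
      then show ?thesis using bk ac by (simp add: M_def)
    next
      case 2
      then have "inv a \<otimes> inv x \<otimes> inv (inv a) = x" using bk by simp
      then have "inv (inv a \<otimes> x \<otimes> inv (inv a)) = x" using conj_inv_x[of "inv a"] ac by simp
      then have "inv a \<otimes> x \<otimes> inv (inv a) = inv x" using ac x by (metis inv_closed inv_inv m_closed)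
      then show ?thesis using ac by (simp add: M_def)
    qed
  next
    fix a b assume a: "a \<in> M" and b: "b \<in> M"
    have c: "a \<in> carrier G" "b \<in> carrier G" using a b by (auto simp: M_def)
    have "a \<otimes> b \<otimes> x \<otimes> inv (a \<otimes> b) = a \<otimes> (b \<otimes> x \<otimes> inv b) \<otimes> inv a" using c x by (simp add: conj_conj)
    then show "a \<otimes> b \<in> M" using a b c x conj_inv_x[of a] by (auto simp: M_def)
  qed (auto simp: M_def)
  have "M = {h \<in> carrier G. h \<otimes> x \<otimes> inv h = x} \<union> {h \<in> carrier G. h \<otimes> x \<otimes> inv h = inv x}"
    by (auto simp: M_def)
  moreover have "{h \<in> carrier G. h \<otimes> x \<otimes> inv h = x} \<inter> {h \<in> carrier G. h \<otimes> x \<otimes> inv h = inv x} = {}"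
    using x1(3) by auto
  ultimately have cM: "card M = 6"
    using conj_fibre[OF x(1) cl_self[OF x(1)]] conj_fibre[OF x(1) real] x by (simp add: card_Un_disjoint)
  have order3_M: "k = x \<or> k = inv x" if k: "k \<in> M" "k \<in> cl x" for k
  proof -
    obtain y where y: "y \<in> carrier G" "k = y \<otimes> x \<otimes> inv y" using k by (auto simp: cl_def)
    have kc: "k \<in> carrier G" using y x by simp
    have kk: "k \<otimes> k = inv k" using y x x1(2) by (simp add: conj_mult conj_inv)
    have k1: "k \<noteq> \<one>" using y x x1(1) conj_inj[of y x \<one>] by auto
    have "k \<otimes> x \<otimes> inv k = x"
    proof (rule ccontr)
      assume "k \<otimes> x \<otimes> inv k \<noteq> x"
      then have e: "k \<otimes> x \<otimes> inv k = inv x" using k(1) by (auto simp: M_def)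
      have "(k \<otimes> k) \<otimes> x \<otimes> inv (k \<otimes> k) = k \<otimes> inv x \<otimes> inv k" using e kc x by (simp add: conj_conj[symmetric])
      also have "\<dots> = x" using conj_inv_x[OF kc] e x by simp
      finally have "inv k \<otimes> x \<otimes> inv (inv k) = x" unfolding kk .
      then have "k \<otimes> (inv k \<otimes> x \<otimes> inv (inv k)) \<otimes> inv k = k \<otimes> x \<otimes> inv k" by simp
      then have "x = inv x" using e kc x by (simp add: m_assoc)
      then show False using x1(3) by simp
    qed
    then have "k \<in> cent x" using conj_eq_iff[of k x x] kc x by (simp add: cent_def)
    then show ?thesis using x1(4) k1 by simp
  qed
  have notcore: "\<exists>y\<in>carrier G. y \<otimes> k \<otimes> inv y \<notin> M" if k: "k \<in> cl x" for k
  proof (rule ccontr)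
    assume "\<not> ?thesis"
    then have "cl k \<subseteq> M" by (auto simp: cl_def)
    then have "cl x \<subseteq> M" using cl_eq[OF x(1) k] by simp
    then have "cl x \<subseteq> {x, inv x}" using order3_M by auto
    then have "card (cl x) \<le> card {x, inv x}" by (intro card_mono) auto
    also have "\<dots> \<le> 2" by (simp add: card_insert_le_m1)
    finally show False using cardK by simp
  qed
  obtain f where "f \<in> hom G (sym_group 4)" "inj_on f (carrier G)"
  proof (rule embed_sym_group[OF M])
    show "order G = 4 * card M" using n cM by simp
    fix g assume g: "g \<in> carrier G" and core: "\<And>y. y \<in> carrier G \<Longrightarrow> y \<otimes> g \<otimes> inv y \<in> M"
    have gM: "g \<in> M" using core[of \<one>] g by simp
    then consider "g \<otimes> x \<otimes> inv g = x" | "g \<otimes> x \<otimes> inv g = inv x" by (auto simp: M_def)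
    then show "g = \<one>"
    proof cases
      case 1
      then have "g \<in> cent x" using conj_eq_iff[of g x x] g x by (simp add: cent_def)
      then have "g = \<one> \<or> g = x \<or> g = inv x" using x1(4) by simp
      then show ?thesis using notcore cl_self[OF x(1)] real core by blast
    next
      case 2
      have igM: "inv g \<in> M" by (rule subgroup.m_inv_closed[OF M gM])
      have ig: "inv g \<otimes> x \<otimes> g = inv x"
      proof -
        have "inv g \<otimes> (g \<otimes> x \<otimes> inv g) \<otimes> inv (inv g) = x" using g x by (simp add: m_assoc)
        then have "inv g \<otimes> inv x \<otimes> inv (inv g) = x" using 2 by simp
        then have "inv (inv g \<otimes> x \<otimes> inv (inv g)) = x" using conj_inv_x[of "inv g"] g by simp
        then have "inv (inv (inv g \<otimes> x \<otimes> inv (inv g))) = inv x" by simp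
        then show ?thesis using g x by simp
      qed
      have xg: "x = inv g \<otimes> (x \<otimes> g \<otimes> inv x)"
      proof -
        have "inv g \<otimes> (x \<otimes> g \<otimes> inv x) = (inv g \<otimes> x \<otimes> g) \<otimes> inv x" using g x by (simp add: m_assoc)
        also have "\<dots> = inv (x \<otimes> x)" unfolding ig using x by (simp add: inv_mult_group)
        also have "\<dots> = x" using x1(2) x by simp
        finally show ?thesis by simp
      qed
      have "y \<otimes> x \<otimes> inv y \<in> M" if y: "y \<in> carrier G" for y
      proof -
        have "y \<otimes> x \<otimes> inv y = y \<otimes> (inv g \<otimes> (x \<otimes> g \<otimes> inv x)) \<otimes> inv y" using xg by simp
        also have "\<dots> = (y \<otimes> inv g \<otimes> inv y) \<otimes> (y \<otimes> (x \<otimes> g \<otimes> inv x) \<otimes> inv y)"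
          using y g x by (simp add: conj_mult)
        also have "\<dots> = inv (y \<otimes> g \<otimes> inv y) \<otimes> ((y \<otimes> x) \<otimes> g \<otimes> inv (y \<otimes> x))"
          using y g x by (simp add: conj_inv conj_conj)
        finally show ?thesis
          using subgroup.m_closed[OF M subgroup.m_inv_closed[OF M core[OF y]] core[of "y \<otimes> x"]] y x by simp
      qed
      then show ?thesis using notcore[OF cl_self[OF x(1)]] by blast
    qed
  qed blast
  then show ?thesis using iso_sym_group n by (simp add: fact_numeral)
qed

text \<open>
  Let \<open>H\<close> be the normal subgroup of index 2 given by an odd sign. It contains the class of \<open>x\<close>, a third
  of \<open>G\<close>, so it has no room for a class with a quarter of the elements and is the complement of the classes of
  \<open>z\<close> and \<open>w\<close>. The centralizer of \<open>x\<close> is contained in \<open>H\<close>, so in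
  \<open>H\<close> the class of \<open>x\<close> splits into two classes, which are inverse to each other. Hence
  \<open>|H|\<close> is 12 or 21, and \<open>4\<close> divides \<open>2 |H|\<close>.
\<close>

theorem two_classes_4_imp_sym_group:
  assumes x: "x \<in> carrier G" "card (cent x) = 3" and real: "inv x \<in> cl x" and n4: "order G > 4"
    and z: "z \<in> carrier G" "card (cent z) = 4" and w: "w \<in> carrier G" "card (cent w) = 4" and zw: "w \<notin> cl z"
    and a: "a \<in> carrier G" "a \<noteq> \<one>" "card (cent a) \<le> 12" "a \<notin> cl x" "a \<notin> cl z" "a \<notin> cl w"
  shows "G \<cong> sym_group 4"
proof -
  have x1: "x \<noteq> \<one>" "x \<otimes> x = inv x" "x \<noteq> inv x" "cent x = {\<one>, x, inv x}" using cent_order_3[OF x] n4 by simp_all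
  obtain M g where Mg: "subgroup M G" "g \<in> carrier G" "sign (cperm M g) \<noteq> (1::int)"
    using odd_sign_exists[OF z w zw n4] by blast
  obtain H where H: "subgroup H G" "2 * card H = order G"
    and H3: "\<And>h. h \<in> carrier G \<Longrightarrow> h \<otimes> h = inv h \<Longrightarrow> h \<in> H"
    and Hc: "\<And>h y. h \<in> H \<Longrightarrow> y \<in> carrier G \<Longrightarrow> y \<otimes> h \<otimes> inv y \<in> H"
    using index_2_of_sign[OF Mg] by metis
  have Hcarr: "H \<subseteq> carrier G" by (rule subgroup.subset[OF H(1)])
  have finH: "finite H" by (rule finite_subset[OF Hcarr finite_carrier])
  have cK: "3 * card (cl x) = order G" and cz: "4 * card (cl z) = order G" and cw: "4 * card (cl w) = order G"
    using card_cl[OF x(1)] card_cl[OF z(1)] card_cl[OF w(1)] x z w by simp_all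
  have inK: "k \<in> carrier G \<and> k \<noteq> \<one> \<and> k \<otimes> k = inv k" if k: "k \<in> cl x" for k
  proof -
    obtain y where y: "y \<in> carrier G" "k = y \<otimes> x \<otimes> inv y" using k by (auto simp: cl_def)
    then show ?thesis using x x1 conj_inj[of y x \<one>] by (auto simp: conj_mult conj_inv)
  qed
  have KH: "cl x \<subseteq> H" using inK H3 by blast
  have disj: "cl x \<inter> cl v = {}" if "v \<in> carrier G" "card (cent v) = 4" for v
    using cl_disjoint[OF x(1) that(1)] card_cent_cl[OF x(1), of v] that(2) x(2) by auto
  have out: "cl v \<inter> H = {}" if v: "v \<in> carrier G" "card (cent v) = 4" for v
  proof -
    have "v \<notin> H"
    proof
      assume "v \<in> H"
      then have "cl v \<subseteq> H" using Hc by (auto simp: cl_def)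
      then have "card (cl x \<union> cl v) \<le> card H" using KH by (intro card_mono[OF finH]) auto
      moreover have "4 * card (cl v) = order G" using card_cl[OF v(1)] v(2) by simp
      ultimately show False using card_Un_disjoint[OF finite_cl finite_cl disj[OF v]] cK H(2) order_pos by linarith
    qed
    moreover have "u \<in> H \<Longrightarrow> v \<in> H" if "u \<in> cl v" for u
      using cl_sym[OF v(1) that] Hc[of u] by (auto simp: cl_def)
    ultimately show ?thesis by blast
  qed
  have "H = carrier G - (cl z \<union> cl w)"
  proof (rule card_subset_eq)
    show "H \<subseteq> carrier G - (cl z \<union> cl w)" using out[OF z] out[OF w] Hcarr by blast
    have "card (cl z \<union> cl w) = card (cl z) + card (cl w)"
      by (rule card_Un_disjoint) (use cl_disjoint[OF z(1) w(1) zw] in auto)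
    moreover have "cl z \<union> cl w \<subseteq> carrier G" using cl_sub z w by blast
    ultimately have "card (carrier G - (cl z \<union> cl w)) = order G - (card (cl z) + card (cl w))"
      by (simp add: card_Diff_subset order_def)
    then show "card H = card (carrier G - (cl z \<union> cl w))" using H(2) cz cw by linarith
  qed simp
  then have aH: "a \<in> H" using a by blast
  have xH: "x \<in> H" using KH cl_self[OF x(1)] by blast
  interpret HG: finite_grp "G\<lparr>carrier := H\<rparr>" by (rule finite_grp_subgroup[OF H(1)])
  have invH: "inv\<^bsub>G\<lparr>carrier := H\<rparr>\<^esub> h = inv h" if "h \<in> H" for h using m_inv_consistent[OF H(1) that] .
  have centH: "HG.cent h = cent h \<inter> H" for h using Hcarr by (auto simp: HG.cent_def cent_def)
  have clH: "HG.cl h \<subseteq> cl h" for h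
    using Hcarr by (auto simp: HG.cl_def cl_def invH)
  have ordH: "order (G\<lparr>carrier := H\<rparr>) = card H" by (simp add: order_def)
  have "inv x \<in> H" by (rule subgroup.m_inv_closed[OF H(1) xH])
  then have "HG.cent x = cent x" using centH[of x] xH subgroup.one_closed[OF H(1)] unfolding x1(4) by auto
  then have cHx: "card (HG.cent x) = 3" using x by simp
  have H3': "card H > 3" using H(2) cK cz order_pos by presburger
  interpret N: nonreal_3 "G\<lparr>carrier := H\<rparr>" x
  proof
    show "x \<in> carrier (G\<lparr>carrier := H\<rparr>)" using xH by simp
    show "card (HG.cent x) = 3" by (rule cHx)
    show "3 < order (G\<lparr>carrier := H\<rparr>)" using H3' ordH by simp
    show "inv\<^bsub>G\<lparr>carrier := H\<rparr>\<^esub> x \<notin> HG.cl x"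
    proof
      assume r: "inv\<^bsub>G\<lparr>carrier := H\<rparr>\<^esub> x \<in> HG.cl x"
      have "cl x \<subseteq> HG.cl x"
      proof
        fix k assume k: "k \<in> cl x"
        then have kH: "k \<in> H" using KH by blast
        have "k \<in> HG.cl x \<or> k \<in> HG.cl (inv\<^bsub>G\<lparr>carrier := H\<rparr>\<^esub> x)"
          by (rule HG.order_3_conjugate) (use xH cHx H3' ordH kH inK[OF k] invH[OF kH] in simp_all)
        then show "k \<in> HG.cl x" using HG.cl_eq[OF _ r] xH by simp
      qed
      then have "card (cl x) \<le> card (HG.cl x)" by (intro card_mono HG.finite_cl)
      moreover have "card (HG.cl x) * 3 = card H" using HG.card_cl[of x] xH cHx ordH by simp
      ultimately show False using cK H(2) order_pos by linarith
    qed
  qed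
  have "HG.cl (inv\<^bsub>G\<lparr>carrier := H\<rparr>\<^esub> x) \<subseteq> cl x"
    using clH[of "inv x"] cl_eq[OF x(1) real] invH[OF xH] by simp
  then have "a \<in> N.N" using aH a(4) clH[of x] by (auto simp: N.N_def N.K_def N.L_def)
  moreover have "card (HG.cent a) \<le> 12"
    using card_mono[of "cent a" "HG.cent a"] centH[of a] a(3) by simp
  ultimately have "card H = 12 \<or> card H = 21"
    using N.small_centralizer_classification[of a] a(2) ordH by simp
  moreover have "4 dvd order G" using cz by (metis dvd_triv_left)
  ultimately have "order G = 24" using H(2) by (elim disjE) auto
  then show ?thesis by (rule real_order_24_iso[OF x real])
qed

end

section \<open>Relations in spherical triangle groups\<close>

context finite_grp
begin

lemma inv_eq_right_inverse: "\<lbrakk>a \<in> carrier G; b \<in> carrier G; a \<otimes> b = \<one>\<rbrakk> \<Longrightarrow> inv a = b"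
  by (metis inv_equality inv_inv inv_closed)

text \<open>
  With \<open>s\<close> the conjugate of \<open>t\<close> by \<open>k\<close>, the element \<open>h\<close> is \<open>(t
  s)\<^sup>-\<^sup>1 k\<close>. The relations are those of \<open>S\<^sub>4\<close>, where \<open>t s\<close> has order 3 and
  conjugates \<open>t\<close> to \<open>s\<close> as \<open>k\<close> does; so \<open>h\<close> centralizes \<open>t\<close>
  there. The proof rewrites words with the two relations \<open>e1\<close> and \<open>e2\<close>, which turn
  \<open>k\<^sup>-\<^sup>1 t k\<^sup>-\<^sup>1\<close> and \<open>t k\<^sup>-\<^sup>1 t\<close> into words without inverses.
\<close>

lemma triangle_234:
  assumes t: "t \<in> carrier G" "t \<otimes> t = \<one>" and k: "k \<in> carrier G" "k \<otimes> k = inv k"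
    and tk: "(t \<otimes> k) [^] (4::nat) = \<one>"
  defines "h \<equiv> k \<otimes> (t \<otimes> (inv k \<otimes> (t \<otimes> k)))"
  shows "h \<otimes> h = \<one>" "h \<otimes> t = t \<otimes> h"
proof -
  note [simp] = t(1) k(1)
  have it: "inv t = t" using t by (simp add: inv_equality)
  have KK: "inv k \<otimes> inv k = k" using k by (metis inv_inv inv_mult_group)
  have tt': "t \<otimes> (t \<otimes> w) = w" and kk': "k \<otimes> (k \<otimes> w) = inv k \<otimes> w" and KK': "inv k \<otimes> (inv k \<otimes> w) = k \<otimes> w"
    if "w \<in> carrier G" for w
    using that t k KK by (simp_all add: m_assoc[symmetric])
  note base = m_assoc t(2) tt' k(2) kk' KK KK'
  have r: "t \<otimes> (k \<otimes> (t \<otimes> (k \<otimes> (t \<otimes> (k \<otimes> (t \<otimes> k)))))) = \<one>"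
    using tk by (simp add: numeral_eq_Suc m_assoc)
  have "k \<otimes> ((t \<otimes> (k \<otimes> (t \<otimes> (k \<otimes> (t \<otimes> (k \<otimes> (t \<otimes> k))))))) \<otimes> inv k) = k \<otimes> (\<one> \<otimes> inv k)" by (simp only: r)
  then have r': "k \<otimes> (t \<otimes> (k \<otimes> (t \<otimes> (k \<otimes> (t \<otimes> (k \<otimes> t)))))) = \<one>" by (simp add: m_assoc)
  have "(k \<otimes> (t \<otimes> k)) \<otimes> (t \<otimes> (k \<otimes> (t \<otimes> (k \<otimes> t)))) = \<one>" using r' by (simp add: m_assoc)
  then have e1: "inv k \<otimes> (t \<otimes> inv k) = t \<otimes> (k \<otimes> (t \<otimes> (k \<otimes> t)))"
    using inv_eq_right_inverse[of "k \<otimes> (t \<otimes> k)" "t \<otimes> (k \<otimes> (t \<otimes> (k \<otimes> t)))"] by (simp add: inv_mult_group it m_assoc)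
  have "(t \<otimes> (k \<otimes> t)) \<otimes> (k \<otimes> (t \<otimes> (k \<otimes> (t \<otimes> k)))) = \<one>" using r by (simp add: m_assoc)
  then have e2: "t \<otimes> (inv k \<otimes> t) = k \<otimes> (t \<otimes> (k \<otimes> (t \<otimes> k)))"
    using inv_eq_right_inverse[of "t \<otimes> (k \<otimes> t)" "k \<otimes> (t \<otimes> (k \<otimes> (t \<otimes> k)))"] by (simp add: inv_mult_group it m_assoc)
  have "k \<otimes> (t \<otimes> (inv k \<otimes> (t \<otimes> (inv k \<otimes> (t \<otimes> (inv k \<otimes> (t \<otimes> k))))))) = (k \<otimes> t) \<otimes> ((inv k \<otimes> (t \<otimes> inv k)) \<otimes> (t \<otimes> (inv k \<otimes> (t \<otimes> k))))"
    by (simp add: base)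
  also have "\<dots> = (k \<otimes> t) \<otimes> ((t \<otimes> (k \<otimes> (t \<otimes> (k \<otimes> t)))) \<otimes> (t \<otimes> (inv k \<otimes> (t \<otimes> k))))"
    by (simp only: e1)
  also have "\<dots> = \<one>"
    by (simp add: base)
  finally have hh: "k \<otimes> (t \<otimes> (inv k \<otimes> (t \<otimes> (inv k \<otimes> (t \<otimes> (inv k \<otimes> (t \<otimes> k))))))) = \<one>" .
  show "h \<otimes> h = \<one>" using hh unfolding h_def by (simp add: base)
  have "k \<otimes> (t \<otimes> (inv k \<otimes> (t \<otimes> (k \<otimes> t)))) = (k) \<otimes> ((t \<otimes> (inv k \<otimes> t)) \<otimes> (k \<otimes> t))"
    by (simp add: base)
  also have "\<dots> = (k) \<otimes> ((k \<otimes> (t \<otimes> (k \<otimes> (t \<otimes> k)))) \<otimes> (k \<otimes> t))"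
    by (simp only: e2)
  also have "\<dots> = inv k \<otimes> (t \<otimes> (k \<otimes> (t \<otimes> (inv k \<otimes> t))))"
    by (simp add: base)
  also have "\<dots> = (inv k \<otimes> (t \<otimes> k)) \<otimes> ((t \<otimes> (inv k \<otimes> t)) \<otimes> (\<one>))"
    by (simp add: base)
  also have "\<dots> = (inv k \<otimes> (t \<otimes> k)) \<otimes> ((k \<otimes> (t \<otimes> (k \<otimes> (t \<otimes> k)))) \<otimes> (\<one>))"
    by (simp only: e2)
  also have "\<dots> = inv k \<otimes> (t \<otimes> (inv k \<otimes> (t \<otimes> (k \<otimes> (t \<otimes> k)))))"
    by (simp add: base)
  also have "\<dots> = (\<one>) \<otimes> ((inv k \<otimes> (t \<otimes> inv k)) \<otimes> (t \<otimes> (k \<otimes> (t \<otimes> k))))"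
    by (simp add: base)
  also have "\<dots> = (\<one>) \<otimes> ((t \<otimes> (k \<otimes> (t \<otimes> (k \<otimes> t)))) \<otimes> (t \<otimes> (k \<otimes> (t \<otimes> k))))"
    by (simp only: e1)
  also have "\<dots> = t \<otimes> (k \<otimes> (t \<otimes> (inv k \<otimes> (t \<otimes> k))))"
    by (simp add: base)
  finally have ht: "k \<otimes> (t \<otimes> (inv k \<otimes> (t \<otimes> (k \<otimes> t)))) = t \<otimes> (k \<otimes> (t \<otimes> (inv k \<otimes> (t \<otimes> k))))" .
  show "h \<otimes> t = t \<otimes> h" using ht unfolding h_def by (simp add: base)
qed

text \<open>
  The analogue in \<open>A\<^sub>5\<close>: there \<open>t s\<close> has order 5, its square conjugates \<open>t\<close> to
  \<open>s\<close>, and \<open>h\<close> is \<open>(t s)\<^sup>-\<^sup>2 k\<close>.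
\<close>

lemma triangle_235:
  assumes t: "t \<in> carrier G" "t \<otimes> t = \<one>" and k: "k \<in> carrier G" "k \<otimes> k = inv k"
    and tk: "(t \<otimes> k) [^] (5::nat) = \<one>"
  defines "h \<equiv> k \<otimes> (t \<otimes> (inv k \<otimes> (t \<otimes> (k \<otimes> (t \<otimes> (inv k \<otimes> (t \<otimes> k)))))))"
  shows "h \<otimes> h = \<one>" "h \<otimes> t = t \<otimes> h"
proof -
  note [simp] = t(1) k(1)
  have it: "inv t = t" using t by (simp add: inv_equality)
  have KK: "inv k \<otimes> inv k = k" using k by (metis inv_inv inv_mult_group)
  have tt': "t \<otimes> (t \<otimes> w) = w" and kk': "k \<otimes> (k \<otimes> w) = inv k \<otimes> w" and KK': "inv k \<otimes> (inv k \<otimes> w) = k \<otimes> w"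
    if "w \<in> carrier G" for w
    using that t k KK by (simp_all add: m_assoc[symmetric])
  note base = m_assoc t(2) tt' k(2) kk' KK KK'
  have r: "t \<otimes> (k \<otimes> (t \<otimes> (k \<otimes> (t \<otimes> (k \<otimes> (t \<otimes> (k \<otimes> (t \<otimes> k)))))))) = \<one>"
    using tk by (simp add: numeral_eq_Suc m_assoc)
  have "k \<otimes> ((t \<otimes> (k \<otimes> (t \<otimes> (k \<otimes> (t \<otimes> (k \<otimes> (t \<otimes> (k \<otimes> (t \<otimes> k))))))))) \<otimes> inv k) = k \<otimes> (\<one> \<otimes> inv k)" by (simp only: r)
  then have r': "k \<otimes> (t \<otimes> (k \<otimes> (t \<otimes> (k \<otimes> (t \<otimes> (k \<otimes> (t \<otimes> (k \<otimes> t)))))))) = \<one>" by (simp add: m_assoc)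
  have "(k \<otimes> (t \<otimes> k)) \<otimes> (t \<otimes> (k \<otimes> (t \<otimes> (k \<otimes> (t \<otimes> (k \<otimes> t)))))) = \<one>" using r' by (simp add: m_assoc)
  then have e1: "inv k \<otimes> (t \<otimes> inv k) = t \<otimes> (k \<otimes> (t \<otimes> (k \<otimes> (t \<otimes> (k \<otimes> t)))))"
    using inv_eq_right_inverse[of "k \<otimes> (t \<otimes> k)" "t \<otimes> (k \<otimes> (t \<otimes> (k \<otimes> (t \<otimes> (k \<otimes> t)))))"] by (simp add: inv_mult_group it m_assoc)
  have "(t \<otimes> (k \<otimes> t)) \<otimes> (k \<otimes> (t \<otimes> (k \<otimes> (t \<otimes> (k \<otimes> (t \<otimes> k)))))) = \<one>" using r by (simp add: m_assoc)
  then have e2: "t \<otimes> (inv k \<otimes> t) = k \<otimes> (t \<otimes> (k \<otimes> (t \<otimes> (k \<otimes> (t \<otimes> k)))))"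
    using inv_eq_right_inverse[of "t \<otimes> (k \<otimes> t)" "k \<otimes> (t \<otimes> (k \<otimes> (t \<otimes> (k \<otimes> (t \<otimes> k)))))"] by (simp add: inv_mult_group it m_assoc)
  have "k \<otimes> (t \<otimes> (inv k \<otimes> (t \<otimes> (k \<otimes> (t \<otimes> (inv k \<otimes> (t \<otimes> (inv k \<otimes> (t \<otimes> (inv k \<otimes> (t \<otimes> (k \<otimes> (t \<otimes> (inv k \<otimes> (t \<otimes> k))))))))))))))) = (k \<otimes> (t \<otimes> (inv k \<otimes> (t \<otimes> (k \<otimes> t))))) \<otimes> ((inv k \<otimes> (t \<otimes> inv k)) \<otimes> (t \<otimes> (inv k \<otimes> (t \<otimes> (k \<otimes> (t \<otimes> (inv k \<otimes> (t \<otimes> k))))))))"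
    by (simp add: base)
  also have "\<dots> = (k \<otimes> (t \<otimes> (inv k \<otimes> (t \<otimes> (k \<otimes> t))))) \<otimes> ((t \<otimes> (k \<otimes> (t \<otimes> (k \<otimes> (t \<otimes> (k \<otimes> t)))))) \<otimes> (t \<otimes> (inv k \<otimes> (t \<otimes> (k \<otimes> (t \<otimes> (inv k \<otimes> (t \<otimes> k))))))))"
    by (simp only: e1)
  also have "\<dots> = k \<otimes> (t \<otimes> (inv k \<otimes> (t \<otimes> (inv k \<otimes> (t \<otimes> (inv k \<otimes> (t \<otimes> (inv k \<otimes> (t \<otimes> k)))))))))"
    by (simp add: base)
  also have "\<dots> = (k \<otimes> t) \<otimes> ((inv k \<otimes> (t \<otimes> inv k)) \<otimes> (t \<otimes> (inv k \<otimes> (t \<otimes> (inv k \<otimes> (t \<otimes> k))))))"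
    by (simp add: base)
  also have "\<dots> = (k \<otimes> t) \<otimes> ((t \<otimes> (k \<otimes> (t \<otimes> (k \<otimes> (t \<otimes> (k \<otimes> t)))))) \<otimes> (t \<otimes> (inv k \<otimes> (t \<otimes> (inv k \<otimes> (t \<otimes> k))))))"
    by (simp only: e1)
  also have "\<dots> = \<one>"
    by (simp add: base)
  finally have hh: "k \<otimes> (t \<otimes> (inv k \<otimes> (t \<otimes> (k \<otimes> (t \<otimes> (inv k \<otimes> (t \<otimes> (inv k \<otimes> (t \<otimes> (inv k \<otimes> (t \<otimes> (k \<otimes> (t \<otimes> (inv k \<otimes> (t \<otimes> k))))))))))))))) = \<one>" .
  show "h \<otimes> h = \<one>" using hh unfolding h_def by (simp add: base)
  have "k \<otimes> (t \<otimes> (inv k \<otimes> (t \<otimes> (k \<otimes> (t \<otimes> (inv k \<otimes> (t \<otimes> (k \<otimes> t)))))))) = (k) \<otimes> ((t \<otimes> (inv k \<otimes> t)) \<otimes> (k \<otimes> (t \<otimes> (inv k \<otimes> (t \<otimes> (k \<otimes> t))))))"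
    by (simp add: base)
  also have "\<dots> = (k) \<otimes> ((k \<otimes> (t \<otimes> (k \<otimes> (t \<otimes> (k \<otimes> (t \<otimes> k)))))) \<otimes> (k \<otimes> (t \<otimes> (inv k \<otimes> (t \<otimes> (k \<otimes> t))))))"
    by (simp only: e2)
  also have "\<dots> = inv k \<otimes> (t \<otimes> (k \<otimes> (t \<otimes> (k \<otimes> (t \<otimes> (inv k \<otimes> (t \<otimes> (inv k \<otimes> (t \<otimes> (k \<otimes> t))))))))))"
    by (simp add: base)
  also have "\<dots> = (inv k \<otimes> (t \<otimes> (k \<otimes> (t \<otimes> (k \<otimes> t))))) \<otimes> ((inv k \<otimes> (t \<otimes> inv k)) \<otimes> (t \<otimes> (k \<otimes> t)))"
    by (simp add: base)
  also have "\<dots> = (inv k \<otimes> (t \<otimes> (k \<otimes> (t \<otimes> (k \<otimes> t))))) \<otimes> ((t \<otimes> (k \<otimes> (t \<otimes> (k \<otimes> (t \<otimes> (k \<otimes> t)))))) \<otimes> (t \<otimes> (k \<otimes> t)))"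
    by (simp only: e1)
  also have "\<dots> = inv k \<otimes> (t \<otimes> (k \<otimes> (t \<otimes> (inv k \<otimes> (t \<otimes> (k \<otimes> (t \<otimes> (inv k \<otimes> t))))))))"
    by (simp add: base)
  also have "\<dots> = (inv k \<otimes> (t \<otimes> k)) \<otimes> ((t \<otimes> (inv k \<otimes> t)) \<otimes> (k \<otimes> (t \<otimes> (inv k \<otimes> t))))"
    by (simp add: base)
  also have "\<dots> = (inv k \<otimes> (t \<otimes> k)) \<otimes> ((k \<otimes> (t \<otimes> (k \<otimes> (t \<otimes> (k \<otimes> (t \<otimes> k)))))) \<otimes> (k \<otimes> (t \<otimes> (inv k \<otimes> t))))"
    by (simp only: e2)
  also have "\<dots> = inv k \<otimes> (t \<otimes> (inv k \<otimes> (t \<otimes> (k \<otimes> (t \<otimes> (k \<otimes> (t \<otimes> (inv k \<otimes> (t \<otimes> (inv k \<otimes> t))))))))))"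
    by (simp add: base)
  also have "\<dots> = (\<one>) \<otimes> ((inv k \<otimes> (t \<otimes> inv k)) \<otimes> (t \<otimes> (k \<otimes> (t \<otimes> (k \<otimes> (t \<otimes> (inv k \<otimes> (t \<otimes> (inv k \<otimes> t)))))))))"
    by (simp add: base)
  also have "\<dots> = (\<one>) \<otimes> ((t \<otimes> (k \<otimes> (t \<otimes> (k \<otimes> (t \<otimes> (k \<otimes> t)))))) \<otimes> (t \<otimes> (k \<otimes> (t \<otimes> (k \<otimes> (t \<otimes> (inv k \<otimes> (t \<otimes> (inv k \<otimes> t)))))))))"
    by (simp only: e1)
  also have "\<dots> = t \<otimes> (k \<otimes> (t \<otimes> (k \<otimes> (t \<otimes> (inv k \<otimes> (t \<otimes> (k \<otimes> (t \<otimes> (inv k \<otimes> (t \<otimes> (inv k \<otimes> t)))))))))))"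
    by (simp add: base)
  also have "\<dots> = (t \<otimes> (k \<otimes> (t \<otimes> (k \<otimes> (t \<otimes> (inv k \<otimes> (t \<otimes> (k \<otimes> t)))))))) \<otimes> ((inv k \<otimes> (t \<otimes> inv k)) \<otimes> (t))"
    by (simp add: base)
  also have "\<dots> = (t \<otimes> (k \<otimes> (t \<otimes> (k \<otimes> (t \<otimes> (inv k \<otimes> (t \<otimes> (k \<otimes> t)))))))) \<otimes> ((t \<otimes> (k \<otimes> (t \<otimes> (k \<otimes> (t \<otimes> (k \<otimes> t)))))) \<otimes> (t))"
    by (simp only: e1)
  also have "\<dots> = t \<otimes> (k \<otimes> (t \<otimes> (k \<otimes> (t \<otimes> (inv k \<otimes> (t \<otimes> (inv k \<otimes> (t \<otimes> (k \<otimes> (t \<otimes> k))))))))))"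
    by (simp add: base)
  also have "\<dots> = (t \<otimes> (k \<otimes> (t \<otimes> (k \<otimes> t)))) \<otimes> ((inv k \<otimes> (t \<otimes> inv k)) \<otimes> (t \<otimes> (k \<otimes> (t \<otimes> k))))"
    by (simp add: base)
  also have "\<dots> = (t \<otimes> (k \<otimes> (t \<otimes> (k \<otimes> t)))) \<otimes> ((t \<otimes> (k \<otimes> (t \<otimes> (k \<otimes> (t \<otimes> (k \<otimes> t)))))) \<otimes> (t \<otimes> (k \<otimes> (t \<otimes> k))))"
    by (simp only: e1)
  also have "\<dots> = t \<otimes> (k \<otimes> (t \<otimes> (inv k \<otimes> (t \<otimes> (k \<otimes> (t \<otimes> (inv k \<otimes> (t \<otimes> k))))))))"
    by (simp add: base)
  finally have ht: "k \<otimes> (t \<otimes> (inv k \<otimes> (t \<otimes> (k \<otimes> (t \<otimes> (inv k \<otimes> (t \<otimes> (k \<otimes> t)))))))) = t \<otimes> (k \<otimes> (t \<otimes> (inv k \<otimes> (t \<otimes> (k \<otimes> (t \<otimes> (inv k \<otimes> (t \<otimes> k))))))))" .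
  show "h \<otimes> t = t \<otimes> h" using ht unfolding h_def by (simp add: base)
qed

end

section \<open>Groups with the largest class sizes of the alternating group of degree 5\<close>

context finite_grp
begin

lemma cent_pow_card: "g \<in> carrier G \<Longrightarrow> h \<in> cent g \<Longrightarrow> h [^] card (cent g) = \<one>"
  using group.pow_order_eq_1[OF subgroup_imp_group[OF cent_subgroup], of g h]
  by (simp add: order_def nat_pow_consistent[symmetric])

text \<open>
  Count the \<open>y\<close> for which \<open>t\<close> times the conjugate of \<open>g\<close> by \<open>y\<close> is again
  conjugate to \<open>t\<close>. Each \<open>s\<close> in question accounts for \<open>c(g)\<close> of them. On the other hand, a
  product of two involutions is inverted by them, so the conjugate \<open>v = y\<^sup>-\<^sup>1 t y\<close> inverts
  \<open>g\<close>; there are at most \<open>c(g)\<close> such \<open>v\<close>, and each comes from at most \<open>c(t)\<close>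
  elements \<open>y\<close>.
\<close>

lemma card_involution_products_le:
  assumes t: "t \<in> carrier G" "t \<otimes> t = \<one>" and g: "g \<in> carrier G"
  shows "card {s \<in> cl t. t \<otimes> s \<in> cl g} \<le> card (cent t)"
proof -
  let ?S = "{s \<in> cl t. t \<otimes> s \<in> cl g}"
  define A where "A = {y \<in> carrier G. t \<otimes> (y \<otimes> g \<otimes> inv y) \<in> cl t}"
  have finA: "finite A" by (simp add: A_def)
  have tt': "t \<otimes> (t \<otimes> w) = w" if "w \<in> carrier G" for w using that t by (simp add: m_assoc[symmetric])
  have it: "inv t = t" using t by (simp add: inv_equality)
  have "card A = (\<Sum>s\<in>?S. card {y \<in> A. t \<otimes> (y \<otimes> g \<otimes> inv y) = s})"
  proof (rule card_eq_sum_fibres[OF finA])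
    show "(\<lambda>y. t \<otimes> (y \<otimes> g \<otimes> inv y)) ` A \<subseteq> ?S"
    proof
      fix s assume "s \<in> (\<lambda>y. t \<otimes> (y \<otimes> g \<otimes> inv y)) ` A"
      then obtain y where y: "y \<in> carrier G" "s \<in> cl t" "s = t \<otimes> (y \<otimes> g \<otimes> inv y)" by (auto simp: A_def)
      have "t \<otimes> s = y \<otimes> g \<otimes> inv y" unfolding y(3) using y g by (intro tt') simp
      then have "t \<otimes> s \<in> cl g" using y(1) by (auto simp: cl_def)
      then show "s \<in> ?S" using y(2) by simp
    qed
  qed simp
  also have "\<dots> = (\<Sum>s\<in>?S. card (cent g))"
  proof (rule sum.cong)
    fix s assume s: "s \<in> ?S"
    then have sc: "s \<in> carrier G" using clD[OF t(1)] by simp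
    have iff: "t \<otimes> p = s \<longleftrightarrow> p = t \<otimes> s" if "p \<in> carrier G" for p
      using tt'[OF that] tt'[OF sc] by metis
    have "{y \<in> A. t \<otimes> (y \<otimes> g \<otimes> inv y) = s} = {y \<in> carrier G. t \<otimes> (y \<otimes> g \<otimes> inv y) = s}"
      using s by (auto simp: A_def)
    also have "\<dots> = {y \<in> carrier G. y \<otimes> g \<otimes> inv y = t \<otimes> s}"
      using iff g by (intro Collect_cong conj_cong) simp_all
    finally have "{y \<in> A. t \<otimes> (y \<otimes> g \<otimes> inv y) = s} = {y \<in> carrier G. y \<otimes> g \<otimes> inv y = t \<otimes> s}" .
    then show "card {y \<in> A. t \<otimes> (y \<otimes> g \<otimes> inv y) = s} = card (cent g)"
      using conj_fibre[OF g, of "t \<otimes> s"] s by simp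
  qed simp
  finally have 1: "card A = card ?S * card (cent g)" by simp
  let ?V = "{v \<in> carrier G. v \<otimes> g \<otimes> inv v = inv g} \<inter> cl t"
  have "card A \<le> card ?V * card (cent t)"
  proof (rule card_le_fibres[OF finA, of _ "\<lambda>y. inv y \<otimes> t \<otimes> y"])
    show "(\<lambda>y. inv y \<otimes> t \<otimes> y) ` A \<subseteq> ?V"
    proof
      fix v assume "v \<in> (\<lambda>y. inv y \<otimes> t \<otimes> y) ` A"
      then obtain y where y: "y \<in> carrier G" "t \<otimes> (y \<otimes> g \<otimes> inv y) \<in> cl t" "v = inv y \<otimes> t \<otimes> inv (inv y)"
        by (auto simp: A_def)
      define p where "p = y \<otimes> g \<otimes> inv y"
      have pc: "p \<in> carrier G" using y g by (simp add: p_def)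
      have "s \<otimes> s = \<one>" if "s \<in> cl t" for s using that t by (auto simp: cl_def conj_mult)
      from this[OF y(2)] have "(t \<otimes> p) \<otimes> (t \<otimes> p) = \<one>" by (simp only: p_def)
      then have "inv p = t \<otimes> p \<otimes> t" using pc t by (intro inv_equality) (simp_all add: m_assoc)
      then have e: "t \<otimes> p \<otimes> inv t = inv p" by (simp add: it)
      have vc: "v \<in> carrier G" using y t by simp
      have "v \<otimes> g \<otimes> inv v = inv y \<otimes> (t \<otimes> p \<otimes> inv t) \<otimes> inv (inv y)"
        unfolding y(3) p_def using y(1) g t(1) by (simp add: m_assoc inv_mult_group)
      also have "\<dots> = inv g" unfolding e unfolding p_def using y g by (simp add: m_assoc inv_mult_group)
      finally have "v \<otimes> g \<otimes> inv v = inv g" .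
      moreover have "v \<in> cl t" using y(1) unfolding y(3) cl_def by blast
      ultimately show "v \<in> ?V" using vc by simp
    qed
    fix v assume "v \<in> ?V"
    then have v: "v \<in> carrier G" "v \<in> cl t" by auto
    have "{y \<in> A. inv y \<otimes> t \<otimes> y = v} \<subseteq> {y \<in> carrier G. y \<otimes> v \<otimes> inv y = t}"
      using t by (auto simp: A_def m_assoc)
    then have "card {y \<in> A. inv y \<otimes> t \<otimes> y = v} \<le> card {y \<in> carrier G. y \<otimes> v \<otimes> inv y = t}"
      by (intro card_mono) auto
    also have "\<dots> \<le> card (cent t)" using conj_fibre_le[OF v(1)] card_cent_cl[OF t(1) v(2)] by metis
    finally show "card {y \<in> A. inv y \<otimes> t \<otimes> y = v} \<le> card (cent t)" .
  qed simp
  also have "card ?V \<le> card {v \<in> carrier G. v \<otimes> g \<otimes> inv v = inv g}" by (intro card_mono) auto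
  also have "\<dots> \<le> card (cent g)" by (rule conj_fibre_le[OF g])
  finally have "card ?S * card (cent g) \<le> card (cent g) * card (cent t)" using 1 by simp
  then show ?thesis using card_cent_pos[OF g] by (simp add: mult.commute)
qed

end

text \<open>
  Four classes with centralizers of orders 3, 4, 5, 5, as in \<open>A\<^sub>5\<close>. The remaining set \<open>R\<close> has
  \<open>|G| / 60\<close> elements, and the point is to show that it consists of the identity only.
\<close>

locale classes_3455 = finite_grp +
  fixes x z u v
  assumes x: "x \<in> carrier G" "card (cent x) = 3"
    and z: "z \<in> carrier G" "card (cent z) = 4"
    and u: "u \<in> carrier G" "card (cent u) = 5" and v: "v \<in> carrier G" "card (cent v) = 5" and uv: "v \<notin> cl u"
begin

definition "K = cl x"
definition "Z = cl z"
definition "Y = cl u \<union> cl v"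
definition "R = carrier G - (K \<union> Z \<union> Y)"

lemma cards: "3 * card K = order G" "4 * card Z = order G" "5 * card (cl u) = order G" "5 * card (cl v) = order G"
  using card_cl[OF x(1)] card_cl[OF z(1)] card_cl[OF u(1)] card_cl[OF v(1)] x z u v by (simp_all add: K_def Z_def)

lemma dvd60: "60 dvd order G"
proof -
  have "3 dvd order G" "4 dvd order G" "5 dvd order G" using cards by (metis dvd_triv_left)+
  then show ?thesis by presburger
qed

lemma order_ge: "order G \<ge> 60" using dvd60 order_pos dvd_imp_le by blast

lemma K:
  assumes "k \<in> K"
  shows "k \<in> carrier G" "k \<noteq> \<one>" "k \<otimes> k = inv k" "cent k = {\<one>, k, inv k}" "card (cent k) = 3"
proof -
  show k: "k \<in> carrier G" using assms x clD by (simp add: K_def)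
  show c: "card (cent k) = 3" using assms card_cent_cl[OF x(1)] x by (simp add: K_def)
  show "k \<noteq> \<one>" "k \<otimes> k = inv k" "cent k = {\<one>, k, inv k}"
    using cent_order_3[OF k c] order_ge by auto
qed

lemma Z:
  assumes "w \<in> Z"
  shows "w \<in> carrier G" "card (cent w) = 4" "w [^] (4::nat) = \<one>"
proof -
  show w: "w \<in> carrier G" using assms z clD by (simp add: Z_def)
  show c: "card (cent w) = 4" using assms card_cent_cl[OF z(1)] z by (simp add: Z_def)
  show "w [^] (4::nat) = \<one>" using pow_card_cent[OF w] c by simp
qed

lemma Y:
  assumes "w \<in> Y"
  shows "w \<in> carrier G" "card (cent w) = 5" "w [^] (5::nat) = \<one>" "w \<noteq> \<one>"
proof -
  show w: "w \<in> carrier G" using assms u v clD by (auto simp: Y_def)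
  show c: "card (cent w) = 5" using assms card_cent_cl[OF u(1)] card_cent_cl[OF v(1)] u v by (auto simp: Y_def)
  show "w [^] (5::nat) = \<one>" using pow_card_cent[OF w] c by simp
  show "w \<noteq> \<one>" using c cent_of_one order_ge by (auto simp: order_def)
qed

lemma fin: "finite K" "finite Z" "finite Y" "finite R" by (simp_all add: K_def Z_def Y_def R_def)

lemma disj: "K \<inter> Z = {}" "K \<inter> Y = {}" "Z \<inter> Y = {}"
  using K(5) Z(2) Y(2) by fastforce+

lemma sub: "K \<subseteq> carrier G" "Z \<subseteq> carrier G" "Y \<subseteq> carrier G" using K(1) Z(1) Y(1) by auto

lemma card_Y: "5 * card Y = 2 * order G"
proof -
  have "card Y = card (cl u) + card (cl v)"
    unfolding Y_def by (rule card_Un_disjoint) (use cl_disjoint[OF u(1) v(1) uv] in auto)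
  then show ?thesis using cards by simp
qed

lemma card_R: "60 * card R = order G"
proof -
  have "card (K \<union> Z \<union> Y) = card K + card Z + card Y"
    using disj fin by (subst card_Un_disjoint, auto)+
  moreover have "card R + card (K \<union> Z \<union> Y) = order G"
    using sub fin by (simp add: R_def order_def card_Diff_subset card_mono)
  ultimately show ?thesis using cards card_Y by linarith
qed

lemma one_R: "\<one> \<in> R"
  using K(2) Y(4) Z(2) cent_of_one order_ge by (fastforce simp: R_def order_def)

text \<open>
  Sort the \<open>|G| / 4\<close> conjugates \<open>s\<close> of \<open>z\<close> by the class of \<open>z s\<close>. Each of the
  four known classes accounts for at most four of them, and \<open>R\<close> for at most \<open>|G| / 60\<close>, so \<open>14 |G|
  \<le> 960\<close>.
\<close>

lemma involution_imp_order_60: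
  assumes zz: "z \<otimes> z = \<one>"
  shows "order G = 60"
proof -
  let ?S = "\<lambda>C. {s \<in> Z. z \<otimes> s \<in> C}"
  have le: "card (?S (cl g)) \<le> 4" if "g \<in> carrier G" for g
    using card_involution_products_le[OF z(1) zz that] z(2) by (simp add: Z_def)
  have R: "card (?S R) \<le> card R"
  proof (rule card_inj_on_le)
    show "inj_on ((\<otimes>) z) (?S R)" using z Z(1) by (auto simp: inj_on_def)
  qed (use fin in auto)
  have "Z \<subseteq> ?S (cl x) \<union> ?S (cl z) \<union> ?S (cl u) \<union> ?S (cl v) \<union> ?S R"
    using z Z(1) by (auto simp: R_def K_def Z_def Y_def)
  then have "card Z \<le> card (?S (cl x) \<union> ?S (cl z) \<union> ?S (cl u) \<union> ?S (cl v) \<union> ?S R)"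
    using fin by (intro card_mono) auto
  also have "\<dots> \<le> card (?S (cl x)) + card (?S (cl z)) + card (?S (cl u)) + card (?S (cl v)) + card (?S R)"
    using card_Un_le[of "?S (cl x) \<union> ?S (cl z) \<union> ?S (cl u) \<union> ?S (cl v)" "?S R"]
      card_Un_le[of "?S (cl x) \<union> ?S (cl z) \<union> ?S (cl u)" "?S (cl v)"]
      card_Un_le[of "?S (cl x) \<union> ?S (cl z)" "?S (cl u)"] card_Un_le[of "?S (cl x)" "?S (cl z)"] by linarith
  finally have "card Z \<le> 16 + card R"
    using le[OF x(1)] le[OF z(1)] le[OF u(1)] le[OF v(1)] R by linarith
  then have "14 * order G \<le> 960" using cards(2) card_R by linarith
  moreover obtain j where j: "order G = 60 * j" using dvd60 by (elim dvdE)
  ultimately have "j < 2" "j \<noteq> 0" using order_pos by auto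
  then show ?thesis using j by simp
qed

text \<open>
  All elements outside the four classes are trivial, so \<open>z\<close> is an involution, its centralizer \<open>V\<close> is a
  Klein four-group of elements of the class of \<open>z\<close>, and \<open>V\<close> is the centralizer of each of its
  non-trivial elements. The elements that conjugate \<open>z\<close> into \<open>V\<close> thus form a subgroup \<open>M\<close>,
  of order \<open>3 \<cdot> 4\<close>. It contains no non-trivial class together with the identity, as every such class has at
  least 12 elements. So \<open>G\<close> acts faithfully on the five cosets of \<open>M\<close>.
\<close>

lemma order_60_iso:
  assumes n: "order G = 60"
  shows "G \<cong> alt_group 5"
proof -
  have "card R = 1" using card_R n by simp
  then have R1: "R = {\<one>}" using one_R by (metis card_1_singletonE singletonD)
  have zz: "z \<otimes> z = \<one>"
  proof (rule ccontr)
    assume ne: "z \<otimes> z \<noteq> \<one>"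
    note cz = cent_order_4[OF z ne]
    have c: "z \<otimes> z \<in> carrier G" using z by simp
    have "z \<otimes> z \<notin> K" using K(3)[of "z \<otimes> z"] cz(2) c ne by (metis inv_one r_inv inv_inv one_closed)
    moreover have "z \<otimes> z \<notin> Z"
    proof
      assume "z \<otimes> z \<in> Z"
      then have "(z \<otimes> z) \<otimes> (z \<otimes> z) \<in> cl (z \<otimes> z)" unfolding Z_def by (rule cl_square[OF z(1)])
      then show False using one_in_cl[OF c] cz(2) ne by simp
    qed
    moreover have "z \<otimes> z \<notin> Y"
    proof
      assume y: "z \<otimes> z \<in> Y"
      have "(z \<otimes> z) [^] (5::nat) = z \<otimes> z" using cz(2) z by (simp add: numeral_eq_Suc m_assoc)
      then show False using Y(3)[OF y] ne by simp
    qed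
    ultimately have "z \<otimes> z \<in> R" using c by (simp add: R_def)
    then show False using R1 ne by simp
  qed
  have sqZ: "e \<otimes> e = \<one>" if "e \<in> Z" for e using that z zz by (auto simp: Z_def cl_def conj_mult)
  have V: "subgroup (cent z) G" by (rule cent_subgroup[OF z(1)])
  have VZ: "e \<in> Z" if e: "e \<in> cent z" "e \<noteq> \<one>" for e
  proof -
    have ec: "e \<in> carrier G" and ze: "z \<in> cent e" using e cent_closed cent_sym[OF z(1)] by auto
    have zZ: "z \<in> Z" using cl_self[OF z(1)] by (simp add: Z_def)
    have z1: "z \<noteq> \<one>" using z cent_of_one n by (auto simp: order_def)
    have "e \<notin> K"
    proof
      assume k: "e \<in> K"
      have "z [^] (3::nat) = \<one>" using cent_pow_card[OF ec ze] K(5)[OF k] by simp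
      then show False using zz z z1 by (simp add: numeral_eq_Suc m_assoc)
    qed
    moreover have "e \<notin> Y"
    proof
      assume k: "e \<in> Y"
      have "z [^] (5::nat) = \<one>" using cent_pow_card[OF ec ze] Y(2)[OF k] by simp
      then show False using zz z z1 by (simp add: numeral_eq_Suc m_assoc)
    qed
    ultimately show ?thesis using ec e(2) R1 by (auto simp: R_def)
  qed
  have sq: "e \<otimes> e = \<one>" if "e \<in> cent z" for e using VZ[OF that] sqZ by (cases "e = \<one>") auto
  have comm: "a \<otimes> b = b \<otimes> a" if a: "a \<in> cent z" and b: "b \<in> cent z" for a b
  proof -
    have c: "a \<in> carrier G" "b \<in> carrier G" using a b cent_closed by auto
    have "inv (a \<otimes> b) = a \<otimes> b" using sq[OF subgroup.m_closed[OF V a b]] c by (simp add: inv_equality)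
    moreover have "inv (a \<otimes> b) = b \<otimes> a" using sq[OF a] sq[OF b] c by (simp add: inv_mult_group inv_equality)
    ultimately show ?thesis by simp
  qed
  have centV: "cent e = cent z" if e: "e \<in> cent z" "e \<noteq> \<one>" for e
  proof -
    have "cent z \<subseteq> cent e"
    proof
      fix a assume a: "a \<in> cent z"
      show "a \<in> cent e" using comm[OF a e(1)] cent_closed[OF a] unfolding cent_def by blast
    qed
    then show ?thesis using Z(2)[OF VZ[OF e]] z(2) by (metis card_subset_eq finite_cent)
  qed
  define M where "M = {g \<in> carrier G. g \<otimes> z \<otimes> inv g \<in> cent z}"
  have nt: "g \<otimes> z \<otimes> inv g \<noteq> \<one>" if "g \<in> carrier G" for g
    using that z conj_inj[of g z \<one>] cent_of_one n by (auto simp: order_def)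
  have MV: "g \<otimes> a \<otimes> inv g \<in> cent z" if g: "g \<in> M" and a: "a \<in> cent z" for g a
  proof -
    have gc: "g \<in> carrier G" and gz: "g \<otimes> z \<otimes> inv g \<in> cent z" using g by (auto simp: M_def)
    have "g \<otimes> a \<otimes> inv g \<in> cent (g \<otimes> z \<otimes> inv g)" using conj_cent_iff[OF gc z(1), of a] a cent_closed by blast
    then show ?thesis using centV[OF gz nt[OF gc]] by simp
  qed
  have M: "subgroup M G"
  proof (rule subgroupI)
    have "\<one> \<in> M" using z cent_self by (simp add: M_def)
    then show "M \<noteq> {}" by auto
    fix a assume a: "a \<in> M"
    have ac: "a \<in> carrier G" using a by (simp add: M_def)
    have "inj_on (\<lambda>e. a \<otimes> e \<otimes> inv a) (cent z)" using ac cent_closed by (auto simp: inj_on_def)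
    then have "(\<lambda>e. a \<otimes> e \<otimes> inv a) ` cent z = cent z" using MV[OF a]
      by (intro card_subset_eq) (auto simp: card_image)
    then have "z \<in> (\<lambda>e. a \<otimes> e \<otimes> inv a) ` cent z" using cent_self[OF z(1)] by simp
    then obtain e where e: "e \<in> cent z" "z = a \<otimes> e \<otimes> inv a" by (elim imageE)
    have "inv a \<otimes> z \<otimes> inv (inv a) = e" unfolding e(2) using ac cent_closed[OF e(1)] by (simp add: m_assoc)
    then show "inv a \<in> M" using e(1) ac by (simp add: M_def)
  next
    fix a b assume a: "a \<in> M" and b: "b \<in> M"
    have "a \<otimes> (b \<otimes> z \<otimes> inv b) \<otimes> inv a \<in> cent z" using MV[OF a] b by (simp add: M_def)
    then show "a \<otimes> b \<in> M" using a b z by (simp add: M_def conj_conj)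
  qed (auto simp: M_def)
  have "card M = (\<Sum>e\<in>cent z - {\<one>}. card {g \<in> M. g \<otimes> z \<otimes> inv g = e})"
  proof (rule card_eq_sum_fibres)
    show "(\<lambda>g. g \<otimes> z \<otimes> inv g) ` M \<subseteq> cent z - {\<one>}" using nt by (auto simp: M_def)
  qed (auto simp: M_def)
  also have "\<dots> = (\<Sum>e\<in>cent z - {\<one>}. 4)"
  proof (rule sum.cong)
    fix e assume e: "e \<in> cent z - {\<one>}"
    then have "{g \<in> M. g \<otimes> z \<otimes> inv g = e} = {g \<in> carrier G. g \<otimes> z \<otimes> inv g = e}" by (auto simp: M_def)
    then show "card {g \<in> M. g \<otimes> z \<otimes> inv g = e} = 4" using conj_fibre[OF z(1), of e] VZ[of e] e z by (simp add: Z_def)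
  qed simp
  also have "\<dots> = 12" using cent_one[OF z(1)] z by (simp add: card_Diff_singleton)
  finally have cM: "card M = 12" .
  obtain f where "f \<in> hom G (sym_group 5)" "inj_on f (carrier G)"
  proof (rule embed_sym_group[OF M])
    show "order G = 5 * card M" using n cM by simp
    fix g assume g: "g \<in> carrier G" and core: "\<And>y. y \<in> carrier G \<Longrightarrow> y \<otimes> g \<otimes> inv y \<in> M"
    show "g = \<one>"
    proof (rule ccontr)
      assume g1: "g \<noteq> \<one>"
      then have "g \<in> K \<or> g \<in> Z \<or> g \<in> cl u \<or> g \<in> cl v" using g R1 by (auto simp: R_def Y_def)
      then have "cl g = K \<or> cl g = Z \<or> cl g = cl u \<or> cl g = cl v"
        using cl_eq x z u v unfolding K_def Z_def by blast
      then have "card (cl g) \<ge> 12" using cards n by (elim disjE) simp_all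
      moreover have "insert \<one> (cl g) \<subseteq> M" using core subgroup.one_closed[OF M] by (auto simp: cl_def)
      then have "card (insert \<one> (cl g)) \<le> 12" using cM by (metis M card_mono finite_carrier finite_subset subgroup.subset)
      moreover have "\<one> \<notin> cl g" using one_in_cl[OF g] g1 by auto
      ultimately show False by simp
    qed
  qed blast
  moreover have "2 * order G = fact 5" using n by (simp add: fact_numeral)
  ultimately show ?thesis
  proof (rule iso_alt_group)
    show "K \<union> Y \<subseteq> carrier G" using sub by auto
    show "2 * card (K \<union> Y) > order G" using cards card_Y disj fin n by (simp add: card_Un_disjoint)
    fix g assume "g \<in> K \<union> Y"
    then show "\<exists>m. g [^] (2 * m + 1 :: nat) = \<one>"
    proof
      assume "g \<in> K"
      then have "g [^] (2 * 1 + 1 :: nat) = \<one>" using K[of g] by (simp add: numeral_eq_Suc)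
      then show ?thesis by blast
    next
      assume "g \<in> Y"
      then have "g [^] (2 * 2 + 1 :: nat) = \<one>" using Y(3)[of g] by simp
      then show ?thesis by blast
    qed
  qed simp
qed

end

context finite_grp
begin

text \<open>
  The relations of \<open>A\<^sub>4\<close>: the three conjugates of \<open>t\<close> by the powers of \<open>k\<close> commute
  and have trivial product.
\<close>

lemma triangle_233:
  assumes t: "t \<in> carrier G" "t \<otimes> t = \<one>" and k: "k \<in> carrier G" "k \<otimes> k = inv k"
    and tk: "(t \<otimes> k) \<otimes> (t \<otimes> k) = inv (t \<otimes> k)"
  defines "s \<equiv> k \<otimes> t \<otimes> inv k"
  shows "s \<otimes> t = t \<otimes> s" "k \<otimes> s \<otimes> inv k = t \<otimes> s"
proof -
  note [simp] = t(1) k(1)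
  have it: "inv t = t" using t by (simp add: inv_equality)
  have KK: "inv k \<otimes> inv k = k" using k by (metis inv_inv inv_mult_group)
  have tt': "t \<otimes> (t \<otimes> w) = w" and kk': "k \<otimes> (k \<otimes> w) = inv k \<otimes> w" and KK': "inv k \<otimes> (inv k \<otimes> w) = k \<otimes> w"
    if "w \<in> carrier G" for w
    using that t k KK by (simp_all add: m_assoc[symmetric])
  note base = m_assoc t(2) tt' k(2) kk' KK KK'
  have "t \<otimes> (k \<otimes> (t \<otimes> k)) = inv k \<otimes> t" using tk by (simp add: m_assoc inv_mult_group it)
  then have "t \<otimes> (k \<otimes> (t \<otimes> k)) \<otimes> inv k = inv k \<otimes> t \<otimes> inv k" by simp
  then have e: "t \<otimes> (k \<otimes> t) = inv k \<otimes> (t \<otimes> inv k)" by (simp add: base)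
  have ts: "t \<otimes> s = inv k \<otimes> (t \<otimes> k)"
  proof -
    have "t \<otimes> s = (t \<otimes> (k \<otimes> t)) \<otimes> inv k" by (simp add: s_def m_assoc)
    then show ?thesis unfolding e by (simp add: base)
  qed
  then show "k \<otimes> s \<otimes> inv k = t \<otimes> s" by (simp add: s_def base)
  have "s \<otimes> t = inv (t \<otimes> s)" by (simp add: s_def inv_mult_group it m_assoc)
  also have "\<dots> = inv k \<otimes> (t \<otimes> k)" unfolding ts by (simp add: inv_mult_group it m_assoc)
  finally show "s \<otimes> t = t \<otimes> s" using ts by simp
qed

text \<open>
  Put \<open>t = z\<^sup>2\<close>. The quotient of the two orders is the number of conjugates of \<open>s\<close> under the
  centralizer of \<open>t\<close>, to which \<open>z\<close> belongs. The centralizer of \<open>z\<close> contains no involution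
  besides \<open>t\<close>, so \<open>z\<close> moves all these conjugates, and as \<open>z\<^sup>2\<close> fixes them, they come
  in pairs. If \<open>s\<close> and its conjugate \<open>r\<close> by \<open>z\<close> are the only ones, then they commute, so
  \<open>s r\<close> is an involution fixed by \<open>z\<close>. Hence \<open>s r = t\<close>, which says that \<open>s\<close>
  inverts \<open>z\<close>.
\<close>

lemma card_cent_inter_le:
  assumes z: "z \<in> carrier G" "card (cent z) = 4" "z \<otimes> z \<noteq> \<one>"
    and s: "s \<in> carrier G" "s \<otimes> s = \<one>" "s \<noteq> \<one>" "s \<noteq> z \<otimes> z" "s \<in> cent (z \<otimes> z)"
  shows "2 * card (cent s \<inter> cent (z \<otimes> z)) \<le> card (cent (z \<otimes> z))"
    and "s \<otimes> z \<otimes> inv s \<noteq> inv z \<Longrightarrow> 4 * card (cent s \<inter> cent (z \<otimes> z)) \<le> card (cent (z \<otimes> z))"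
proof -
  define t where "t = z \<otimes> z"
  note cz = cent_order_4[OF z]
  have tc: "t \<in> carrier G" using z by (simp add: t_def)
  have C: "subgroup (cent t) G" by (rule cent_subgroup[OF tc])
  interpret C: finite_grp "G\<lparr>carrier := cent t\<rparr>" by (rule finite_grp_subgroup[OF C])
  have invC: "inv\<^bsub>G\<lparr>carrier := cent t\<rparr>\<^esub> h = inv h" if "h \<in> cent t" for h
    by (rule m_inv_consistent[OF C that])
  have centC: "C.cent s = cent s \<inter> cent t" 
  proof -
    have "C.cent s = {h \<in> cent t. h \<otimes> s = s \<otimes> h}" by (simp add: C.cent_def)
    then show ?thesis by (auto simp: cent_def)
  qed
  have sC: "s \<in> cent t" using s by (simp add: t_def)
  have zC: "z \<in> cent t" using z by (simp add: t_def cent_def m_assoc)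
  have clI: "y \<otimes> s \<otimes> inv y \<in> C.cl s" if "y \<in> cent t" for y
    unfolding C.cl_def using that invC[OF that] by (intro image_eqI[of _ _ y]) auto
  have cl_elem: "r \<in> carrier G \<and> t \<otimes> r = r \<otimes> t" if r: "r \<in> C.cl s" for r
    using C.clD[of s r] r sC by (auto simp: cent_def)
  have prod: "card (C.cl s) * card (cent s \<inter> cent t) = card (cent t)"
    using C.card_cl[of s] sC centC by (simp add: order_def)
  define r where "r = z \<otimes> s \<otimes> inv z"
  have ns: "z \<otimes> q \<otimes> inv z \<noteq> q" if q: "q \<in> carrier G" "q \<otimes> q = \<one>" "q \<noteq> \<one>" "q \<noteq> t" for q
  proof
    assume "z \<otimes> q \<otimes> inv z = q"
    then have "q \<in> cent z" using conj_eq_iff[of z q q] q z by (simp add: cent_def)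
    then have "q = z \<or> q = inv z" using cz(1) q by (auto simp: t_def)
    then show False using q(2) z(3) cz(8) by auto
  qed
  have rc: "r \<in> carrier G" using z s by (simp add: r_def)
  have rs: "r \<noteq> s" unfolding r_def by (rule ns) (use s in \<open>auto simp: t_def\<close>)
  have rcl: "r \<in> C.cl s" unfolding r_def by (rule clI[OF zC])
  have scl: "s \<in> C.cl s" by (rule C.cl_self) (use sC in simp)
  have sub2: "{s, r} \<subseteq> C.cl s" using rcl scl by simp
  have "card {s, r} = 2" using rs by simp
  then have "2 \<le> card (C.cl s)" using card_mono[OF C.finite_cl sub2] by simp
  then have "2 * card (cent s \<inter> cent t) \<le> card (C.cl s) * card (cent s \<inter> cent t)" by (rule mult_le_mono1)
  then show "2 * card (cent s \<inter> cent (z \<otimes> z)) \<le> card (cent (z \<otimes> z))"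
    by (simp only: prod t_def[symmetric])
  assume ni: "s \<otimes> z \<otimes> inv s \<noteq> inv z"
  have tt: "t \<otimes> t = \<one>" using cz(2) by (simp add: t_def)
  have zz_conj: "z \<otimes> (z \<otimes> q \<otimes> inv z) \<otimes> inv z = q" if q: "q \<in> carrier G" "t \<otimes> q = q \<otimes> t" for q
  proof -
    have "z \<otimes> (z \<otimes> q \<otimes> inv z) \<otimes> inv z = t \<otimes> q \<otimes> inv t"
      using q z by (simp add: t_def conj_conj)
    then show ?thesis using q conj_eq_iff[of t q q] tc by simp
  qed
  have "C.cl s \<noteq> {s, r}"
  proof
    assume two: "C.cl s = {s, r}"
    have "s \<otimes> r \<otimes> inv s \<in> C.cl s"
      using C.cl_conj[of s r s] sC rcl invC[OF sC] by simp
    then have "s \<otimes> r \<otimes> inv s = s \<or> s \<otimes> r \<otimes> inv s = r" using two by blast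
    moreover have "s \<otimes> r \<otimes> inv s \<noteq> s"
    proof
      assume "s \<otimes> r \<otimes> inv s = s"
      then have "s \<otimes> r = s \<otimes> s" using conj_eq_iff[OF s(1) rc s(1)] by (simp only:)
      then have "r = s" using s(1) rc by (simp only: l_cancel)
      then show False using rs by simp
    qed
    ultimately have sr: "s \<otimes> r = r \<otimes> s" using conj_eq_iff[of s r r] s rc by blast
    have rr: "r \<otimes> r = \<one>" using s z by (simp add: r_def conj_mult)
    have "z \<otimes> (s \<otimes> r) \<otimes> inv z = (z \<otimes> s \<otimes> inv z) \<otimes> (z \<otimes> r \<otimes> inv z)" using z s rc by (simp add: conj_mult)
    also have "\<dots> = r \<otimes> s" using zz_conj[of s] cl_elem[OF scl] by (simp add: r_def)
    also have "\<dots> = s \<otimes> r" using sr by simp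
    finally have "s \<otimes> r = t"
    proof -
      assume e: "z \<otimes> (s \<otimes> r) \<otimes> inv z = s \<otimes> r"
      have c: "s \<otimes> r \<in> carrier G" using s rc by simp
      have "s \<otimes> r \<otimes> (s \<otimes> r) = s \<otimes> (r \<otimes> s) \<otimes> r" using s rc by (simp add: m_assoc)
      also have "\<dots> = s \<otimes> (s \<otimes> r) \<otimes> r" by (simp only: sr)
      also have "\<dots> = (s \<otimes> s) \<otimes> (r \<otimes> r)" using s(1) rc by (simp add: m_assoc)
      also have "\<dots> = \<one>" using s rr by simp
      finally have 2: "s \<otimes> r \<otimes> (s \<otimes> r) = \<one>" .
      have "s \<otimes> r \<noteq> \<one>"
      proof
        assume "s \<otimes> r = \<one>"
        then have "s \<otimes> r = s \<otimes> s" using s(2) by (simp only:)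
        then have "r = s" using s(1) rc by (simp only: l_cancel)
        then show False using rs by simp
      qed
      then show ?thesis using ns[OF c 2] e by blast
    qed
    then have "s \<otimes> (s \<otimes> r) = s \<otimes> t" by simp
    then have "r = s \<otimes> t" using s rc by (simp add: m_assoc[symmetric])
    then have "z \<otimes> s = s \<otimes> t \<otimes> z" using conj_eq_iff[of z s "s \<otimes> t"] z s tc by (simp add: r_def)
    also have "\<dots> = s \<otimes> inv z"
    proof -
      have "t \<otimes> z = inv z" using cz(2) z by (intro inv_equality[symmetric]) (simp_all add: t_def m_assoc)
      then show ?thesis using s tc z by (simp add: m_assoc)
    qed
    finally have "s \<otimes> (z \<otimes> s) = s \<otimes> (s \<otimes> inv z)" by simp
    then have "s \<otimes> z \<otimes> s = inv z" using s z by (simp add: m_assoc[symmetric])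
    moreover have "inv s = s" using s by (simp add: inv_equality)
    ultimately show False using ni by simp
  qed
  then obtain q where q: "q \<in> C.cl s" "q \<noteq> s" "q \<noteq> r" using sub2 by blast
  have qc: "q \<in> carrier G" using cl_elem[OF q(1)] by simp
  define p where "p = z \<otimes> q \<otimes> inv z"
  have pcl: "p \<in> C.cl s"
    unfolding p_def using C.cl_conj[of s q z] sC q(1) zC invC[OF zC] by simp
  have qq: "q \<otimes> q = \<one>" "q \<noteq> \<one>" "q \<noteq> t"
  proof -
    obtain y where y: "y \<in> cent t" "q = y \<otimes> s \<otimes> inv y" using q(1) invC unfolding C.cl_def by auto
    have yc: "y \<in> carrier G" using y cent_closed by blast
    show "q \<otimes> q = \<one>" using y yc s by (simp add: conj_mult)
    show "q \<noteq> \<one>" using y yc s conj_inj[of y s \<one>] by auto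
    show "q \<noteq> t"
    proof
      assume "q = t"
      moreover have "y \<otimes> t \<otimes> inv y = t" using y(1) yc tc conj_eq_iff[of y t t] by (simp add: cent_def)
      ultimately have "s = t" using y(2) yc s tc conj_inj[of y s t] by simp
      then show False using s by (simp add: t_def)
    qed
  qed
  have pq: "p \<noteq> q" unfolding p_def by (rule ns[OF qc qq])
  have zinj: "a = b" if "a \<in> carrier G" "b \<in> carrier G" "z \<otimes> a \<otimes> inv z = z \<otimes> b \<otimes> inv z" for a b
    using conj_inj[of z a b] that z by simp
  have pr: "p \<noteq> r" using zinj[OF qc s(1)] q(2) by (auto simp: p_def r_def)
  have ps: "p \<noteq> s"
  proof
    assume "p = s"
    then have "z \<otimes> q \<otimes> inv z = z \<otimes> r \<otimes> inv z" using zz_conj[of s] cl_elem[OF scl] by (simp add: p_def r_def)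
    then show False using zinj[OF qc rc] q(3) by simp
  qed
  have "{s, r, q, p} \<subseteq> C.cl s" using sub2 q pcl by simp
  moreover have "card {s, r, q, p} = 4" using rs q pq pr ps by (simp add: eq_commute)
  ultimately have "4 \<le> card (C.cl s)" using card_mono[OF C.finite_cl] by metis
  then have "4 * card (cent s \<inter> cent t) \<le> card (C.cl s) * card (cent s \<inter> cent t)" by (rule mult_le_mono1)
  then show "4 * card (cent s \<inter> cent (z \<otimes> z)) \<le> card (cent (z \<otimes> z))"
    by (simp only: prod t_def[symmetric])
qed

end

context classes_3455
begin

lemma KZY_R: "g \<in> carrier G \<Longrightarrow> g \<in> K \<or> g \<in> Z \<or> g \<in> Y \<or> g \<in> R"
  by (auto simp: R_def)

lemma conj_K: "\<lbrakk>k \<in> K; y \<in> carrier G\<rbrakk> \<Longrightarrow> y \<otimes> k \<otimes> inv y \<in> K"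
  using cl_conj[OF x(1)] by (simp add: K_def)

lemma involution_in_R:
  assumes s: "s \<in> carrier G" "s \<otimes> s = \<one>" and "s \<notin> Z"
  shows "s \<in> R"
proof -
  have "s \<notin> K"
  proof
    assume k: "s \<in> K"
    then have "inv s = \<one>" using K(3)[OF k] s by simp
    then show False using K(2)[OF k] s by (simp add: inv_eq_1_iff)
  qed
  moreover have "s \<notin> Y"
  proof
    assume k: "s \<in> Y"
    have "s [^] (5::nat) = s" using s by (simp add: numeral_eq_Suc m_assoc)
    then show False using Y(3,4)[OF k] by simp
  qed
  ultimately show ?thesis using assms by (simp add: R_def)
qed

text \<open>
  Put \<open>t = z\<^sup>2\<close>, let \<open>I\<close> be the class of \<open>t\<close> and \<open>c = c(t)\<close>. The
  identity and the elements of \<open>I\<close> lie in \<open>R\<close>, which has \<open>|G| / 60\<close> elements, so \<open>c >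
  60\<close>; and \<open>15\<close> divides \<open>|I|\<close>, because elements of order 3 and 5 act on \<open>I\<close> without
  fixed points.

  Map each \<open>k \<in> K\<close> to the conjugate \<open>s\<close> of \<open>t\<close> by \<open>k\<close>. If \<open>t k \<in>
  K\<close>, then \<open>s\<close> commutes with \<open>t\<close>, and \<open>k\<close> cyclically permutes \<open>t\<close>,
  \<open>s\<close> and \<open>t s\<close>; so for given \<open>s\<close> there are at most as many such \<open>k\<close> as
  elements centralizing both \<open>s\<close> and \<open>t\<close>, which is at most \<open>c / 4\<close>, up to at most four
  exceptional \<open>s\<close> with the bound \<open>c / 2\<close>. If \<open>t k\<close> lies in \<open>Z\<close> or
  \<open>Y\<close>, then \<open>s\<close> does not commute with \<open>t\<close>, and \<open>k = w h\<close>, where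
  \<open>w\<close> is \<open>t s\<close> or \<open>(t s)\<^sup>2\<close> and \<open>h\<close> is one of the involutions
  \<open>P\<close> commuting with \<open>t\<close>; at most half of \<open>P\<close> occurs, and \<open>P\<close> has at most
  \<open>(c + 2) / 2\<close> elements. The remaining \<open>k\<close> have \<open>t k \<in> R\<close>, so there are at most
  \<open>|R|\<close> of them.

  Altogether \<open>4 |K| \<le> (|I| - 1) c + 4 c + 2 (|I| - 1) + 4 |R|\<close>, where \<open>|K|\<close> and \<open>|R|\<close>
  are \<open>|I| c / 3\<close> and \<open>|I| c / 60\<close>. With \<open>|I| \<ge> 15\<close> this would force \<open>c \<le>
  30\<close>.
\<close>

lemma order_4_impossible:
  assumes zz: "z \<otimes> z \<noteq> \<one>"
  shows False
proof -
  note cz = cent_order_4[OF z zz]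
  define t where "t = z \<otimes> z"
  define c where "c = card (cent t)"
  define I where "I = cl t"
  have tc: "t \<in> carrier G" using z by (simp add: t_def)
  have tt: "t \<otimes> t = \<one>" using cz(2) by (simp add: t_def)
  have t1: "t \<noteq> \<one>" using zz by (simp add: t_def)
  have it: "inv t = t" using tc tt by (simp add: inv_equality)
  have tt': "t \<otimes> (t \<otimes> w) = w" if "w \<in> carrier G" for w using that tc tt by (simp add: m_assoc[symmetric])
  have tI: "t \<in> I" using cl_self[OF tc] by (simp add: I_def)
  have I: "s \<in> carrier G" "s \<otimes> s = \<one>" "s \<noteq> \<one>" if s: "s \<in> I" for s
  proof -
    show "s \<in> carrier G" using clD[OF tc] s by (simp add: I_def)
    show "s \<otimes> s = \<one>" using s tc tt by (auto simp: I_def cl_def conj_mult)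
    show "s \<noteq> \<one>" using s one_in_cl[OF tc] t1 by (auto simp: I_def)
  qed
  have IR: "I \<subseteq> R"
  proof
    fix s assume s: "s \<in> I"
    have "s \<notin> Z"
    proof
      assume "s \<in> Z"
      then have "cl t = cl z" using cl_eq[OF z(1), of s] cl_eq[OF tc, of s] s by (simp add: Z_def I_def)
      then have "t \<in> cl z" using cl_self[OF tc] by simp
      then have "t \<otimes> t \<in> cl t" unfolding t_def by (rule cl_square[OF z(1)])
      then show False using one_in_cl[OF tc] tt t1 by simp
    qed
    then show "s \<in> R" by (rule involution_in_R[OF I(1,2)[OF s]])
  qed
  have finI: "finite I" by (simp add: I_def)
  have nI: "card I * c = order G" using card_cl[OF tc] by (simp add: I_def c_def)
  have Kt: "k \<notin> cent t" if k: "k \<in> K" for k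
  proof
    assume "k \<in> cent t"
    then have "t \<in> cent k" by (rule cent_sym[OF tc])
    then have "t [^] (3::nat) = \<one>" using cent_pow_card[OF K(1)[OF k]] K(5)[OF k] by metis
    then show False using tt t1 tc by (simp add: numeral_eq_Suc)
  qed
  have kt: "k \<otimes> t \<otimes> inv k \<noteq> t" if k: "k \<in> K" for k
    using Kt[OF k] conj_eq_iff[of k t t] K(1)[OF k] tc by (simp add: cent_def)
  have conj_in_I: "y \<otimes> s \<otimes> inv y \<in> I" if "s \<in> I" "y \<in> carrier G" for s y
    using cl_conj[OF tc] that by (simp add: I_def)
  \<comment> \<open>\<open>R\<close> is a sixtieth of the group and strictly contains the class \<open>I\<close>.\<close>
  have "card I + 1 \<le> card R"
  proof -
    have "card (insert \<one> I) \<le> card R" using IR one_R fin by (intro card_mono) auto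
    moreover have "\<one> \<notin> I" using I(3) by blast
    ultimately show ?thesis using finI by simp
  qed
  then have "60 * (card I + 1) \<le> 60 * card R" by simp
  also have "\<dots> = card I * c" using nI card_R by simp
  finally have "60 * card I + 60 \<le> card I * c" by simp
  then have ge: "card I * 60 < card I * c" by linarith
  have c60: "c > 60"
  proof (rule ccontr)
    assume "\<not> c > 60"
    then have "card I * c \<le> card I * 60" by (intro mult_le_mono2) simp
    then show False using ge by linarith
  qed
  \<comment> \<open>An involution does not commute with an element whose centralizer has odd order.\<close>
  have prime_dvd_I: "p dvd card I" if p: "Factorial_Ring.prime p" "odd p" and g: "g \<in> carrier G" "card (cent g) = p" for p g
  proof -
    have gp: "g [^] p = \<one>" using pow_card_cent[OF g(1)] g by simp
    have fp: "((\<lambda>s. g \<otimes> s \<otimes> inv g) ^^ k) s = g [^] k \<otimes> s \<otimes> inv (g [^] k)" if "s \<in> carrier G" for k s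
      using that g by (induction k) (simp_all add: conj_conj nat_pow_Suc2[symmetric] del: nat_pow_Suc)
    have "[card I = card {s \<in> I. g \<otimes> s \<otimes> inv g = s}] (mod p)"
      by (rule card_fixed_points_cong[OF p(1) finI]) (use conj_in_I g I(1) fp gp in auto)
    moreover have "{s \<in> I. g \<otimes> s \<otimes> inv g = s} = {}"
    proof -
      have False if s: "s \<in> I" "g \<otimes> s \<otimes> inv g = s" for s
      proof -
        have "g \<otimes> s = s \<otimes> g" using conj_eq_iff[of g s s] g I(1)[OF s(1)] s by simp
        then have "s \<in> cent g" using I(1)[OF s(1)] by (simp add: cent_def)
        then have sp: "s [^] p = \<one>" using cent_pow_card[OF g(1)] g by simp
        obtain m where m: "p = 2 * m + 1" using p(2) by (elim oddE)
        have "s [^] (2::nat) = \<one>" using I(2)[OF s(1)] I(1)[OF s(1)] by (simp add: numeral_2_eq_2)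
        then have "s [^] (2 * m + 1) = s"
          using I(1)[OF s(1)] by (simp add: nat_pow_mult[symmetric] nat_pow_pow[symmetric])
        then show False using sp m I(3)[OF s(1)] by simp
      qed
      then show ?thesis by blast
    qed
    ultimately show ?thesis by (simp add: cong_0_iff)
  qed
  have "3 dvd card I" by (rule prime_dvd_I[OF _ _ x]) simp_all
  moreover have "5 dvd card I" by (rule prime_dvd_I[OF _ _ u]) simp_all
  ultimately have "15 dvd card I" by presburger
  moreover have "card I > 0" using tI finI by (auto simp: card_gt_0_iff)
  ultimately have I15: "card I \<ge> 15" by (rule dvd_imp_le)
  define P where "P = {h \<in> cent t. h \<otimes> h = \<one> \<and> h \<noteq> \<one> \<and> h \<noteq> t}"
  have finP: "finite P" by (simp add: P_def)
  have C: "subgroup (cent t) G" by (rule cent_subgroup[OF tc])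
  have zC: "z \<in> cent t" using z by (simp add: t_def cent_def m_assoc)
  have inverting: "card {h \<in> carrier G. h \<otimes> z \<otimes> inv h = inv z} \<le> 4" using conj_fibre_le[OF z(1)] z(2) by metis
  \<comment> \<open>If \<open>h\<close> and \<open>z h\<close> both square to 1, then \<open>h\<close> inverts \<open>z\<close>; so \<open>J\<close> and \<open>z J\<close> share at most four elements.\<close>
  have P_le: "2 * card P \<le> c + 2"
  proof -
    define J where "J = insert t P"
    have J: "h \<in> cent t" "h \<otimes> h = \<one>" "h \<noteq> \<one>" if "h \<in> J" for h
      using that tt t1 cent_self[OF tc] by (auto simp: J_def P_def)
    have finJ: "finite J" using finP by (simp add: J_def)
    have cJ: "card J = card P + 1" using finP by (simp add: J_def P_def)
    have Jc: "h \<in> carrier G" if "h \<in> J" for h using J(1)[OF that] by (rule cent_closed)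
    have inj: "inj_on ((\<otimes>) z) J" using Jc z by (auto simp: inj_on_def)
    have "(\<otimes>) z ` J \<inter> J \<subseteq> (\<otimes>) z ` {h \<in> carrier G. h \<otimes> z \<otimes> inv h = inv z}"
    proof
      fix y assume "y \<in> (\<otimes>) z ` J \<inter> J"
      then obtain h where h: "h \<in> J" "z \<otimes> h \<in> J" "y = z \<otimes> h" by blast
      have "inv z = h \<otimes> z \<otimes> h" using J(2)[OF h(2)] z Jc[OF h(1)] by (intro inv_equality) (simp_all add: m_assoc, metis J(2) h(1,2) m_assoc m_closed r_inv inv_equality l_inv Jc)
      moreover have "inv h = h" using J(2)[OF h(1)] Jc[OF h(1)] by (simp add: inv_equality)
      ultimately have "h \<otimes> z \<otimes> inv h = inv z" by simp
      then show "y \<in> (\<otimes>) z ` {h \<in> carrier G. h \<otimes> z \<otimes> inv h = inv z}" using Jc[OF h(1)] h(3) by blast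
    qed
    then have "card ((\<otimes>) z ` J \<inter> J) \<le> card ((\<otimes>) z ` {h \<in> carrier G. h \<otimes> z \<otimes> inv h = inv z})"
      by (intro card_mono) auto
    also have "\<dots> \<le> 4" using card_image_le[of "{h \<in> carrier G. h \<otimes> z \<otimes> inv h = inv z}" "(\<otimes>) z"] inverting by simp
    finally have 4: "card ((\<otimes>) z ` J \<inter> J) \<le> 4" .
    have "(\<otimes>) z ` J \<union> J \<subseteq> cent t" using J(1) subgroup.m_closed[OF C zC] by auto
    then have "card ((\<otimes>) z ` J \<union> J) \<le> c" unfolding c_def by (intro card_mono) auto
    moreover have "card ((\<otimes>) z ` J) + card J = card ((\<otimes>) z ` J \<union> J) + card ((\<otimes>) z ` J \<inter> J)"
      using finJ by (intro card_Un_Int) auto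
    ultimately show ?thesis using 4 cJ card_image[OF inj] by linarith
  qed
  define J1 where "J1 = {s \<in> I. s \<in> cent t \<and> s \<noteq> t}"
  define Q where "Q = {s \<in> I. s \<notin> cent t}"
  have split_I: "card Q + card J1 + 1 = card I"
  proof -
    have "I = insert t (Q \<union> J1)" using tI by (auto simp: Q_def J1_def)
    moreover have "t \<notin> Q \<union> J1" using cent_self[OF tc] by (auto simp: Q_def J1_def)
    moreover have "Q \<inter> J1 = {}" by (auto simp: Q_def J1_def)
    moreover have "finite Q" "finite J1" using finI by (auto simp: Q_def J1_def)
    ultimately show ?thesis by (simp add: card_Un_disjoint)
  qed
  define Ka where "Ka = {k \<in> K. t \<otimes> k \<in> K}"
  define Kb where "Kb = {k \<in> K. t \<otimes> k \<in> Z \<union> Y}"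
  define Kr where "Kr = {k \<in> K. t \<otimes> k \<in> R}"
  have finK: "finite Ka" "finite Kb" "finite Kr" using fin by (simp_all add: Ka_def Kb_def Kr_def)
  \<comment> \<open>Tetrahedral products: for given \<open>s\<close> the elements \<open>k\<close> lie in a coset of the common centralizer of \<open>s\<close> and \<open>t\<close>.\<close>
  have Ka_le: "4 * card Ka \<le> card J1 * c + 4 * c"
  proof -
    have finJ1: "finite J1" using finI by (simp add: J1_def)
    have tri: "k \<otimes> t \<otimes> inv k \<in> J1 \<and> k \<otimes> (k \<otimes> t \<otimes> inv k) \<otimes> inv k = t \<otimes> (k \<otimes> t \<otimes> inv k)" if k: "k \<in> Ka" for k
    proof -
      have kK: "k \<in> K" and tk: "t \<otimes> k \<in> K" using k by (auto simp: Ka_def)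
      note tr = triangle_233[OF tc tt K(1)[OF kK] K(3)[OF kK] K(3)[OF tk]]
      have "k \<otimes> t \<otimes> inv k \<in> I" by (rule conj_in_I[OF tI K(1)[OF kK]])
      moreover have "k \<otimes> t \<otimes> inv k \<in> cent t" using tr(1) K(1)[OF kK] tc by (simp add: cent_def)
      ultimately show ?thesis using kt[OF kK] tr(2) by (simp add: J1_def)
    qed
    have fib: "card {k \<in> Ka. k \<otimes> t \<otimes> inv k = s} \<le> card (cent s \<inter> cent t)" if s: "s \<in> J1" for s
    proof (cases "{k \<in> Ka. k \<otimes> t \<otimes> inv k = s} = {}")
      case True
      then show ?thesis by (simp only: card.empty)
    next
      case False
      then obtain a where a: "a \<in> Ka" "a \<otimes> t \<otimes> inv a = s" by blast
      have ac: "a \<in> carrier G" using a K(1) by (simp add: Ka_def)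
      have sc: "s \<in> carrier G" using s I(1) by (simp add: J1_def)
      have e: "inv a \<otimes> s \<otimes> inv (inv a) = t" using a(2) ac tc by (auto simp: m_assoc)
      have "a \<otimes> s \<otimes> inv a = t \<otimes> s" using tri[OF a(1)] a(2) by simp
      moreover have "inv a \<otimes> (a \<otimes> s \<otimes> inv a) \<otimes> inv (inv a) = s" using ac sc by (simp add: m_assoc)
      ultimately have e2: "inv a \<otimes> (t \<otimes> s) \<otimes> inv (inv a) = s" by (simp only:)
      have "(\<otimes>) (inv a) ` {k \<in> Ka. k \<otimes> t \<otimes> inv k = s} \<subseteq> cent s \<inter> cent t"
      proof
        fix y assume "y \<in> (\<otimes>) (inv a) ` {k \<in> Ka. k \<otimes> t \<otimes> inv k = s}"
        then obtain k where k: "k \<in> Ka" "k \<otimes> t \<otimes> inv k = s" "y = inv a \<otimes> k" by blast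
        have kc: "k \<in> carrier G" using k K(1) by (simp add: Ka_def)
        have yc: "y \<in> carrier G" using k ac kc by simp
        have "y \<otimes> t \<otimes> inv y = inv a \<otimes> (k \<otimes> t \<otimes> inv k) \<otimes> inv (inv a)"
          unfolding k(3) by (rule conj_conj[symmetric]) (use ac kc tc in auto)
        then have "y \<otimes> t \<otimes> inv y = t" using k(2) e by simp
        then have "y \<in> cent t" using conj_eq_iff[OF yc tc tc] yc by (simp add: cent_def)
        moreover have "k \<otimes> s \<otimes> inv k = t \<otimes> s" using tri[OF k(1)] k(2) by simp
        then have "inv a \<otimes> (k \<otimes> s \<otimes> inv k) \<otimes> inv (inv a) = s" using e2 by simp
        then have "y \<otimes> s \<otimes> inv y = s"
          unfolding k(3) using conj_conj[of "inv a" k s] ac kc sc by simp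
        then have "y \<in> cent s" using conj_eq_iff[OF yc sc sc] yc by (simp add: cent_def)
        ultimately show "y \<in> cent s \<inter> cent t" by simp
      qed
      moreover have "inj_on ((\<otimes>) (inv a)) {k \<in> Ka. k \<otimes> t \<otimes> inv k = s}"
        using ac K(1) by (auto simp: inj_on_def Ka_def)
      ultimately show ?thesis by (intro card_inj_on_le[of "(\<otimes>) (inv a)"]) auto
    qed
    define D where "D = {s \<in> J1. s \<otimes> z \<otimes> inv s = inv z}"
    have D4: "card D \<le> 4"
    proof -
      have "D \<subseteq> {h \<in> carrier G. h \<otimes> z \<otimes> inv h = inv z}" using I(1) by (auto simp: D_def J1_def)
      then have "card D \<le> card {h \<in> carrier G. h \<otimes> z \<otimes> inv h = inv z}" by (intro card_mono) auto
      then show ?thesis using inverting by simp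
    qed
    have b: "4 * card {k \<in> Ka. k \<otimes> t \<otimes> inv k = s} \<le> c + (if s \<in> D then c else 0)" if s: "s \<in> J1" for s
    proof -
      have sI: "s \<in> I" "s \<noteq> z \<otimes> z" "s \<in> cent (z \<otimes> z)" using s by (auto simp: J1_def t_def)
      note ci = card_cent_inter_le[OF z zz I(1)[OF sI(1)] I(2)[OF sI(1)] I(3)[OF sI(1)] sI(2,3)]
      show ?thesis using fib[OF s] ci s unfolding c_def t_def D_def by (cases "s \<otimes> z \<otimes> inv s = inv z") auto
    qed
    have "card Ka = (\<Sum>s\<in>J1. card {k \<in> Ka. k \<otimes> t \<otimes> inv k = s})"
      by (rule card_eq_sum_fibres[OF finK(1) finJ1]) (use tri in blast)
    then have "4 * card Ka = (\<Sum>s\<in>J1. 4 * card {k \<in> Ka. k \<otimes> t \<otimes> inv k = s})" by (simp add: sum_distrib_left)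
    also have "\<dots> \<le> (\<Sum>s\<in>J1. c + (if s \<in> D then c else 0))" by (rule sum_mono) (rule b)
    also have "\<dots> = card J1 * c + (\<Sum>s\<in>J1. if s \<in> D then c else 0)" by (simp add: sum.distrib)
    also have "(\<Sum>s\<in>J1. if s \<in> D then c else 0) = (\<Sum>s\<in>J1 \<inter> D. c)"
      by (rule sum.inter_restrict[OF finJ1, symmetric])
    also have "J1 \<inter> D = D" by (auto simp: D_def)
    also have "(\<Sum>s\<in>D. c) = card D * c" by simp
    also have "\<dots> \<le> 4 * c" using D4 by simp
    finally show ?thesis by simp
  qed
  \<comment> \<open>Octahedral and icosahedral products, where \<open>t s\<close> has order 3 and 5.\<close>
  have Kb_le: "2 * card Kb \<le> card Q * card P"
  proof -
    have finQ: "finite Q" using finI by (simp add: Q_def)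
    have w_inv: "inv (t \<otimes> s) = s \<otimes> t" if "s \<in> I" for s
      using I[OF that] tc it by (simp add: inv_mult_group inv_equality)
    have oct: "(t \<otimes> s) [^] (3::nat) = \<one>" "inv (t \<otimes> s) \<otimes> k \<in> cent t" "(inv (t \<otimes> s) \<otimes> k) \<otimes> (inv (t \<otimes> s) \<otimes> k) = \<one>"
      if k: "k \<in> K" "t \<otimes> k \<in> Z" and s: "s = k \<otimes> t \<otimes> inv k" for k s
    proof -
      note kc = K(1)[OF k(1)]
      have sI: "s \<in> I" unfolding s by (rule conj_in_I[OF tI kc])
      note sc = I(1)[OF sI]
      define h where "h = inv (t \<otimes> s) \<otimes> k"
      have hc: "h \<in> carrier G" using tc sc kc by (simp add: h_def)
      have "h = (s \<otimes> t) \<otimes> k" by (simp only: h_def w_inv[OF sI])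
      then have he: "h = k \<otimes> (t \<otimes> (inv k \<otimes> (t \<otimes> k)))"
        unfolding s using kc tc by (simp add: m_assoc)
      note tr = triangle_234[OF tc tt kc K(3)[OF k(1)] Z(3)[OF k(2)]]
      show "(inv (t \<otimes> s) \<otimes> k) \<otimes> (inv (t \<otimes> s) \<otimes> k) = \<one>" using tr(1) he unfolding h_def by simp
      show hC: "inv (t \<otimes> s) \<otimes> k \<in> cent t" using tr(2) he hc unfolding h_def by (simp add: cent_def)
      have "(t \<otimes> s) \<otimes> h = k" unfolding h_def using tc sc kc by simp
      then have "s = (t \<otimes> s) \<otimes> (h \<otimes> t \<otimes> inv h) \<otimes> inv (t \<otimes> s)"
        unfolding s using conj_conj[of "t \<otimes> s" h t] tc sc hc by (simp add: s)
      also have "h \<otimes> t \<otimes> inv h = t" using hC conj_eq_iff[OF hc tc tc] by (simp add: cent_def h_def)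
      finally have "s = t \<otimes> s \<otimes> t \<otimes> (s \<otimes> t)" unfolding w_inv[OF sI] .
      then have "t \<otimes> s = t \<otimes> (t \<otimes> s \<otimes> t \<otimes> (s \<otimes> t))" by simp
      then have "t \<otimes> s = s \<otimes> t \<otimes> (s \<otimes> t)" using tt' tc sc by (simp add: m_assoc)
      then have "(t \<otimes> s) \<otimes> ((t \<otimes> s) \<otimes> (t \<otimes> s)) = (t \<otimes> s) \<otimes> ((t \<otimes> s) \<otimes> (s \<otimes> t \<otimes> (s \<otimes> t)))" by simp
      also have "\<dots> = (t \<otimes> s) \<otimes> ((t \<otimes> s) \<otimes> (inv (t \<otimes> s) \<otimes> inv (t \<otimes> s)))" unfolding w_inv[OF sI] ..
      also have "\<dots> = \<one>" using tc sc by simp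
      finally show "(t \<otimes> s) [^] (3::nat) = \<one>" using tc sc by (simp add: numeral_3_eq_3 m_assoc)
    qed
    have ico: "(t \<otimes> s) [^] (5::nat) = \<one>" "inv ((t \<otimes> s) \<otimes> (t \<otimes> s)) \<otimes> k \<in> cent t"
      "(inv ((t \<otimes> s) \<otimes> (t \<otimes> s)) \<otimes> k) \<otimes> (inv ((t \<otimes> s) \<otimes> (t \<otimes> s)) \<otimes> k) = \<one>"
      if k: "k \<in> K" "t \<otimes> k \<in> Y" and s: "s = k \<otimes> t \<otimes> inv k" for k s
    proof -
      note kc = K(1)[OF k(1)]
      have sI: "s \<in> I" unfolding s by (rule conj_in_I[OF tI kc])
      note sc = I(1)[OF sI]
      define h where "h = inv ((t \<otimes> s) \<otimes> (t \<otimes> s)) \<otimes> k"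
      have hc: "h \<in> carrier G" using tc sc kc by (simp add: h_def)
      have iw: "inv ((t \<otimes> s) \<otimes> (t \<otimes> s)) = (s \<otimes> t) \<otimes> (s \<otimes> t)"
        using w_inv[OF sI] inv_mult_group[of "t \<otimes> s" "t \<otimes> s"] tc sc by simp
      have "h = (s \<otimes> t) \<otimes> (s \<otimes> t) \<otimes> k" by (simp only: h_def iw)
      then have he: "h = k \<otimes> (t \<otimes> (inv k \<otimes> (t \<otimes> (k \<otimes> (t \<otimes> (inv k \<otimes> (t \<otimes> k)))))))"
        unfolding s using kc tc by (simp add: m_assoc)
      note tr = triangle_235[OF tc tt kc K(3)[OF k(1)] Y(3)[OF k(2)]]
      show "(inv ((t \<otimes> s) \<otimes> (t \<otimes> s)) \<otimes> k) \<otimes> (inv ((t \<otimes> s) \<otimes> (t \<otimes> s)) \<otimes> k) = \<one>"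
        using tr(1) he unfolding h_def by simp
      show hC: "inv ((t \<otimes> s) \<otimes> (t \<otimes> s)) \<otimes> k \<in> cent t" using tr(2) he hc unfolding h_def by (simp add: cent_def)
      have "((t \<otimes> s) \<otimes> (t \<otimes> s)) \<otimes> h = k" unfolding h_def using tc sc kc by simp
      then have "s = ((t \<otimes> s) \<otimes> (t \<otimes> s)) \<otimes> (h \<otimes> t \<otimes> inv h) \<otimes> inv ((t \<otimes> s) \<otimes> (t \<otimes> s))"
        unfolding s using conj_conj[of "(t \<otimes> s) \<otimes> (t \<otimes> s)" h t] tc sc hc by (simp add: s)
      also have "h \<otimes> t \<otimes> inv h = t" using hC conj_eq_iff[OF hc tc tc] by (simp add: cent_def h_def)
      finally have "s = (t \<otimes> s) \<otimes> (t \<otimes> s) \<otimes> t \<otimes> ((s \<otimes> t) \<otimes> (s \<otimes> t))" unfolding iw .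
      then have "t \<otimes> s = t \<otimes> ((t \<otimes> s) \<otimes> (t \<otimes> s) \<otimes> t \<otimes> ((s \<otimes> t) \<otimes> (s \<otimes> t)))" by simp
      then have e: "t \<otimes> s = (s \<otimes> t) \<otimes> ((s \<otimes> t) \<otimes> ((s \<otimes> t) \<otimes> (s \<otimes> t)))" using tt' tc sc by (simp add: m_assoc)
      define w where "w = t \<otimes> s"
      have wc: "w \<in> carrier G" using tc sc by (simp add: w_def)
      have "w = inv w \<otimes> (inv w \<otimes> (inv w \<otimes> inv w))" using e w_inv[OF sI] by (simp add: w_def)
      then have "w \<otimes> (w \<otimes> (w \<otimes> (w \<otimes> w))) = w \<otimes> (w \<otimes> (w \<otimes> (w \<otimes> (inv w \<otimes> (inv w \<otimes> (inv w \<otimes> inv w))))))" by simp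
      also have "\<dots> = \<one>" using wc by simp
      finally show "(t \<otimes> s) [^] (5::nat) = \<one>" using wc unfolding w_def[symmetric] by (simp add: numeral_eq_Suc m_assoc)
    qed
    have nocomm: "s = t" if "s \<in> I" "(t \<otimes> s) [^] (m::nat) = \<one>" "odd m" "s \<in> cent t" for s m
    proof -
      have sc: "s \<in> carrier G" using I that by simp
      have st: "s \<otimes> t = t \<otimes> s" using that(4) by (simp add: cent_def)
      have "(t \<otimes> s) \<otimes> (t \<otimes> s) = t \<otimes> (s \<otimes> t) \<otimes> s" using sc tc by (simp add: m_assoc)
      also have "\<dots> = t \<otimes> (t \<otimes> s) \<otimes> s" by (simp only: st)
      also have "\<dots> = \<one>" using tt' tc sc I(2)[OF that(1)] by (simp add: m_assoc)
      finally have 2: "(t \<otimes> s) [^] (2::nat) = \<one>" using tc sc by (simp add: numeral_2_eq_2)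
      obtain i where i: "m = 2 * i + 1" using \<open>odd m\<close> by (elim oddE)
      have "(t \<otimes> s) [^] m = t \<otimes> s" unfolding i
        using tc sc 2 by (simp add: nat_pow_mult[symmetric] nat_pow_pow[symmetric])
      then have "t \<otimes> s = t \<otimes> t" using that(2) tt by simp
      then show ?thesis using tc sc by (simp only: l_cancel)
    qed
    \<comment> \<open>The sets \<open>w\<^sup>-\<^sup>1 F\<close> and \<open>t w\<^sup>-\<^sup>1 F\<close> are disjoint: otherwise \<open>k = l t\<close> for some \<open>k, l \<in> F\<close>, and then \<open>t l\<close> is conjugate to \<open>k\<close>, hence in \<open>K\<close>.\<close>
    have half: "2 * card F \<le> card P"
      if F: "F \<subseteq> Kb" and w: "w \<in> carrier G" "t \<otimes> w \<in> I" "w \<otimes> t \<in> I"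
        and h: "\<And>k. k \<in> F \<Longrightarrow> inv w \<otimes> k \<in> cent t \<and> (inv w \<otimes> k) \<otimes> (inv w \<otimes> k) = \<one>" for F w
    proof -
      have Fk: "k \<in> K" "t \<otimes> k \<in> Z \<union> Y" "k \<in> carrier G" if "k \<in> F" for k using that F K(1) by (auto simp: Kb_def)
      define S where "S = (\<lambda>k. inv w \<otimes> k) ` F"
      have finF: "finite F" using F finK finite_subset by blast
      have SP: "S \<subseteq> P"
      proof
        fix y assume "y \<in> S"
        then obtain k where k: "k \<in> F" "y = inv w \<otimes> k" by (auto simp: S_def)
        have wy: "k = w \<otimes> y" using k w Fk(3)[OF k(1)] by simp
        have "y \<noteq> \<one>"
        proof
          assume "y = \<one>"
          then have "t \<otimes> k \<in> R" using wy w IR by auto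
          then show False using Fk(2)[OF k(1)] by (auto simp: R_def)
        qed
        moreover have "y \<noteq> t"
        proof
          assume "y = t"
          then have "k \<in> R" using wy w IR by auto
          then show False using Fk(1)[OF k(1)] by (auto simp: R_def)
        qed
        ultimately show "y \<in> P" using h[OF k(1)] k(2) by (simp add: P_def)
      qed
      have TP: "(\<otimes>) t ` S \<subseteq> P"
      proof
        fix y assume "y \<in> (\<otimes>) t ` S"
        then obtain h where h: "h \<in> P" "y = t \<otimes> h" using SP by blast
        have hc: "h \<in> carrier G" "h \<otimes> t = t \<otimes> h" "h \<otimes> h = \<one>" "h \<noteq> \<one>" "h \<noteq> t" "h \<in> cent t"
          using h(1) by (auto simp: P_def cent_def)
        have "y \<in> cent t" unfolding h(2) by (rule subgroup.m_closed[OF C cent_self[OF tc] hc(6)])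
        moreover have "y \<otimes> y = \<one>"
        proof -
          have "y \<otimes> y = t \<otimes> (h \<otimes> t) \<otimes> h" using h(2) hc(1) tc by (simp add: m_assoc)
          also have "\<dots> = (t \<otimes> t) \<otimes> (h \<otimes> h)" unfolding hc(2) using hc(1) tc by (simp add: m_assoc)
          finally show ?thesis using tt hc(3) by simp
        qed
        moreover have "y \<noteq> \<one>"
        proof
          assume "y = \<one>"
          then have "t \<otimes> h = t \<otimes> t" using h(2) tt by simp
          then have "h = t" using hc(1) tc by (simp only: l_cancel)
          then show False using hc(5) by simp
        qed
        moreover have "y \<noteq> t" using h(2) hc tc by simp
        ultimately show "y \<in> P" by (simp add: P_def)
      qed
      have disjoint: "S \<inter> (\<otimes>) t ` S = {}"
      proof -
        have False if y: "y \<in> S" "y \<in> (\<otimes>) t ` S" for y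
        proof -
          obtain k where k: "k \<in> F" "y = inv w \<otimes> k" using y(1) by (auto simp: S_def)
          obtain l where l: "l \<in> F" "y = t \<otimes> (inv w \<otimes> l)" using y(2) by (auto simp: S_def)
          have lc: "inv w \<otimes> l \<in> carrier G" "inv w \<otimes> l \<in> cent t" using h[OF l(1)] cent_closed by auto
          have "inv w \<otimes> k = (inv w \<otimes> l) \<otimes> t" using k(2) l(2) lc by (simp add: cent_def)
          then have "w \<otimes> (inv w \<otimes> k) = w \<otimes> ((inv w \<otimes> l) \<otimes> t)" by simp
          then have kl: "k = l \<otimes> t" using Fk(3)[OF k(1)] Fk(3)[OF l(1)] w tc by (simp add: m_assoc)
          have "t \<otimes> (l \<otimes> t) \<otimes> inv t \<in> K" unfolding kl[symmetric] by (rule conj_K[OF Fk(1)[OF k(1)] tc])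
          moreover have "t \<otimes> (l \<otimes> t) \<otimes> inv t = t \<otimes> l" using tc Fk(3)[OF l(1)] by (simp add: m_assoc)
          ultimately show False using Fk(2)[OF l(1)] disj by auto
        qed
        then show ?thesis by blast
      qed
      have SC: "S \<subseteq> carrier G" using SP cent_closed by (auto simp: P_def)
      have "card (S \<union> (\<otimes>) t ` S) \<le> card P" using SP TP finP by (intro card_mono) auto
      moreover have "card (S \<union> (\<otimes>) t ` S) = card S + card ((\<otimes>) t ` S)"
        using disjoint finF by (intro card_Un_disjoint) (auto simp: S_def)
      moreover have "inj_on ((\<otimes>) t) S" using SC tc by (auto simp: inj_on_def subset_iff)
      then have "card ((\<otimes>) t ` S) = card S" by (rule card_image)
      moreover have "inj_on ((\<otimes>) (inv w)) F" using Fk(3) w by (auto simp: inj_on_def)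
      then have "card S = card F" unfolding S_def by (rule card_image)
      ultimately show ?thesis by simp
    qed
    have fib: "2 * card {k \<in> Kb. k \<otimes> t \<otimes> inv k = s} \<le> card P" if s: "s \<in> Q" for s
    proof -
      let ?F = "{k \<in> Kb. k \<otimes> t \<otimes> inv k = s}"
      have sI: "s \<in> I" and sC: "s \<notin> cent t" using s by (auto simp: Q_def)
      note sc = I(1)[OF sI]
      have st: "s \<noteq> t" using sC cent_self[OF tc] by auto
      let ?w = "t \<otimes> s"
      have wc: "?w \<in> carrier G" using tc sc by simp
      have "s \<otimes> t \<otimes> s \<in> I" using conj_in_I[OF tI sc] I(2)[OF sI] sc by (simp add: inv_equality)
      have tst: "t \<otimes> s \<otimes> t \<in> I" using conj_in_I[OF sI tc] it by simp
      have tstst: "t \<otimes> s \<otimes> t \<otimes> s \<otimes> t \<in> I"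
      proof -
        have "(t \<otimes> s) \<otimes> t \<otimes> inv (t \<otimes> s) \<in> I" by (rule conj_in_I[OF tI wc])
        then show ?thesis unfolding w_inv[OF sI] using tc sc by (simp add: m_assoc)
      qed
      show ?thesis
      proof (cases "\<exists>k\<in>?F. t \<otimes> k \<in> Z")
        case True
        then obtain a where a: "a \<in> ?F" "t \<otimes> a \<in> Z" by blast
        then have w3: "?w [^] (3::nat) = \<one>" using oct(1)[of a s] by (auto simp: Kb_def)
        have allZ: "t \<otimes> k \<in> Z" if k: "k \<in> ?F" for k
        proof (rule ccontr)
          assume "t \<otimes> k \<notin> Z"
          then have "t \<otimes> k \<in> Y" "k \<in> K" using k by (auto simp: Kb_def)
          then have w5: "?w [^] (5::nat) = \<one>" using ico(1)[of k s] k by auto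
          have "?w [^] (6::nat) = (?w [^] (3::nat)) [^] (2::nat)" using wc by (simp add: nat_pow_pow)
          then have "?w [^] (6::nat) = \<one>" using w3 by simp
          moreover have "?w [^] (6::nat) = ?w [^] (5::nat) \<otimes> ?w" using nat_pow_Suc[of ?w 5] by simp
          ultimately have "?w = \<one>" using w5 wc by simp
          then have "t \<otimes> s = t \<otimes> t" using tt by simp
          then have "s = t" using tc sc by (simp only: l_cancel)
          then show False using st by simp
        qed
        show ?thesis
        proof (rule half[of ?F ?w])
          show "t \<otimes> ?w \<in> I" using tt' sc sI by simp
          show "?w \<otimes> t \<in> I" by (rule tst)
          fix k assume k: "k \<in> ?F"
          then show "inv ?w \<otimes> k \<in> cent t \<and> (inv ?w \<otimes> k) \<otimes> (inv ?w \<otimes> k) = \<one>"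
            using oct(2,3)[of k s] allZ[OF k] by (auto simp: Kb_def)
        qed (use wc in auto)
      next
        case False
        show ?thesis
        proof (rule half[of ?F "?w \<otimes> ?w"])
          show "t \<otimes> (?w \<otimes> ?w) \<in> I" using tt' tc sc \<open>s \<otimes> t \<otimes> s \<in> I\<close> by (simp add: m_assoc)
          show "?w \<otimes> ?w \<otimes> t \<in> I" using tstst tc sc by (simp add: m_assoc)
          fix k assume k: "k \<in> ?F"
          then have "t \<otimes> k \<in> Y" "k \<in> K" using False by (auto simp: Kb_def)
          then show "inv (?w \<otimes> ?w) \<otimes> k \<in> cent t \<and> (inv (?w \<otimes> ?w) \<otimes> k) \<otimes> (inv (?w \<otimes> ?w) \<otimes> k) = \<one>"
            using ico(2,3)[of k s] k by auto
        qed (use wc in auto)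
      qed
    qed
    have im: "(\<lambda>k. k \<otimes> t \<otimes> inv k) ` Kb \<subseteq> Q"
    proof
      fix s assume "s \<in> (\<lambda>k. k \<otimes> t \<otimes> inv k) ` Kb"
      then obtain k where k: "k \<in> Kb" "s = k \<otimes> t \<otimes> inv k" by blast
      have kK: "k \<in> K" "t \<otimes> k \<in> Z \<or> t \<otimes> k \<in> Y" using k by (auto simp: Kb_def)
      have sI: "s \<in> I" unfolding k(2) by (rule conj_in_I[OF tI K(1)[OF kK(1)]])
      have "s \<noteq> t" using kt[OF kK(1)] k(2) by simp
      moreover have "(t \<otimes> s) [^] (3::nat) = \<one> \<or> (t \<otimes> s) [^] (5::nat) = \<one>"
        using kK(2) oct(1)[OF kK(1) _ k(2)] ico(1)[OF kK(1) _ k(2)] by blast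
      ultimately have "s \<notin> cent t" using nocomm[OF sI, of 3] nocomm[OF sI, of 5] by auto
      then show "s \<in> Q" using sI by (simp add: Q_def)
    qed
    have "card Kb = (\<Sum>s\<in>Q. card {k \<in> Kb. k \<otimes> t \<otimes> inv k = s})"
      by (rule card_eq_sum_fibres[OF finK(2) finQ im])
    then have "2 * card Kb = (\<Sum>s\<in>Q. 2 * card {k \<in> Kb. k \<otimes> t \<otimes> inv k = s})" by (simp add: sum_distrib_left)
    also have "\<dots> \<le> (\<Sum>s\<in>Q. card P)" by (rule sum_mono) (rule fib)
    finally show ?thesis by simp
  qed
  have Kr_le: "card Kr \<le> card R"
  proof (rule card_inj_on_le)
    show "inj_on ((\<otimes>) t) Kr" using tc K(1) by (auto simp: inj_on_def Kr_def)
  qed (use fin in \<open>auto simp: Kr_def\<close>)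
  have "K \<subseteq> Ka \<union> Kb \<union> Kr"
  proof
    fix k assume k: "k \<in> K"
    then have "t \<otimes> k \<in> carrier G" using K(1) tc by simp
    from KZY_R[OF this] show "k \<in> Ka \<union> Kb \<union> Kr" using k by (auto simp: Ka_def Kb_def Kr_def)
  qed
  then have "card K \<le> card (Ka \<union> Kb \<union> Kr)" using finK by (intro card_mono) auto
  also have "\<dots> \<le> card Ka + card Kb + card Kr"
    using card_Un_le[of "Ka \<union> Kb" Kr] card_Un_le[of Ka Kb] by linarith
  finally have 1: "card K \<le> card Ka + card Kb + card Kr" .
  have "card Q * (2 * card P) = 2 * (card Q * card P)" by simp
  then have "4 * card Kb \<le> card Q * (2 * card P)" using Kb_le by linarith
  also have "\<dots> \<le> card Q * (c + 2)" using P_le by (rule mult_le_mono2)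
  finally have 2: "4 * card Kb \<le> card Q * (c + 2)" .
  define i where "i = int (card I)"
  define d where "d = int c"
  have n: "int (order G) = i * d" using nI by (simp add: i_def d_def flip: of_nat_mult)
  have "4 * int (card K) \<le> int (card J1) * d + 4 * d + int (card Q) * (d + 2) + 4 * int (card R)"
  proof -
    have "4 * card K \<le> card J1 * c + 4 * c + card Q * (c + 2) + 4 * card R"
      using 1 2 Ka_le Kr_le by linarith
    then have "int (4 * card K) \<le> int (card J1 * c + 4 * c + card Q * (c + 2) + 4 * card R)" by (simp only: of_nat_le_iff)
    then show ?thesis by (simp add: d_def algebra_simps)
  qed
  moreover have "int (card Q) * 2 \<le> 2 * (i - 1)" using split_I by (simp add: i_def)
  moreover have "int (card J1) * d + int (card Q) * d = (i - 1) * d"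
    using split_I unfolding i_def by (simp add: distrib_right[symmetric])
  ultimately have "4 * int (card K) \<le> (i - 1) * d + 4 * d + 2 * (i - 1) + 4 * int (card R)"
    by (simp add: algebra_simps)
  moreover have "3 * int (card K) = i * d" using cards(1) n by linarith
  moreover have "60 * int (card R) = i * d" using card_R n by linarith
  ultimately have "19 * (i * d) \<le> 15 * (i * d) + 45 * d + 30 * i" by (simp add: algebra_simps)
  \<comment> \<open>With the previous inequality, \<open>4 i d \<le> 45 d + 30 i\<close>, this gives \<open>15 d \<le> 450\<close>.\<close>
  moreover have "(i - 15) * (4 * d - 30) \<ge> 0"
    using I15 c60 by (intro mult_nonneg_nonneg) (simp_all add: i_def d_def)
  ultimately show False using c60 by (simp add: algebra_simps d_def)
qed

theorem iso_alt_5: "G \<cong> alt_group 5"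
proof -
  have "z \<otimes> z = \<one>" using order_4_impossible by blast
  then show ?thesis using order_60_iso involution_imp_order_60 by blast
qed

end

section \<open>Groups of large conjugacy probability\<close>

context finite_grp
begin

abbreviation inv_cent_sum :: "'a set \<Rightarrow> real" where
  "inv_cent_sum A \<equiv> \<Sum>g\<in>A. 1 / real (card (cent g))"

lemma inv_cent_sum_le:
  assumes "A \<subseteq> carrier G" "m > 0" "\<And>g. g \<in> A \<Longrightarrow> card (cent g) \<ge> m"
  shows "inv_cent_sum A \<le> real (card A) / real m"
proof -
  have "inv_cent_sum A \<le> (\<Sum>g\<in>A. 1 / real m)"
    using assms by (intro sum_mono divide_left_mono mult_pos_pos) (auto simp: card_cent_pos subset_iff)
  then show ?thesis by simp
qed

lemma inv_cent_sum_cl: "g \<in> carrier G \<Longrightarrow> inv_cent_sum (cl g) = real (order G) / real (card (cent g)) ^ 2"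
proof -
  assume g: "g \<in> carrier G"
  have "inv_cent_sum (cl g) = (\<Sum>h\<in>cl g. 1 / real (card (cent g)))"
    using card_cent_cl[OF g] by (intro sum.cong) auto
  then show ?thesis using real_card_cl[OF g] by (simp add: power2_eq_square)
qed

lemma inv_cent_sum_insert_one:
  assumes "A \<subseteq> carrier G" "\<one> \<in> A" "m > 0" "\<And>g. g \<in> A \<Longrightarrow> g \<noteq> \<one> \<Longrightarrow> card (cent g) \<ge> m"
  shows "inv_cent_sum A \<le> 1 / real (order G) + (real (card A) - 1) / real m"
proof -
  have finA: "finite A" using assms(1) finite_subset by blast
  have "inv_cent_sum A = 1 / real (card (cent \<one>)) + inv_cent_sum (A - {\<one>})"
    by (rule sum.remove[OF finA assms(2)])
  also have "inv_cent_sum (A - {\<one>}) \<le> real (card (A - {\<one>})) / real m"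
    by (rule inv_cent_sum_le) (use assms in auto)
  also have "real (card (A - {\<one>})) = real (card A) - 1"
  proof -
    have "card (A - {\<one>}) + 1 = card A" using finA assms(2) by (metis Suc_eq_plus1 card.remove)
    then show ?thesis by linarith
  qed
  finally show ?thesis by (simp add: cent_of_one order_def)
qed

text \<open>
  If all other elements had centralizers of order at least 13, then so would the identity, and the average of \<open>1 / c\<close>
  over \<open>A\<close> would be at most \<open>1 / 13\<close>.
\<close>

lemma exists_small_cent:
  assumes A: "A \<subseteq> carrier G" "\<one> \<in> A" "card A > 1" and s: "inv_cent_sum A > real (card A) / 13"
  shows "\<exists>a\<in>A. a \<noteq> \<one> \<and> card (cent a) \<le> 12"
proof (rule ccontr)
  assume "\<not> ?thesis"
  then have c: "card (cent a) \<ge> 13" if "a \<in> A" "a \<noteq> \<one>" for a using that by force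
  have "A \<noteq> {\<one>}" using A(3) by auto
  then obtain a where a: "a \<in> A" "a \<noteq> \<one>" using A(2) by blast
  have "13 \<le> order G" using c[OF a] card_cent_le[of a] by linarith
  then have "1 / real (order G) \<le> 1 / 13" by (simp add: field_simps)
  moreover have "inv_cent_sum A \<le> 1 / real (order G) + (real (card A) - 1) / real 13"
    by (rule inv_cent_sum_insert_one) (use A c in auto)
  ultimately show False using s by (simp add: field_simps)
qed

text \<open>
  The sum of \<open>1 / c(g)\<close> over the group is at least \<open>n / 4\<close>, where \<open>n\<close> is the order. Each
  class that is found takes its share \<open>n / c\<^sup>2\<close>, and what is left for the remaining elements forces the next
  small centralizer: \<open>n / 36\<close> for \<open>n / 3\<close> elements after a non-real pair with \<open>c = 3\<close>;
  \<open>5 n / 36\<close> for \<open>2 n / 3\<close> elements after a real class with \<open>c = 3\<close>; \<open>11 n /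
  144\<close> for \<open>5 n / 12\<close> elements after one more class with \<open>c = 4\<close>; and so on. In each case the
  average of \<open>1 / c\<close> over the rest is compared with \<open>1 / 4\<close>, \<open>1 / 5\<close>, \<open>1 / 6\<close>
  or \<open>1 / 13\<close>.
\<close>

theorem kappa_classification:
  assumes kappa: "kappa G \<ge> 1 / 4" and n4: "order G > 4"
  shows "G \<cong> alt_group 4 \<or> G \<cong> sym_group 4 \<or> G \<cong> alt_group 5 \<or> G \<cong> frobenius21 \<or>
    (\<exists>A :: 'a monoid. comm_group A \<and> finite (carrier A) \<and> odd (order A) \<and> 2 * order A = order G \<and>
       G \<cong> inversion_extension A)"
proof -
  define n where "n = real (order G)"
  have n0: "n > 4" using n4 by (simp add: n_def)
  have S: "inv_cent_sum (carrier G) \<ge> n / 4"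
    using kappa n0 unfolding kappa_sum n_def[symmetric] by (simp add: field_simps)
  have c2: "card (cent g) \<ge> 2" if g: "g \<in> carrier G" for g
  proof (rule ccontr)
    assume "\<not> ?thesis"
    then have "card (cent g) = 1" using card_cent_pos[OF g] by linarith
    then have "g = \<one>" using cent_self[OF g] cent_one[OF g] by (metis card_1_singletonE singletonD)
    then show False using \<open>card (cent g) = 1\<close> n4 by (simp add: cent_of_one order_def)
  qed
  show ?thesis
  proof (cases "\<exists>g\<in>carrier G. card (cent g) = 2")
    case True
    then obtain t where "t \<in> carrier G" "card (cent t) = 2" by blast
    then show ?thesis using centralizer_order_2_imp_inversion_extension[of t] n4 by simp
  next
    case no2: False
    then have c3: "card (cent g) \<ge> 3" if "g \<in> carrier G" for g using c2[OF that] that by force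
    have "\<exists>g\<in>carrier G. card (cent g) = 3"
    proof (rule ccontr)
      assume "\<not> ?thesis"
      then have c4: "card (cent g) \<ge> 4" if "g \<in> carrier G" for g using c3[OF that] that by force
      have "inv_cent_sum (carrier G) \<le> 1 / real (order G) + (real (card (carrier G)) - 1) / real 4"
        by (rule inv_cent_sum_insert_one) (use c4 in auto)
      then have "inv_cent_sum (carrier G) \<le> 1 / n + (n - 1) / 4" by (simp add: n_def order_def)
      then have "n / 4 \<le> 1 / n + (n - 1) / 4" using S by linarith
      moreover have "1 / n < 1 / 4" using n0 by (simp add: field_simps)
      ultimately show False by (simp add: field_simps)
    qed
    then obtain x where x: "x \<in> carrier G" "card (cent x) = 3" by blast
    have Kx: "3 * card (cl x) = order G" using card_cl[OF x(1)] x by simp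
    have SK: "inv_cent_sum (cl x) = n / 9" using inv_cent_sum_cl[OF x(1)] x by (simp add: n_def)
    have one_cent: "card (cent \<one>) > 4" using n4 by (simp add: cent_of_one order_def)
    show ?thesis
    proof (cases "inv x \<in> cl x")
      case False
      interpret N: nonreal_3 G x by unfold_locales (use x n4 False in auto)
      have un: "carrier G = N.K \<union> (N.L \<union> N.N)" using N.K_carrier N.L_carrier by (auto simp: N.N_def)
      have "inv_cent_sum (carrier G) = inv_cent_sum N.K + (inv_cent_sum N.L + inv_cent_sum N.N)"
      proof -
        have "inv_cent_sum (N.L \<union> N.N) = inv_cent_sum N.L + inv_cent_sum N.N"
          by (rule sum.union_disjoint) (use N.fin in \<open>auto simp: N.N_def\<close>)
        moreover have "inv_cent_sum (N.K \<union> (N.L \<union> N.N)) = inv_cent_sum N.K + inv_cent_sum (N.L \<union> N.N)"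
          by (rule sum.union_disjoint) (use N.fin N.KL_disjoint in \<open>auto simp: N.N_def\<close>)
        ultimately show ?thesis unfolding un by simp
      qed
      moreover have "inv_cent_sum N.K = n / 9" using SK by (simp add: N.K_def)
      moreover have "inv_cent_sum N.L = n / 9"
        using inv_cent_sum_cl[of "inv x"] nonreal_3.cent_x[OF N.nonreal_3_inv] x by (simp add: N.L_def n_def)
      ultimately have SN: "inv_cent_sum N.N \<ge> n / 36" using S by (simp add: field_simps)
      have cN: "3 * card N.N = order G" using N.card_KLN by simp
      have "real (card N.N) = n / 3" using cN by (simp add: n_def flip: of_nat_mult)
      then have "real (card N.N) / 13 < inv_cent_sum N.N" using SN n0 by (simp add: field_simps)
      moreover have "card N.N > 1" using cN n4 by linarith
      ultimately obtain a where "a \<in> N.N" "a \<noteq> \<one>" "card (cent a) \<le> 12"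
        using exists_small_cent[OF N.N_carrier subgroup.one_closed[OF N.N_subgroup]] by blast
      then have "order G = 12 \<or> order G = 21" by (rule N.small_centralizer_classification)
      then show ?thesis using N.order_12_iso N.order_21_iso by blast
    next
      case real: True
      have inK: "g \<in> cl x" if g: "g \<in> carrier G" "card (cent g) = 3" for g
      proof -
        have "g \<noteq> \<one>" "g \<otimes> g = inv g" using cent_order_3[OF g] n4 by auto
        then have "g \<in> cl x \<or> g \<in> cl (inv x)" by (rule order_3_conjugate[OF x _ g(1), rotated]) (use n4 in simp)
        then show ?thesis using cl_eq[OF x(1) real] by simp
      qed
      define U where "U = carrier G - cl x"
      have U4: "card (cent g) \<ge> 4" if "g \<in> U" for g using that c3[of g] inK[of g] by (force simp: U_def)
      have cU: "real (card U) = 2 * n / 3"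
      proof -
        have "card U + card (cl x) = order G"
          using cl_sub[OF x(1)] by (simp add: U_def order_def card_Diff_subset card_mono)
        then have "3 * card U = 2 * order G" using Kx by linarith
        then have "3 * real (card U) = 2 * n" unfolding n_def by (metis of_nat_mult of_nat_numeral)
        then show ?thesis by simp
      qed
      have Usub: "U \<subseteq> carrier G" by (auto simp: U_def)
      have remove: "inv_cent_sum (B - cl g) = inv_cent_sum B - n / real (card (cent g)) ^ 2 \<and>
          real (card (B - cl g)) = real (card B) - n / real (card (cent g))"
        if B: "B \<subseteq> carrier G" "cl g \<subseteq> B" and g: "g \<in> carrier G" for B g
      proof -
        have finB: "finite B" using B finite_subset by blast
        have "card (B - cl g) + card (cl g) = card B"
          using card_Diff_subset[OF finite_cl B(2)] card_mono[OF finB B(2)] by linarith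
        then show ?thesis
          using sum.subset_diff[OF B(2) finB, of "\<lambda>g. 1 / real (card (cent g))"] inv_cent_sum_cl[OF g] real_card_cl[OF g]
          by (simp add: n_def)
      qed
      have SU: "inv_cent_sum U \<ge> 5 * n / 36"
        using remove[of "carrier G" x] cl_sub[OF x(1)] x S by (simp add: U_def field_simps)
      have clU: "cl g \<subseteq> carrier G - cl x" if "g \<in> carrier G" "card (cent g) \<noteq> 3" for g
      proof -
        have "g \<notin> cl x" using card_cent_cl[OF x(1), of g] x that by auto
        then show ?thesis using cl_disjoint[OF x(1) that(1)] cl_sub[OF that(1)] by blast
      qed
      have "\<exists>z\<in>U. card (cent z) = 4"
      proof (rule ccontr)
        assume "\<not> ?thesis"
        then have "card (cent g) \<ge> 5" if "g \<in> U" for g using U4[OF that] that by force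
        then have "inv_cent_sum U \<le> real (card U) / real 5" by (intro inv_cent_sum_le[OF Usub]) auto
        then show False using SU cU n0 by (simp add: field_simps)
      qed
      then obtain z where z: "z \<in> carrier G" "card (cent z) = 4" by (auto simp: U_def)
      define W where "W = U - cl z"
      have Wsub: "W \<subseteq> carrier G" by (auto simp: W_def U_def)
      have W: "inv_cent_sum W \<ge> 11 * n / 144" "real (card W) = 5 * n / 12"
        using remove[OF Usub _ z(1)] clU[OF z(1)] z SU cU unfolding W_def by (auto simp: U_def field_simps)
      have not_in: "g \<notin> cl h" if "g \<in> carrier G" "h \<in> carrier G" "card (cent g) \<noteq> card (cent h)" for g h
        using card_cent_cl[OF that(2), of g] that(3) by auto
      show ?thesis
      proof (cases "\<exists>w\<in>carrier G. card (cent w) = 4 \<and> w \<notin> cl z")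
        case True
        then obtain w where w: "w \<in> carrier G" "card (cent w) = 4" "w \<notin> cl z" by blast
        define R where "R = W - cl w"
        have "cl w \<subseteq> W" using clU[OF w(1)] w cl_disjoint[OF z(1) w(1,3)] by (auto simp: W_def U_def)
        then have R: "inv_cent_sum R \<ge> n / 72" "real (card R) = n / 6"
          using remove[OF Wsub _ w(1)] w W unfolding R_def by (auto simp: field_simps)
        have Rsub: "R \<subseteq> carrier G" using Wsub by (auto simp: R_def)
        have one: "\<one> \<in> R" using not_in[of \<one>] x z w one_cent by (auto simp: R_def W_def U_def)
        have "12 dvd order G"
        proof -
          have "4 * card (cl z) = order G" using card_cl[OF z(1)] z by simp
          then show ?thesis using Kx by presburger
        qed
        then have "order G \<ge> 12" using order_pos by (intro dvd_imp_le) auto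
        then have "card R > 1" using R(2) by (simp add: n_def)
        moreover have "real (card R) / 13 < inv_cent_sum R" using R n0 by (simp add: field_simps)
        ultimately obtain a where a: "a \<in> R" "a \<noteq> \<one>" "card (cent a) \<le> 12" using exists_small_cent[OF Rsub one] by blast
        have "G \<cong> sym_group 4"
          by (rule two_classes_4_imp_sym_group[OF x real n4 z w(1,2,3), of a]) (use a in \<open>auto simp: R_def W_def U_def\<close>)
        then show ?thesis by blast
      next
        case False
        then have W5: "card (cent g) \<ge> 5" if "g \<in> W" for g using that U4[of g] by (force simp: W_def U_def)
        have "\<exists>u\<in>W. card (cent u) = 5"
        proof (rule ccontr)
          assume "\<not> ?thesis"
          then have "card (cent g) \<ge> 6" if "g \<in> W" for g using W5[OF that] that by force
          then have "inv_cent_sum W \<le> real (card W) / real 6" by (intro inv_cent_sum_le[OF Wsub]) auto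
          then show False using W n0 by (simp add: field_simps)
        qed
        then obtain u where u: "u \<in> W" "card (cent u) = 5" by blast
        have uc: "u \<in> carrier G" using u Wsub by blast
        have clu: "cl u \<subseteq> W"
          using clU[OF uc] cl_disjoint[OF z(1) uc] u by (auto simp: W_def U_def)
        have "\<exists>v\<in>W - cl u. card (cent v) = 5"
        proof (rule ccontr)
          assume "\<not> ?thesis"
          then have "card (cent g) \<ge> 6" if "g \<in> W - cl u" for g using W5[of g] that by force
          then have "inv_cent_sum (W - cl u) \<le> real (card (W - cl u)) / real 6"
            using Wsub by (intro inv_cent_sum_le) auto
          moreover have "inv_cent_sum (W - cl u) \<ge> 11 * n / 144 - n / 25" "real (card (W - cl u)) = 5 * n / 12 - n / 5"
            using remove[OF Wsub clu uc] u W by simp_all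
          ultimately show False using n0 by (simp add: field_simps)
        qed
        then obtain v where v: "v \<in> carrier G" "card (cent v) = 5" "v \<notin> cl u" using Wsub by blast
        interpret C: classes_3455 G x z u v
          by unfold_locales (use x z uc u v in auto)
        show ?thesis using C.iso_alt_5 by blast
      qed
    qed
  qed
qed

end

section \<open>Lower bounds for the conjugacy probability\<close>

lemma (in finite_grp) kappa_ge_representatives:
  assumes R: "finite R" "R \<subseteq> carrier G" and nc: "\<And>g h. g \<in> R \<Longrightarrow> h \<in> R \<Longrightarrow> g \<noteq> h \<Longrightarrow> h \<notin> cl g"
    and c: "\<And>g. g \<in> R \<Longrightarrow> card (cent g) \<le> c g"
  shows "kappa G \<ge> (\<Sum>g\<in>R. 1 / real (c g) ^ 2)"
proof -
  have n: "real (order G) > 0" using order_pos by simp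
  have "(\<Sum>g\<in>R. real (order G) / real (c g) ^ 2) \<le> (\<Sum>g\<in>R. inv_cent_sum (cl g))"
  proof (rule sum_mono)
    fix g assume g: "g \<in> R"
    then have gc: "g \<in> carrier G" using R by blast
    have "real (card (cent g)) ^ 2 \<le> real (c g) ^ 2" using c[OF g] by (intro power_mono) auto
    then show "real (order G) / real (c g) ^ 2 \<le> inv_cent_sum (cl g)"
      unfolding inv_cent_sum_cl[OF gc] using n card_cent_pos[OF gc] c[OF g]
      by (intro divide_left_mono mult_pos_pos zero_less_power) auto
  qed
  also have "\<dots> = inv_cent_sum (\<Union>g\<in>R. cl g)"
    using R nc cl_disjoint by (intro sum.UNION_disjoint[symmetric]) (auto simp: subset_iff)
  also have "\<dots> \<le> inv_cent_sum (carrier G)"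
    using R cl_sub by (intro sum_mono2) auto
  finally have "(\<Sum>g\<in>R. 1 / real (c g) ^ 2) * real (order G) \<le> inv_cent_sum (carrier G)"
    by (simp add: sum_distrib_right)
  then show ?thesis unfolding kappa_sum using n by (simp add: field_simps)
qed

lemma (in finite_grp) kappa_ge_inverse_order: "kappa G \<ge> 1 / real (order G)"
proof -
  have n: "real (order G) > 0" using order_pos by simp
  have "(\<Sum>g\<in>carrier G. 1 / real (order G)) \<le> inv_cent_sum (carrier G)"
    using card_cent_le card_cent_pos n by (intro sum_mono divide_left_mono mult_pos_pos) auto
  then have "1 \<le> inv_cent_sum (carrier G)" using n by (auto simp: order_def split: if_splits)
  then show ?thesis unfolding kappa_sum using n by (simp add: field_simps)
qed

lemma kappa_iso:
  assumes "finite_grp G" "group H" and iso: "G \<cong> H"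
  shows "kappa G = kappa H"
proof -
  interpret G: finite_grp G by fact
  interpret H: group H by fact
  obtain f where f: "f \<in> iso G H" using iso by (auto simp: is_iso_def)
  have hom: "f (a \<otimes>\<^bsub>G\<^esub> b) = f a \<otimes>\<^bsub>H\<^esub> f b" if "a \<in> carrier G" "b \<in> carrier G" for a b
    using f that by (auto simp: iso_def hom_def)
  have bij: "bij_betw f (carrier G) (carrier H)" using f by (simp add: iso_def)
  then have inj: "inj_on f (carrier G)" and im: "f ` carrier G = carrier H" by (auto simp: bij_betw_def)
  interpret H: finite_grp H by unfold_locales (use im G.finite_carrier in \<open>metis finite_imageI\<close>)
  have "card (H.cent (f g)) = card (G.cent g)" if g: "g \<in> carrier G" for g
  proof -
    have "H.cent (f g) = f ` G.cent g"
    proof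
      show "f ` G.cent g \<subseteq> H.cent (f g)"
        using g hom im by (auto simp: G.cent_def H.cent_def) (metis hom)
      show "H.cent (f g) \<subseteq> f ` G.cent g"
      proof
        fix y assume y: "y \<in> H.cent (f g)"
        then obtain h where h: "h \<in> carrier G" "y = f h" using im by (auto simp: H.cent_def)
        then have "f (h \<otimes>\<^bsub>G\<^esub> g) = f (g \<otimes>\<^bsub>G\<^esub> h)" using y g hom by (simp add: H.cent_def)
        then have "h \<otimes>\<^bsub>G\<^esub> g = g \<otimes>\<^bsub>G\<^esub> h" using inj_onD[OF inj] h g by simp
        then show "y \<in> f ` G.cent g" using h by (auto simp: G.cent_def)
      qed
    qed
    then show ?thesis using card_image[OF inj_on_subset[OF inj G.cent_sub]] by simp
  qed
  then have "G.inv_cent_sum (carrier G) = H.inv_cent_sum (carrier H)"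
    using sum.reindex_bij_betw[OF bij, of "\<lambda>h. 1 / real (card (H.cent h))"] by simp
  moreover have "order G = order H" using bij by (simp add: order_def bij_betw_same_card)
  ultimately show ?thesis unfolding G.kappa_sum H.kappa_sum by simp
qed

text \<open>
  The centralizer of the inverting involution has order 2, because no non-trivial element of a group of odd order equals its
  inverse. Its class alone contributes \<open>1/4\<close>.
\<close>

lemma kappa_inversion_extension:
  assumes "comm_group A" "finite (carrier A)" "odd (order A)"
  shows "kappa (inversion_extension A) \<ge> 1 / 4"
proof -
  interpret A: comm_group A by fact
  interpret E: group "inversion_extension A" by (rule group_inversion_extension) fact
  have carE: "carrier (inversion_extension A) = carrier A \<times> {0, 1}"
    by (auto simp: inversion_extension_def semidirect_product_def carrier_integer_mod_group)
  interpret E: finite_grp "inversion_extension A"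
    by unfold_locales (use assms in \<open>simp add: carE\<close>)
  have mult: "(a, k) \<otimes>\<^bsub>inversion_extension A\<^esub> (b, l) = (a \<otimes>\<^bsub>A\<^esub> inversion_action A k b, (k + l) mod 2)" for a b k l
    by (simp add: inversion_extension_def semidirect_product_def)
  have sq: "b = \<one>\<^bsub>A\<^esub>" if b: "b \<in> carrier A" "b \<otimes>\<^bsub>A\<^esub> b = \<one>\<^bsub>A\<^esub>" for b
  proof -
    obtain m where m: "order A = 2 * m + 1" using assms(3) by (elim oddE)
    have "b [^]\<^bsub>A\<^esub> (2 * m + 1) = \<one>\<^bsub>A\<^esub>" using A.pow_order_eq_1[OF b(1)] m by simp
    moreover have "b [^]\<^bsub>A\<^esub> (2::nat) = \<one>\<^bsub>A\<^esub>" using b by (simp add: numeral_2_eq_2)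
    then have "b [^]\<^bsub>A\<^esub> (2 * m + 1) = b"
      using b(1) by (simp add: A.nat_pow_mult[symmetric] A.nat_pow_pow[symmetric])
    ultimately show ?thesis by simp
  qed
  let ?t = "(\<one>\<^bsub>A\<^esub>, 1) :: 'a \<times> int"
  have "E.cent ?t \<subseteq> {(\<one>\<^bsub>A\<^esub>, 0), ?t}"
  proof
    fix y assume y: "y \<in> E.cent ?t"
    then obtain b l where bl: "y = (b, l)" "b \<in> carrier A" "l = 0 \<or> l = 1" by (auto simp: E.cent_def carE)
    have "y \<otimes>\<^bsub>inversion_extension A\<^esub> ?t = ?t \<otimes>\<^bsub>inversion_extension A\<^esub> y" using y by (simp add: E.cent_def)
    then have "b = inv\<^bsub>A\<^esub> b" using bl unfolding bl(1) mult by (auto simp: inversion_action_def)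
    then have "b \<otimes>\<^bsub>A\<^esub> b = \<one>\<^bsub>A\<^esub>" using bl by (metis A.r_inv)
    then have "b = \<one>\<^bsub>A\<^esub>" by (rule sq[OF bl(2)])
    then show "y \<in> {(\<one>\<^bsub>A\<^esub>, 0), ?t}" using bl by auto
  qed
  then have "card (E.cent ?t) \<le> card {(\<one>\<^bsub>A\<^esub>, 0), ?t}" by (intro card_mono) auto
  then have "card (E.cent ?t) \<le> 2" by simp
  then have "(\<Sum>g\<in>{?t}. 1 / real 2 ^ 2) \<le> kappa (inversion_extension A)"
    by (intro E.kappa_ge_representatives) (auto simp: carE)
  then show ?thesis by simp
qed

text \<open>
  Two classes with centralizers of order 3, distinguished by the second component, and two with centralizers of order 7, since
  multiplication by 4 modulo 7 does not take 1 to 3: \<open>2/9 + 2/49 > 1/4\<close>.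
\<close>

lemma kappa_C7_C3: "kappa C7_C3 \<ge> 1 / 4"
proof -
  interpret C: group C7_C3 by (rule group_C7_C3)
  interpret C: finite_grp C7_C3 by unfold_locales (simp add: C7_C3_simps)
  have 3: "k = 0 \<or> k = 1 \<or> k = 2" if "k \<in> {0..<3}" for k :: int using that by auto
  have c1: "card (C.cent (0, k)) \<le> 3" if k: "k = 1 \<or> k = 2" for k
  proof -
    have "C.cent (0, k) \<subseteq> {0} \<times> {0..<3}"
    proof
      fix y assume y: "y \<in> C.cent (0, k)"
      then obtain b l where bl: "y = (b, l)" "b \<in> {0..<7}" "l \<in> {0..<3}" by (auto simp: C.cent_def C7_C3_simps)
      have "y \<otimes>\<^bsub>C7_C3\<^esub> (0, k) = (0, k) \<otimes>\<^bsub>C7_C3\<^esub> y" using y by (simp add: C.cent_def)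
      then have "b mod 7 = (4 ^ nat k * b mod 7) mod 7" unfolding bl(1) C7_C3_simps by simp
      moreover have "(4::int) ^ nat k = 4 \<or> (4::int) ^ nat k = 16" using k by auto
      ultimately have "b = 4 * b mod 7 \<or> b = 16 * b mod 7" using bl(2) by auto
      moreover have "b = 0 \<or> b = 1 \<or> b = 2 \<or> b = 3 \<or> b = 4 \<or> b = 5 \<or> b = 6" using bl(2) by auto
      ultimately have "b = 0" by (elim disjE; simp)
      then show "y \<in> {0} \<times> {0..<3}" using bl by simp
    qed
    then have "card (C.cent (0, k)) \<le> card ({0::int} \<times> {0..<3::int})" by (intro card_mono) auto
    then show ?thesis by simp
  qed
  have c2: "card (C.cent (a, 0)) \<le> 7" if a: "a = 1 \<or> a = 3" for a
  proof -
    have "C.cent (a, 0) \<subseteq> {0..<7} \<times> {0}"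
    proof
      fix y assume y: "y \<in> C.cent (a, 0)"
      then obtain b l where bl: "y = (b, l)" "b \<in> {0..<7}" "l \<in> {0..<3}" by (auto simp: C.cent_def C7_C3_simps)
      have "y \<otimes>\<^bsub>C7_C3\<^esub> (a, 0) = (a, 0) \<otimes>\<^bsub>C7_C3\<^esub> y" using y by (simp add: C.cent_def)
      then have "(b + 4 ^ nat l * a) mod 7 = (b + a) mod 7"
        unfolding bl(1) C7_C3_simps by (simp add: mod_simps add.commute)
      then have "(4 ^ nat l * a) mod 7 = a mod 7" by (simp add: mod_eq_dvd_iff)
      then have "l = 0" using 3[OF bl(3)] a by (elim disjE) simp_all
      then show "y \<in> {0..<7} \<times> {0}" using bl by simp
    qed
    then have "card (C.cent (a, 0)) \<le> card ({0..<7::int} \<times> {0::int})" by (intro card_mono) auto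
    then show ?thesis by simp
  qed
  have nc: "(c, 0) \<notin> C.cl (a, 0)" if ac: "a = 1 \<and> c = 3 \<or> a = 3 \<and> c = 1" for a c
  proof
    assume "(c, 0) \<in> C.cl (a, 0)"
    then obtain y where y: "y \<in> carrier C7_C3"
      "(c, 0) = y \<otimes>\<^bsub>C7_C3\<^esub> (a, 0) \<otimes>\<^bsub>C7_C3\<^esub> inv\<^bsub>C7_C3\<^esub> y" unfolding C.cl_def by blast
    obtain b l where bl: "y = (b, l)" "l \<in> {0..<3}" using y(1) by (auto simp: C7_C3_simps)
    have car: "(a, 0) \<in> carrier C7_C3" "(c, 0) \<in> carrier C7_C3" using ac by (auto simp: C7_C3_simps)
    have "(c, 0) \<otimes>\<^bsub>C7_C3\<^esub> y = y \<otimes>\<^bsub>C7_C3\<^esub> (a, 0)" using C.conj_eq_iff[OF y(1) car] y(2) by simp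
    then have "(b + c) mod 7 = (b + 4 ^ nat l * a) mod 7"
      unfolding bl(1) C7_C3_simps by (simp add: mod_simps add.commute)
    then have "c mod 7 = (4 ^ nat l * a) mod 7" by (simp add: mod_eq_dvd_iff)
    then show False using 3[OF bl(2)] ac by (elim disjE) simp_all
  qed
  have snd_cl: "snd h = snd g" if gh: "g \<in> carrier C7_C3" "h \<in> C.cl g" for g h
  proof -
    obtain y where y: "y \<in> carrier C7_C3" "h = y \<otimes>\<^bsub>C7_C3\<^esub> g \<otimes>\<^bsub>C7_C3\<^esub> inv\<^bsub>C7_C3\<^esub> y"
      using gh(2) unfolding C.cl_def by blast
    have hc: "h \<in> carrier C7_C3" using C.clD[OF gh] by blast
    have "h \<otimes>\<^bsub>C7_C3\<^esub> y = y \<otimes>\<^bsub>C7_C3\<^esub> g" using C.conj_eq_iff[OF y(1) gh(1) hc] y(2) by simp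
    then have "(snd h + snd y) mod 3 = (snd y + snd g) mod 3"
      by (cases h; cases y; cases g) (simp add: C7_C3_simps)
    then have "snd h mod 3 = snd g mod 3" by (simp add: mod_eq_dvd_iff)
    moreover have "0 \<le> snd h" "snd h < 3" "0 \<le> snd g" "snd g < 3" using hc gh(1) by (auto simp: C7_C3_simps)
    ultimately show ?thesis by simp
  qed
  let ?R = "{(0, 1), (0, 2), (1, 0), (3, 0)} :: (int \<times> int) set"
  define c :: "int \<times> int \<Rightarrow> nat" where "c = (\<lambda>g. if snd g = 0 then 7 else 3)"
  have "(\<Sum>g\<in>?R. 1 / real (c g) ^ 2) \<le> kappa C7_C3"
  proof (rule C.kappa_ge_representatives)
    show sub: "?R \<subseteq> carrier C7_C3" by (simp add: C7_C3_simps)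
    show "h \<notin> C.cl g" if "g \<in> ?R" "h \<in> ?R" "g \<noteq> h" for g h
    proof
      assume "h \<in> C.cl g"
      then have "snd h = snd g" using snd_cl[of g h] that(1) sub by blast
      then show False using that \<open>h \<in> C.cl g\<close> nc[of 1 3] nc[of 3 1] by auto
    qed
    show "card (C.cent g) \<le> c g" if "g \<in> ?R" for g
    proof -
      have "c (0, 1) = 3" "c (0, 2) = 3" "c (1, 0) = 7" "c (3, 0) = 7" by (simp_all add: c_def)
      then show ?thesis using that c1[of 1] c1[of 2] c2[of 1] c2[of 3] by (elim insertE emptyE) simp_all
    qed
  qed simp
  moreover have "(\<Sum>g\<in>?R. 1 / real (c g) ^ 2) = 1 / 9 + 1 / 9 + 1 / 49 + 1 / 49" by (simp add: c_def)
  ultimately show ?thesis by linarith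
qed

section \<open>Centralizers and conjugation in permutation groups\<close>

text \<open>
  Two permutations that agree off two points differ at most by the transposition of these points, and parity decides which.
\<close>

lemma permutes_eq_off_pair:
  assumes p: "p permutes S" and q: "q permutes S" and fin: "finite S"
    and eq: "\<And>x. x \<in> S - {a, b} \<Longrightarrow> p x = q x" and par: "a = b \<or> evenperm p = evenperm q"
  shows "p = q"
proof -
  have "inv' q \<circ> p permutes {a, b}"
  proof (rule permutes_superset)
    show "inv' q \<circ> p permutes S" using p permutes_inv[OF q] by (rule permutes_compose)
    show "(inv' q \<circ> p) x = x" if "x \<in> S - {a, b}" for x
      using eq[OF that] permutes_inverses(2)[OF q] by simp
  qed
  then consider "inv' q \<circ> p = id" | "inv' q \<circ> p = Transposition.transpose a b"
    unfolding permutes_doubleton_iff by blast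
  moreover have pq: "p = q \<circ> (inv' q \<circ> p)"
    using permutes_inv_o(1)[OF q] by (simp add: o_assoc)
  ultimately show ?thesis
  proof cases
    case 2
    then have pq: "p = q \<circ> Transposition.transpose a b" using pq by simp
    have "permutation q" using q fin permutation_permutes by blast
    then have "evenperm p = (evenperm q = (a = b))"
      using pq evenperm_comp[of q "Transposition.transpose a b"]
      by (simp add: permutation_swap_id evenperm_swap)
    then have "a = b" using par by blast
    then show ?thesis using pq by simp
  qed simp
qed

text \<open>
  A group of permutations of \<open>{1..n}\<close>, to treat symmetric and alternating groups alike.
\<close>

locale perm_group = finite_grp G for G :: "(nat \<Rightarrow> nat) monoid" (structure) +
  fixes n :: nat
  assumes mult_comp: "p \<otimes> q = p \<circ> q" and carrier_permutes: "p \<in> carrier G \<Longrightarrow> p permutes {1..n}"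
begin

text \<open>
  A permutation that commutes with \<open>\<sigma>\<close> is determined on a whole cycle of \<open>\<sigma>\<close> by its value
  at one point of the cycle. The function \<open>key\<close> records such values, and \<open>T\<close> is a set of possible
  records. Two points \<open>a\<close> and \<open>b\<close> may be left undetermined if all permutations in the group are even;
  \<open>a = b\<close> covers the general case.
\<close>

lemma card_cent_le_key:
  assumes \<sigma>: "\<sigma> \<in> carrier G"
    and T: "finite T" "\<And>h. \<lbrakk>h permutes {1..n}; \<And>x. h (\<sigma> x) = \<sigma> (h x)\<rbrakk> \<Longrightarrow> key h \<in> T"
    and key: "\<And>h h' x. \<lbrakk>h permutes {1..n}; h' permutes {1..n}; \<And>x. h (\<sigma> x) = \<sigma> (h x); \<And>x. h' (\<sigma> x) = \<sigma> (h' x); key h = key h';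
        x \<in> {1..n} - {a, b}\<rbrakk> \<Longrightarrow> h x = h' x"
    and par: "a = b \<or> (\<forall>p\<in>carrier G. evenperm p)"
  shows "card (cent \<sigma>) \<le> card T"
proof (rule card_inj_on_le)
  have comm: "h (\<sigma> x) = \<sigma> (h x)" if "h \<in> cent \<sigma>" for h x
    using that by (auto simp: cent_def mult_comp fun_eq_iff)
  have cc: "h \<in> carrier G" if "h \<in> cent \<sigma>" for h using that cent_sub by blast
  show "inj_on key (cent \<sigma>)"
  proof (rule inj_onI)
    fix h h' assume h: "h \<in> cent \<sigma>" "h' \<in> cent \<sigma>" "key h = key h'"
    show "h = h'"
    proof (rule permutes_eq_off_pair)
      show "h x = h' x" if "x \<in> {1..n} - {a, b}" for x
        by (rule key[OF _ _ _ _ h(3) that]) (use comm h cc carrier_permutes in auto)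
      show "a = b \<or> evenperm h = evenperm h'" using par cc[OF h(1)] cc[OF h(2)] by blast
    qed (use carrier_permutes cc h in auto)
  qed
  show "key ` cent \<sigma> \<subseteq> T"
  proof (rule image_subsetI)
    fix h assume h: "h \<in> cent \<sigma>"
    show "key h \<in> T" by (rule T(2)[OF carrier_permutes[OF cc[OF h]]]) (rule comm[OF h])
  qed
qed (rule T)

lemma clE:
  assumes "p \<in> carrier G" "q \<in> cl p"
  obtains y where "y \<in> carrier G" "\<And>x. q (y x) = y (p x)"
proof -
  obtain y where y: "y \<in> carrier G" "q = y \<otimes> p \<otimes> inv y" using assms(2) unfolding cl_def by blast
  then have "y \<otimes> p = q \<otimes> y" using conj_eq_iff[OF y(1) assms(1) clD[OF assms]] by simp
  then have "y \<circ> p = q \<circ> y" by (simp add: mult_comp)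
  then have "q (y x) = y (p x)" for x by (metis comp_apply)
  then show thesis using y(1) that by blast
qed

lemma not_conj_if_fixed_points:
  assumes "p \<in> carrier G" and "(\<Sum>x = 1..n. of_bool (q x = x)) \<noteq> (\<Sum>x = 1..n. of_bool (p x = x) :: nat)"
  shows "q \<notin> cl p"
proof
  assume "q \<in> cl p"
  then obtain y where y: "y \<in> carrier G" "\<And>x. q (y x) = y (p x)" using clE[OF assms(1)] by metis
  have "(\<Sum>x = 1..n. of_bool (q x = x)) = (\<Sum>x = 1..n. of_bool (q (y x) = y x) :: nat)"
    using sum.permute[OF carrier_permutes[OF y(1)], of "\<lambda>x. of_bool (q x = x)"] by (simp only: o_def)
  also have "\<dots> = (\<Sum>x = 1..n. of_bool (p x = x))"
    unfolding y(2) using permutes_inj[OF carrier_permutes[OF y(1)]] by (simp add: inj_eq)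
  finally show False using assms(2) by simp
qed

lemma not_conj_if_sign:
  assumes "p \<in> carrier G" and "evenperm q \<noteq> evenperm p"
  shows "q \<notin> cl p"
proof
  assume q: "q \<in> cl p"
  have perm: "permutation r" if "r \<in> carrier G" for r
    using carrier_permutes[OF that] permutation_permutes by blast
  obtain y where y: "y \<in> carrier G" "\<And>x. q (y x) = y (p x)" using clE[OF assms(1) q] by metis
  then have "q \<circ> y = y \<circ> p" by (simp add: fun_eq_iff)
  then have "evenperm (q \<circ> y) = evenperm (y \<circ> p)" by simp
  then show False
    using assms perm[OF y(1)] perm[OF assms(1)] perm[OF clD[OF assms(1) q]] by (auto simp: evenperm_comp)
qed

text \<open>
  If \<open>r\<close> conjugates \<open>u\<close> to \<open>v\<close>, then so does \<open>u\<^sup>k r\<close>. A conjugator is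
  determined by its value at \<open>z\<close>, because \<open>u\<close> is transitive on all points but at most one, so
  \<open>y\<close> equals \<open>u\<^sup>k r\<close> and is odd like \<open>r\<close>. In this way two permutations that are
  conjugate in a symmetric group are seen not to be conjugate in the alternating group.
\<close>

lemma odd_conjugator:
  assumes u: "u permutes {1..n}" "evenperm u" and r: "r permutes {1..n}" "\<not> evenperm r"
    and y: "y permutes {1..n}" and conj0: "\<And>x. v (r x) = r (u x)" and conj: "\<And>x. v (y x) = y (u x)"
    and uv: "\<And>x. u (v x) = v (u x)" and start: "y z = (u ^^ k) (r z)"
    and orbit: "\<And>x. x \<in> {1..n} - {a} \<Longrightarrow> \<exists>j. x = (u ^^ j) z"
  shows "\<not> evenperm y"
proof -
  define w where "w = u ^^ k \<circ> r"
  have uk: "(u ^^ k) permutes {1..n} \<and> evenperm (u ^^ k)" for k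
  proof (induction k)
    case (Suc k)
    have "permutation u" "permutation (u ^^ k)" using u(1) Suc permutation_permutes by blast+
    then show ?case using u Suc evenperm_comp[of u "u ^^ k"] permutes_compose[of "u ^^ k" "{1..n}" u]
      by (simp only: funpow.simps simp_thms)
  qed (simp add: permutes_id[unfolded id_def] evenperm_id[unfolded id_def])
  have ukv: "(u ^^ k) (v x) = v ((u ^^ k) x)" for x k by (induction k) (simp_all add: uv)
  have w: "w permutes {1..n}" unfolding w_def using r(1) uk by (blast intro: permutes_compose)
  have "w (u x) = v (w x)" for x by (simp add: w_def conj0[symmetric] ukv)
  then have wj: "w ((u ^^ j) x) = (v ^^ j) (w x)" for x j by (induction j) simp_all
  have yj: "y ((u ^^ j) x) = (v ^^ j) (y x)" for x j by (induction j) (simp_all add: conj[symmetric])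
  have "y = w"
  proof (rule permutes_eq_off_pair[OF y w])
    fix x assume "x \<in> {1..n} - {a, a}"
    then obtain j where "x = (u ^^ j) z" using orbit by auto
    then show "y x = w x" using wj yj start by (simp add: w_def)
  qed simp_all
  moreover have "evenperm w = (evenperm (u ^^ k) = evenperm r)" unfolding w_def
    using uk r(1) permutation_permutes by (intro evenperm_comp) blast+
  ultimately show ?thesis using uk r(2) by blast
qed

end

lemma perm_group_sym: "perm_group (sym_group n) n"
proof -
  interpret group "sym_group n" by (rule sym_group_is_group)
  show ?thesis
    by unfold_locales (simp_all add: sym_group_def finite_permutations)
qed

lemma perm_group_alt: "perm_group (alt_group n) n"
proof -
  interpret group "alt_group n" by (rule alt_group_is_group)
  show ?thesis
    by unfold_locales (auto simp: alt_group_def sym_group_def intro: finite_subset[OF _ finite_permutations[of "{1..n}"]])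
qed

section \<open>The alternating and symmetric groups of small degree\<close>

definition c2 :: "nat \<Rightarrow> nat" where "c2 = cycle_of_list [1, 2]"
definition c22 :: "nat \<Rightarrow> nat" where "c22 = cycle_of_list [1, 2] \<circ> cycle_of_list [3, 4]"
definition c3 :: "nat \<Rightarrow> nat" where "c3 = cycle_of_list [1, 2, 3]"
definition c4 :: "nat \<Rightarrow> nat" where "c4 = cycle_of_list [1, 2, 3, 4]"
definition c5 :: "nat \<Rightarrow> nat" where "c5 = cycle_of_list [1, 2, 3, 4, 5]"

lemma cycle_apply:
  "c2 x = (if x = 1 then 2 else if x = 2 then 1 else x)"
  "c22 x = (if x = 1 then 2 else if x = 2 then 1 else if x = 3 then 4 else if x = 4 then 3 else x)"
  "c3 x = (if x = 1 then 2 else if x = 2 then 3 else if x = 3 then 1 else x)"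
  "c4 x = (if x = 1 then 2 else if x = 2 then 3 else if x = 3 then 4 else if x = 4 then 1 else x)"
  "c5 x = (if x = 1 then 2 else if x = 2 then 3 else if x = 3 then 4 else if x = 4 then 5
           else if x = 5 then 1 else x)"
  by (simp_all add: c2_def c22_def c3_def c4_def c5_def Transposition.transpose_def)

lemma evenperm_cycle:
  "\<not> evenperm c2" "evenperm c22" "evenperm c3" "\<not> evenperm c4" "evenperm c5"
  by (simp_all add: c2_def c22_def c3_def c4_def c5_def evenperm_comp evenperm_swap
      permutation_swap_id permutation_compose)

lemma permutes_cycle:
  "2 \<le> n \<Longrightarrow> c2 permutes {1..n}" "4 \<le> n \<Longrightarrow> c22 permutes {1..n}" "3 \<le> n \<Longrightarrow> c3 permutes {1..n}"
  "4 \<le> n \<Longrightarrow> c4 permutes {1..n}" "5 \<le> n \<Longrightarrow> c5 permutes {1..n}"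
  unfolding c2_def c22_def c3_def c4_def c5_def cycle_of_list.simps
  by (auto intro!: permutes_compose permutes_swap_id permutes_id)

lemma atLeastAtMost_4_5: "{1..4::nat} = {1, 2, 3, 4}" "{1..5::nat} = {1, 2, 3, 4, 5}"
  by auto

context perm_group
begin

text \<open>
  A commuting permutation preserves the set of moved points \<open>{1, 2, 3}\<close>.
\<close>

lemma card_cent_3_cycle:
  assumes "s = c3 \<or> s = c3 \<circ> c3" "s \<in> carrier G" and n: "n = 4 \<or> n = 5 \<and> (\<forall>p\<in>carrier G. evenperm p)"
  shows "card (cent s) \<le> 3"
proof -
  have s: "(s 1 = 2 \<and> s 2 = 3 \<or> s 1 = 3 \<and> s 3 = 2) \<and> (\<forall>x. x \<noteq> 1 \<longrightarrow> x \<noteq> 2 \<longrightarrow> x \<noteq> 3 \<longrightarrow> s x = x)"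
    using assms(1) by (auto simp: cycle_apply)
  have "card (cent s) \<le> card {1, 2, 3::nat}"
  proof (rule card_cent_le_key[where key = "\<lambda>h. h 1" and a = 4 and b = n])
    show "h 1 \<in> {1, 2, 3}" if h: "h permutes {1..n}" and c: "\<And>x. h (s x) = s (h x)" for h
    proof (rule ccontr)
      assume "h 1 \<notin> {1, 2, 3}"
      then have "s (h 1) = h 1" using s by blast
      then have "h (s 1) = h 1" using c[of 1] by (simp only:)
      then have "s 1 = 1" using permutes_inj[OF h] by (simp only: inj_eq)
      then show False using s by auto
    qed
    show "h x = h' x" if c: "\<And>x. h (s x) = s (h x)" "\<And>x. h' (s x) = s (h' x)"
      and 1: "h 1 = h' 1" and x: "x \<in> {1..n} - {4, n}" for h h' x
    proof -
      have "h 2 = h' 2 \<and> h 3 = h' 3"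
        using s c[of 1] c[of 2] c[of 3] 1 by (elim disjE conjE) (metis+)
      moreover have "x = 1 \<or> x = 2 \<or> x = 3" using x n by auto
      ultimately show ?thesis using 1 by blast
    qed
  qed (use assms in auto)
  then show ?thesis by simp
qed

text \<open>
  A commuting permutation also permutes the blocks \<open>{1, 2}\<close> and \<open>{3, 4}\<close>, so that 1 and 3 go to
  different blocks.
\<close>

lemma card_cent_c22_le_8:
  assumes s: "c22 \<in> carrier G" and n: "n = 4"
  shows "card (cent c22) \<le> 8"
proof -
  let ?T = "{(1,3),(1,4),(2,3),(2,4),(3,1),(3,2),(4,1),(4::nat,2::nat)}"
  have "card (cent c22) \<le> card ?T"
  proof (rule card_cent_le_key[where key = "\<lambda>h. (h 1, h 3)" and a = 4 and b = 4])
    show "(h 1, h 3) \<in> ?T" if h: "h permutes {1..n}" and c: "\<And>x. h (c22 x) = c22 (h x)" for h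
    proof -
      have "h 1 \<in> {1..4}" "h 3 \<in> {1..4}" using permutes_in_image[OF h] n by simp_all
      then have e: "h 1 \<in> {1, 2, 3, 4}" "h 3 \<in> {1, 2, 3, 4}" unfolding atLeastAtMost_4_5 .
      have "h 2 = c22 (h 1)" using c[of 1] by (simp add: cycle_apply)
      moreover have "h 3 \<noteq> h 1" "h 3 \<noteq> h 2" using permutes_inj[OF h] by (simp_all add: inj_eq)
      ultimately show ?thesis using e by (elim insertE emptyE) (simp_all add: cycle_apply)
    qed
    show "h x = h' x" if c: "\<And>x. h (c22 x) = c22 (h x)" "\<And>x. h' (c22 x) = c22 (h' x)"
      and e: "(h 1, h 3) = (h' 1, h' 3)" and x: "x \<in> {1..n} - {4, 4}" for h h' x
    proof -
      have "h 2 = c22 (h 1)" "h' 2 = c22 (h' 1)" using c(1)[of 1] c(2)[of 1] by (simp_all add: cycle_apply)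
      then have "h 2 = h' 2" using e by simp
      moreover have "x = 1 \<or> x = 2 \<or> x = 3" using x n by auto
      ultimately show ?thesis using e by blast
    qed
  qed (use s in auto)
  then show ?thesis by simp
qed

lemma card_cent_c22_le_4:
  assumes s: "c22 \<in> carrier G" and n: "n = 4 \<or> n = 5" and ev: "\<forall>p\<in>carrier G. evenperm p"
  shows "card (cent c22) \<le> 4"
proof -
  have five: "h 5 = 5" if h: "h permutes {1..n}" and c: "\<And>x. h (c22 x) = c22 (h x)" for h
  proof (cases "n = 4")
    case True
    then show ?thesis using permutes_not_in[OF h, of 5] by simp
  next
    case False
    then have "h 5 \<in> {1..5}" using permutes_in_image[OF h] n by simp
    then have "h 5 \<in> {1, 2, 3, 4, 5}" unfolding atLeastAtMost_4_5 .
    moreover have "c22 (h 5) = h 5" using c[of 5] by (simp add: cycle_apply)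
    ultimately show ?thesis by (auto simp: cycle_apply)
  qed
  have "card (cent c22) \<le> card {1, 2, 3, 4::nat}"
  proof (rule card_cent_le_key[where key = "\<lambda>h. h 1" and a = 3 and b = 4])
    show "h 1 \<in> {1, 2, 3, 4}" if h: "h permutes {1..n}" and c: "\<And>x. h (c22 x) = c22 (h x)" for h
    proof -
      have "h 1 \<in> {1..5}" using permutes_in_image[OF h, of 1] n by auto
      then have "h 1 \<in> {1, 2, 3, 4, 5}" unfolding atLeastAtMost_4_5 .
      moreover have "h 1 \<noteq> h 5" using permutes_inj[OF h] by (simp add: inj_eq)
      ultimately show ?thesis using five[OF h c] by auto
    qed
    show "h x = h' x" if h: "h permutes {1..n}" "h' permutes {1..n}"
      and c: "\<And>x. h (c22 x) = c22 (h x)" "\<And>x. h' (c22 x) = c22 (h' x)"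
      and e: "h 1 = h' 1" and x: "x \<in> {1..n} - {3, 4}" for h h' x
    proof -
      have "h 2 = c22 (h 1)" "h' 2 = c22 (h' 1)" using c(1)[of 1] c(2)[of 1] by (simp_all add: cycle_apply)
      then have "h 2 = h' 2" using e by simp
      moreover have "h 5 = h' 5" using five[OF h(1) c(1)] five[OF h(2) c(2)] by simp
      moreover have "x = 1 \<or> x = 2 \<or> x = 5" using x n by auto
      ultimately show ?thesis using e by blast
    qed
  qed (use assms in auto)
  then show ?thesis by simp
qed

lemma card_cent_c2:
  assumes s: "c2 \<in> carrier G" and n: "n = 4"
  shows "card (cent c2) \<le> 4"
proof -
  have "card (cent c2) \<le> card ({1::nat, 2} \<times> {3::nat, 4})"
  proof (rule card_cent_le_key[where key = "\<lambda>h. (h 1, h 3)" and a = 4 and b = 4])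
    show "(h 1, h 3) \<in> {1, 2} \<times> {3, 4}" if h: "h permutes {1..n}" and c: "\<And>x. h (c2 x) = c2 (h x)" for h
    proof -
      have "h 3 \<in> {1..4}" using permutes_in_image[OF h] n by simp
      then have 3: "h 3 \<in> {1, 2, 3, 4}" unfolding atLeastAtMost_4_5 .
      have "h 2 = c2 (h 1)" "c2 (h 3) = h 3" using c[of 1] c[of 3] by (simp_all add: cycle_apply)
      moreover have "h 1 \<noteq> h 2" using permutes_inj[OF h] by (simp add: inj_eq)
      ultimately have "c2 (h 1) \<noteq> h 1" "c2 (h 3) = h 3" by metis+
      then show ?thesis using 3 by (auto simp: cycle_apply split: if_splits)
    qed
    show "h x = h' x" if c: "\<And>x. h (c2 x) = c2 (h x)" "\<And>x. h' (c2 x) = c2 (h' x)"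
      and e: "(h 1, h 3) = (h' 1, h' 3)" and x: "x \<in> {1..n} - {4, 4}" for h h' x
    proof -
      have "h 2 = c2 (h 1)" "h' 2 = c2 (h' 1)" using c(1)[of 1] c(2)[of 1] by (simp_all add: cycle_apply)
      then have "h 2 = h' 2" using e by simp
      moreover have "x = 1 \<or> x = 2 \<or> x = 3" using x n by auto
      ultimately show ?thesis using e by blast
    qed
  qed (use s in auto)
  then show ?thesis by simp
qed

lemma card_cent_transitive:
  assumes s: "s \<in> carrier G" and orbit: "\<And>x. x \<in> {1..n} \<Longrightarrow> \<exists>j. x = (s ^^ j) 1" and n: "1 \<le> n"
  shows "card (cent s) \<le> n"
proof -
  have "card (cent s) \<le> card {1..n}"
  proof (rule card_cent_le_key[where key = "\<lambda>h. h 1" and a = 0 and b = 0])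
    show "h 1 \<in> {1..n}" if "h permutes {1..n}" for h using permutes_in_image[OF that, of 1] n by simp
    show "h x = h' x" if c: "\<And>x. h (s x) = s (h x)" "\<And>x. h' (s x) = s (h' x)"
      and e: "h 1 = h' 1" and x: "x \<in> {1..n} - {0, 0}" for h h' x
    proof -
      have 1: "h ((s ^^ j) 1) = (s ^^ j) (h 1)" for j by (induction j) (simp_all add: c)
      have 2: "h' ((s ^^ j) 1) = (s ^^ j) (h' 1)" for j by (induction j) (simp_all add: c)
      obtain j where "x = (s ^^ j) 1" using orbit[of x] x by auto
      then show ?thesis using 1[of j] 2[of j] e by simp
    qed
  qed (use s in auto)
  then show ?thesis by simp
qed

end

lemma orbit_3: "x \<in> {1..4::nat} - {4} \<Longrightarrow> \<exists>j. x = (c3 ^^ j) 1"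
proof -
  assume "x \<in> {1..4::nat} - {4}"
  then have "x \<in> {1, 2, 3}" by auto
  moreover have "(c3 ^^ 0) 1 = 1" "(c3 ^^ 1) 1 = 2" "(c3 ^^ 2) 1 = 3"
    by (simp_all add: cycle_apply numeral_2_eq_2)
  ultimately show ?thesis by (metis insertE singletonD)
qed

lemma orbit_4: "x \<in> {1..4} \<Longrightarrow> \<exists>j. x = (c4 ^^ j) 1"
proof -
  assume "x \<in> {1..4}"
  then have "x \<in> {1, 2, 3, 4}" by auto
  moreover have "(c4 ^^ 0) 1 = 1" "(c4 ^^ 1) 1 = 2" "(c4 ^^ 2) 1 = 3" "(c4 ^^ 3) 1 = 4"
    by (simp_all add: cycle_apply numeral_2_eq_2 numeral_3_eq_3)
  ultimately show ?thesis by (metis insertE singletonD)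
qed

lemma orbit_5: "x \<in> {1..5} \<Longrightarrow> \<exists>j. x = (c5 ^^ j) 1"
proof -
  assume "x \<in> {1..5}"
  then have "x \<in> {1, 2, 3, 4, 5}" by auto
  moreover have "(c5 ^^ 0) 1 = 1" "(c5 ^^ 1) 1 = 2" "(c5 ^^ 2) 1 = 3" "(c5 ^^ 3) 1 = 4" "(c5 ^^ 4) 1 = 5"
    by (simp_all add: cycle_apply eval_nat_numeral)
  ultimately show ?thesis by (metis insertE singletonD)
qed

lemma orbit_5_square: "x \<in> {1..5} \<Longrightarrow> \<exists>j. x = ((c5 \<circ> c5) ^^ j) 1"
proof -
  assume "x \<in> {1..5}"
  then have "x \<in> {1, 2, 3, 4, 5}" by auto
  moreover have "((c5 \<circ> c5) ^^ 0) 1 = 1" "((c5 \<circ> c5) ^^ 3) 1 = 2" "((c5 \<circ> c5) ^^ 1) 1 = 3"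
    "((c5 \<circ> c5) ^^ 4) 1 = 4" "((c5 \<circ> c5) ^^ 2) 1 = 5"
    by (simp_all add: cycle_apply eval_nat_numeral)
  ultimately show ?thesis by (metis insertE singletonD)
qed

lemma nat_sum_4_5:
  fixes f :: "nat \<Rightarrow> nat"
  shows "(\<Sum>x = 1..4. f x) = f 1 + f 2 + f 3 + f 4"
  "(\<Sum>x = 1..5. f x) = f 1 + f 2 + f 3 + f 4 + f 5"
  by (simp_all add: eval_nat_numeral)

text \<open>
  Fixed points and signs separate the four classes, which contribute \<open>1/16 + 1/64 + 1/9 + 1/16 > 1/4\<close>.
\<close>

lemma kappa_sym_4: "kappa (sym_group 4) \<ge> 1 / 4"
proof -
  interpret perm_group "sym_group 4" 4 by (rule perm_group_sym)
  let ?R = "{c2, c22, c3, c4}"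
  define c where "c = (\<lambda>p. if p = c3 then 3 else if p = c22 then 8 else (4::nat))"
  have sub: "c2 \<in> carrier (sym_group 4)" "c22 \<in> carrier (sym_group 4)" "c3 \<in> carrier (sym_group 4)"
    "c4 \<in> carrier (sym_group 4)"
    using permutes_cycle[of 4] by (simp_all add: sym_group_carrier)
  have ne: "c2 \<noteq> c22" "c2 \<noteq> c3" "c2 \<noteq> c4" "c22 \<noteq> c3" "c22 \<noteq> c4" "c3 \<noteq> c4"
  proof -
    have "c2 2 \<noteq> c4 2" "c22 2 \<noteq> c3 2" "c2 3 \<noteq> c22 3" by (simp_all add: cycle_apply)
    then show "c2 \<noteq> c22" "c2 \<noteq> c3" "c2 \<noteq> c4" "c22 \<noteq> c3" "c22 \<noteq> c4" "c3 \<noteq> c4" using evenperm_cycle by metis+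
  qed
  have fix4: "(\<Sum>x = 1..4. of_bool (c2 x = x) :: nat) = 2" "(\<Sum>x = 1..4. of_bool (c22 x = x) :: nat) = 0"
    "(\<Sum>x = 1..4. of_bool (c3 x = x) :: nat) = 1" "(\<Sum>x = 1..4. of_bool (c4 x = x) :: nat) = 0"
    unfolding nat_sum_4_5 by (simp_all add: cycle_apply)
  have "(\<Sum>p\<in>?R. 1 / real (c p) ^ 2) \<le> kappa (sym_group 4)"
  proof (rule kappa_ge_representatives)
    show "q \<notin> cl p" if "p \<in> ?R" "q \<in> ?R" "p \<noteq> q" for p q
    proof -
      have "p \<in> carrier (sym_group 4)" using that(1) sub by blast
      moreover have "(\<Sum>x = 1..4. of_bool (q x = x)) \<noteq> (\<Sum>x = 1..4. of_bool (p x = x) :: nat)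
          \<or> evenperm q \<noteq> evenperm p"
        using that evenperm_cycle fix4 by (elim insertE emptyE) simp_all
      ultimately show ?thesis using not_conj_if_fixed_points not_conj_if_sign by blast
    qed
    show "card (cent p) \<le> c p" if "p \<in> ?R" for p
    proof -
      have "c c2 = 4" "c c22 = 8" "c c3 = 3" "c c4 = 4" using ne by (simp_all add: c_def)
      moreover have "card (cent c2) \<le> 4" "card (cent c22) \<le> 8"
        using sub by (auto intro: card_cent_c2 card_cent_c22_le_8)
      moreover have "card (cent c3) \<le> 3" using sub by (intro card_cent_3_cycle) auto
      moreover have "card (cent c4) \<le> 4" using sub orbit_4 by (intro card_cent_transitive) auto
      ultimately show ?thesis using that by (elim insertE emptyE) simp_all
    qed
  qed (use sub in auto)
  moreover have "(\<Sum>p\<in>?R. 1 / real (c p) ^ 2) = 1 / 16 + 1 / 64 + 1 / 9 + 1 / 16"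
    using ne by (simp add: c_def)
  ultimately show ?thesis by linarith
qed

text \<open>
  The 3-cycles form two classes, because the permutations that conjugate a 3-cycle to its square are odd. With the double
  transpositions they contribute \<open>1/16 + 1/9 + 1/9 > 1/4\<close>.
\<close>

lemma kappa_alt_4: "kappa (alt_group 4) \<ge> 1 / 4"
proof -
  interpret perm_group "alt_group 4" 4 by (rule perm_group_alt)
  let ?R = "{c22, c3, c3 \<circ> c3}"
  define c where "c = (\<lambda>p. if p = c22 then 4 else (3::nat))"
  have perm3: "permutation c3" using permutes_cycle(3)[of 4] permutation_permutes by auto
  have c3p: "c3 permutes {1..4}" using permutes_cycle(3)[of 4] by simp
  have sub: "c22 \<in> carrier (alt_group 4)" "c3 \<in> carrier (alt_group 4)" "c3 \<circ> c3 \<in> carrier (alt_group 4)"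
    using permutes_cycle(2)[of 4] c3p permutes_compose[OF c3p c3p] evenperm_cycle evenperm_comp[OF perm3 perm3]
    by (simp_all add: alt_group_carrier)
  have even: "\<forall>p\<in>carrier (alt_group 4). evenperm p" by (simp add: alt_group_carrier)
  have fix4: "(\<Sum>x = 1..4. of_bool (c22 x = x) :: nat) = 0" "(\<Sum>x = 1..4. of_bool (c3 x = x) :: nat) = 1"
    "(\<Sum>x = 1..4. of_bool ((c3 \<circ> c3) x = x) :: nat) = 1"
    unfolding nat_sum_4_5 by (simp_all add: cycle_apply)
  have "c22 2 \<noteq> c3 2" "c22 3 \<noteq> (c3 \<circ> c3) 3" "c3 2 \<noteq> (c3 \<circ> c3) 2" by (simp_all add: cycle_apply)
  then have ne: "c22 \<noteq> c3" "c22 \<noteq> c3 \<circ> c3" "c3 \<noteq> c3 \<circ> c3" by metis+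
  have nc: "c3 \<circ> c3 \<notin> cl c3"
  proof
    assume "c3 \<circ> c3 \<in> cl c3"
    then obtain y where y: "y \<in> carrier (alt_group 4)" "\<And>x. (c3 \<circ> c3) (y x) = y (c3 x)"
      using clE[OF sub(2)] by metis
    have yp: "y permutes {1..4}" using carrier_permutes[OF y(1)] .
    have "(c3 \<circ> c3) (y 1) \<noteq> y 1"
      unfolding y(2) inj_eq[OF permutes_inj[OF yp]] by (simp add: cycle_apply)
    moreover have "c3 x = x" if "x \<notin> {1, 2, 3}" for x using that by (simp add: cycle_apply)
    ultimately have "y 1 \<in> {1, 2, 3}" by (metis comp_apply)
    then have "y 1 \<in> {1..4} - {4}" by auto
    then obtain k where "y 1 = (c3 ^^ k) 1" using orbit_3 by blast
    then have start: "y 1 = (c3 ^^ k) (Transposition.transpose 2 3 1)" by (simp add: Transposition.transpose_def)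
    have "\<not> evenperm y"
    proof (rule odd_conjugator[where u = c3 and r = "Transposition.transpose 2 3" and v = "c3 \<circ> c3" and z = 1 and k = k and a = 4])
      show "Transposition.transpose 2 3 permutes {1..4::nat}" by (rule permutes_swap_id) auto
      show "\<not> evenperm (Transposition.transpose 2 (3::nat))" by (simp add: evenperm_swap)
      show "(c3 \<circ> c3) (Transposition.transpose 2 3 x) = Transposition.transpose 2 3 (c3 x)" for x
        by (simp add: cycle_apply Transposition.transpose_def)
    qed (use c3p evenperm_cycle(3) yp y(2) start orbit_3 in \<open>simp_all only: o_apply\<close>)
    then show False using even y(1) by blast
  qed
  have nc': "c3 \<notin> cl (c3 \<circ> c3)" using nc cl_sym[OF sub(3)] by blast
  have "(\<Sum>p\<in>?R. 1 / real (c p) ^ 2) \<le> kappa (alt_group 4)"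
  proof (rule kappa_ge_representatives)
    show "q \<notin> cl p" if "p \<in> ?R" "q \<in> ?R" "p \<noteq> q" for p q
    proof -
      have "p \<in> carrier (alt_group 4)" using that(1) sub by blast
      moreover have "(\<Sum>x = 1..4. of_bool (q x = x)) \<noteq> (\<Sum>x = 1..4. of_bool (p x = x) :: nat)
          \<or> p = c3 \<and> q = c3 \<circ> c3 \<or> p = c3 \<circ> c3 \<and> q = c3"
        using that by (elim insertE emptyE) (simp_all only: fix4, simp_all)
      ultimately show ?thesis using not_conj_if_fixed_points nc nc' by blast
    qed
    show "card (cent p) \<le> c p" if "p \<in> ?R" for p
    proof -
      have "c c22 = 4" "c c3 = 3" "c (c3 \<circ> c3) = 3" using ne by (simp_all add: c_def)
      moreover have "card (cent c22) \<le> 4" using sub even by (intro card_cent_c22_le_4) auto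
      moreover have "card (cent c3) \<le> 3" "card (cent (c3 \<circ> c3)) \<le> 3"
        using sub by (auto intro!: card_cent_3_cycle)
      ultimately show ?thesis using that by (elim insertE emptyE) simp_all
    qed
  qed (use sub in auto)
  moreover have "(\<Sum>p\<in>?R. 1 / real (c p) ^ 2) = 1 / 16 + 1 / 9 + 1 / 9"
    using ne by (simp add: c_def)
  ultimately show ?thesis by linarith
qed

text \<open>
  The 5-cycles form two classes, because the permutations that conjugate a 5-cycle to its square are odd. The contributions are
  \<open>1/16 + 1/9 + 1/25 + 1/25 > 1/4\<close>.
\<close>

lemma kappa_alt_5: "kappa (alt_group 5) \<ge> 1 / 4"
proof -
  interpret perm_group "alt_group 5" 5 by (rule perm_group_alt)
  let ?v = "c5 \<circ> c5"
  let ?R = "{c22, c3, c5, ?v}"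
  define c where "c = (\<lambda>p. if p = c22 then 4 else if p = c3 then 3 else (5::nat))"
  have c5p: "c5 permutes {1..5}" using permutes_cycle(5)[of 5] by simp
  have perm5: "permutation c5" using c5p permutation_permutes by auto
  have sub: "c22 \<in> carrier (alt_group 5)" "c3 \<in> carrier (alt_group 5)" "c5 \<in> carrier (alt_group 5)"
    "?v \<in> carrier (alt_group 5)"
    using permutes_cycle(2,3)[of 5] c5p permutes_compose[OF c5p c5p] evenperm_cycle evenperm_comp[OF perm5 perm5]
    by (simp_all add: alt_group_carrier)
  have even: "\<forall>p\<in>carrier (alt_group 5). evenperm p" by (simp add: alt_group_carrier)
  have fix5: "(\<Sum>x = 1..5. of_bool (c22 x = x) :: nat) = 1" "(\<Sum>x = 1..5. of_bool (c3 x = x) :: nat) = 2"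
    "(\<Sum>x = 1..5. of_bool (c5 x = x) :: nat) = 0" "(\<Sum>x = 1..5. of_bool (?v x = x) :: nat) = 0"
    unfolding nat_sum_4_5 by (simp_all add: cycle_apply)
  have "c22 2 \<noteq> c3 2" "c22 2 \<noteq> c5 2" "c22 2 \<noteq> ?v 2" "c3 5 \<noteq> c5 5" "c3 2 \<noteq> ?v 2" "c5 2 \<noteq> ?v 2"
    by (simp_all add: cycle_apply)
  then have ne: "c22 \<noteq> c3" "c22 \<noteq> c5" "c22 \<noteq> ?v" "c3 \<noteq> c5" "c3 \<noteq> ?v" "c5 \<noteq> ?v" by metis+
  have nc: "?v \<notin> cl c5"
  proof
    \<comment> \<open>Doubling modulo 5, up to a shift of the points: it takes \<open>c5\<close> to its square.\<close>
    let ?y = "cycle_of_list [2, 3, 5, 4 :: nat]"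
    assume "?v \<in> cl c5"
    then obtain y where y: "y \<in> carrier (alt_group 5)" "\<And>x. ?v (y x) = y (c5 x)"
      using clE[OF sub(3)] by metis
    have yp: "y permutes {1..5}" using carrier_permutes[OF y(1)] .
    have y0: "?y x = (if x = 2 then 3 else if x = 3 then 5 else if x = 5 then 4 else if x = 4 then 2 else x)" for x
      by (simp add: Transposition.transpose_def)
    have "y 1 \<in> {1..5}" using permutes_in_image[OF yp, of 1] by auto
    then obtain k where "y 1 = (c5 ^^ k) 1" using orbit_5 by blast
    then have start: "y 1 = (c5 ^^ k) (?y 1)" unfolding y0 by simp
    have "\<not> evenperm y"
    proof (rule odd_conjugator[where u = c5 and r = ?y and v = ?v and z = 1 and k = k and a = 0])
      show "?y permutes {1..5}" unfolding cycle_of_list.simps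
        by (auto intro!: permutes_compose permutes_swap_id permutes_id)
      show "\<not> evenperm ?y"
        by (simp add: evenperm_comp evenperm_swap permutation_swap_id permutation_compose)
      show "?v (?y x) = ?y (c5 x)" for x unfolding y0 by (simp add: cycle_apply)
      show "\<exists>j. x = (c5 ^^ j) 1" if "x \<in> {1..5} - {0}" for x using orbit_5[of x] that by blast
    qed (use c5p evenperm_cycle(5) yp y(2) start in \<open>simp_all only: o_apply\<close>)
    then show False using even y(1) by blast
  qed
  have nc': "c5 \<notin> cl ?v" using nc cl_sym[OF sub(4)] by blast
  have "(\<Sum>p\<in>?R. 1 / real (c p) ^ 2) \<le> kappa (alt_group 5)"
  proof (rule kappa_ge_representatives)
    show "q \<notin> cl p" if "p \<in> ?R" "q \<in> ?R" "p \<noteq> q" for p q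
    proof -
      have "p \<in> carrier (alt_group 5)" using that(1) sub by blast
      moreover have "(\<Sum>x = 1..5. of_bool (q x = x)) \<noteq> (\<Sum>x = 1..5. of_bool (p x = x) :: nat)
          \<or> p = c5 \<and> q = ?v \<or> p = ?v \<and> q = c5"
        using that by (elim insertE emptyE) (simp_all only: fix5, simp_all)
      ultimately show ?thesis using not_conj_if_fixed_points nc nc' by blast
    qed
    show "card (cent p) \<le> c p" if "p \<in> ?R" for p
    proof -
      have "c c22 = 4" "c c3 = 3" "c c5 = 5" "c ?v = 5" using ne by (auto simp: c_def)
      moreover have "card (cent c22) \<le> 4" using sub even by (intro card_cent_c22_le_4) auto
      moreover have "card (cent c3) \<le> 3" using sub even by (intro card_cent_3_cycle) auto
      moreover have "card (cent c5) \<le> 5" using sub orbit_5 by (intro card_cent_transitive) auto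
      moreover have "card (cent ?v) \<le> 5" using sub orbit_5_square by (intro card_cent_transitive) auto
      ultimately show ?thesis using that by (elim insertE emptyE) simp_all
    qed
  qed (use sub in auto)
  moreover have "(\<Sum>p\<in>?R. 1 / real (c p) ^ 2) = 1 / 16 + 1 / 9 + 1 / 25 + 1 / 25"
    using ne by (simp add: c_def)
  ultimately show ?thesis by linarith
qed

section \<open>The characterization\<close>

theorem theorem1p3:
  fixes G :: "('a, 'b) monoid_scheme"
  assumes "group G" and "finite (carrier G)" and "\<not> trivial_group G"
  shows "kappa G \<ge> 1 / 4 \<longleftrightarrow>
    Coset.order G \<le> 4 \<or>
    (G \<cong> alt_group 4 \<or> G \<cong> sym_group 4 \<or> G \<cong> alt_group 5 \<or> G \<cong> frobenius21) \<or>
    (\<exists>A :: 'a monoid. comm_group A \<and> finite (carrier A) \<and> \<not> trivial_group A \<and> odd (Coset.order A) \<and>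
       G \<cong> inversion_extension A)"
proof -
  interpret group G by fact
  interpret finite_grp G by unfold_locales fact
  show ?thesis
  proof
    assume k: "kappa G \<ge> 1 / 4"
    show "Coset.order G \<le> 4 \<or>
      (G \<cong> alt_group 4 \<or> G \<cong> sym_group 4 \<or> G \<cong> alt_group 5 \<or> G \<cong> frobenius21) \<or>
      (\<exists>A :: 'a monoid. comm_group A \<and> finite (carrier A) \<and> \<not> trivial_group A \<and> odd (Coset.order A) \<and>
         G \<cong> inversion_extension A)"
    proof (cases "Coset.order G \<le> 4")
      case False
      then have o4: "4 < Coset.order G" by simp
      have "\<not> trivial_group A" if "2 * Coset.order A = Coset.order G" for A :: "'a monoid"
        using that o4 by (auto simp: trivial_group_def order_def)
      then show ?thesis using kappa_classification[OF k o4] by blast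
    qed simp
  next
    assume R: "Coset.order G \<le> 4 \<or>
      (G \<cong> alt_group 4 \<or> G \<cong> sym_group 4 \<or> G \<cong> alt_group 5 \<or> G \<cong> frobenius21) \<or>
      (\<exists>A :: 'a monoid. comm_group A \<and> finite (carrier A) \<and> \<not> trivial_group A \<and> odd (Coset.order A) \<and>
         G \<cong> inversion_extension A)"
    note iso = kappa_iso[OF finite_grp_axioms]
    have "kappa frobenius21 = kappa C7_C3"
    proof (rule kappa_iso[OF _ group_C7_C3 frobenius21_iso])
      have "group frobenius21" unfolding frobenius21_def by (rule group_presented_group)
      moreover have "finite (carrier frobenius21)"
      proof -
        obtain f where "f \<in> iso frobenius21 C7_C3" using frobenius21_iso by (auto simp: is_iso_def)
        then have "bij_betw f (carrier frobenius21) (carrier C7_C3)" by (simp add: iso_def)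
        then show ?thesis using bij_betw_finite[of f] by (simp add: C7_C3_simps)
      qed
      ultimately show "finite_grp frobenius21" by (simp add: finite_grp_def finite_grp_axioms_def)
    qed
    moreover have "group frobenius21" unfolding frobenius21_def by (rule group_presented_group)
    ultimately have f21: "kappa G \<ge> 1 / 4" if "G \<cong> frobenius21"
      using iso[OF _ that] kappa_C7_C3 by simp
    have small: "kappa G \<ge> 1 / 4" if "Coset.order G \<le> 4"
    proof -
      have "1 / 4 \<le> 1 / real (Coset.order G)" using that order_pos by (intro divide_left_mono) auto
      then show ?thesis using kappa_ge_inverse_order by linarith
    qed
    have ext: "kappa G \<ge> 1 / 4" if "comm_group A" "finite (carrier A)" "odd (Coset.order A)"
      "G \<cong> inversion_extension A" for A :: "'a monoid"
      using iso[OF group_inversion_extension[OF that(1)] that(4)] kappa_inversion_extension[OF that(1-3)] by simp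
    show "kappa G \<ge> 1 / 4"
      using R
    proof (elim disjE exE conjE)
      assume "G \<cong> alt_group 4"
      then show ?thesis using iso[OF alt_group_is_group] kappa_alt_4 by simp
    next
      assume "G \<cong> sym_group 4"
      then show ?thesis using iso[OF sym_group_is_group] kappa_sym_4 by simp
    next
      assume "G \<cong> alt_group 5"
      then show ?thesis using iso[OF alt_group_is_group] kappa_alt_5 by simp
    qed (use small f21 ext in blast)+
  qed
qed

end
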